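(* Let $\alpha,\beta\in\mathbb R$ with $\alpha^2+\beta^2=1$, let $(\omega(t),\psi_\pm(t))$ be a one-parameter family of $\mathrm{SU}(3)$-structures on a 6-manifold $M^6$, let $f(t)$ be a family of non-vanishing functions that are constant on $M^6$ for each $t$, and suppose the warped $\mathrm{G}_2$-structures $\varphi(t)=f(t)\,\omega(t)\wedge ds+(\alpha\psi_+(t)-\beta\psi_-(t))$ on $M^6\times S^1$ are coclosed for all $t$. Then the Laplacian coflow equation for $\varphi(t)$ is equivalent to the system $$\begin{cases}\dfrac{\partial\omega^2(t)}{\partial t}=-3(\alpha\pi_0(t)-\beta\sigma_0(t))^2\omega^2(t)+3(\alpha\pi_0(t)-\beta\sigma_0(t))(\alpha\pi_2(t)-\beta\sigma_2(t))\wedge\omega(t)\\ \qquad\qquad+2d_6(\ast_6\nu_3(t))-3d_6(\alpha\pi_0(t)-\beta\sigma_0(t))\wedge(\alpha\psi_+(t)-\beta\psi_-(t)),\\[6pt] \dfrac{f'(t)}{f(t)}\big(\beta\psi_+(t)+\alpha\psi_-(t)\big)+\Big(\beta\dfrac{\partial\psi_+(t)}{\partial t}+\alpha\dfrac{\partial\psi_-(t)}{\partial t}\Big)=\\ \qquad\qquad-(\alpha\pi_0(t)-\beta\sigma_0(t))\big[-3\sigma_0(t)\psi_+(t)+3\pi_0(t)\psi_-(t)+2\nu_3(t)\big]\\ \qquad\qquad-d_6(\alpha\pi_2(t)-\beta\sigma_2(t))-2d_6(\alpha\pi_0(t)-\beta\sigma_0(t))\wedge\omega(t),\end{cases}$$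 where $\alpha\sigma_i(t)+\beta\pi_i(t)=0$ for $i=0,2$.
   Context: $\mathrm{SU}(3)$-structures. An $\mathrm{SU}(3)$-structure on a 6-manifold $M^6$ is a triple $(\omega,\psi_+,\psi_-)$ of a 2-form and two 3-forms such that locally there is a coframe $\{e^1,\dots,e^6\}$ (an adapted basis) with $\omega=e^{12}+e^{34}+e^{56}$, $\psi_+=e^{135}-e^{146}-e^{236}-e^{245}$, $\psi_-=-e^{246}+e^{235}+e^{145}+e^{136}$, where $e^{ij}=e^i\wedge e^j$, etc. The induced metric $g_{\omega,\psi_\pm}$ is the one for which adapted bases are orthonormal, the volume form is $vol_6=\frac1{3!}\omega^3=e^{123456}$, and $\ast_6$ is the corresponding Hodge star. $d_6$ denotes the exterior derivative on $M^6$. Put $\Omega^2_8(M^6)=\{\sigma\in\Omega^2(M^6):\sigma\wedge\psi_+=0,\ \ast_6\sigma=-\sigma\wedge\omega\}$ and $\Omega^3_{12}(M^6)=\{\gamma\in\Omega^3(M^6):\gamma\wedge\omega=0,\ \gamma\wedge\psi_\pm=0\}$. The torsion forms are the functions $\sigma_0,\pi_0$, 1-forms $\pi_1,\nu_1$, 2-forms $\pi_2,\sigma_2\in\Omega^2_8(M^6)$ and 3-form $\nu_3\in\Omega^3_{12}(M^6)$ determined by $$d\omega=-\tfrac32\sigma_0\psi_++\tfrac32\pi_0\psi_-+\nu_1\wedge\omega+\nu_3,\quad d\psi_+=\pi_0\omega^2+\pi_1\wedge\psi_+-\pi_2\wedge\omega,\quad d\psi_-=\sigma_0\omega^2+\pi_1\wedge\psi_--\sigma_2\wedge\omega.$$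 For a family $(\omega(t),\psi_\pm(t))$, the torsion forms at time $t$ are denoted $\sigma_0(t),\pi_0(t)$, etc., and $\ast_6$ is the Hodge star of the structure at time $t$. Warped $\mathrm{G}_2$-structures. $s$ is the coordinate on $S^1$. The 3-form $\varphi=f\,\omega\wedge ds+(\alpha\psi_+-\beta\psi_-)$ on $M^6\times S^1$ is a $\mathrm{G}_2$-structure with metric $g_{\omega,\psi_\pm}+f^2ds^2$, volume form $f\,vol_6\wedge ds$, and Hodge dual $\frac12\omega^2+f(\alpha\psi_-+\beta\psi_+)\wedge ds$; it is coclosed if this 4-form is closed. Laplacian coflow. A family of $\mathrm{G}_2$-structures $\varphi(t)$ solves the Laplacian coflow if $\frac{\partial}{\partial t}(\ast_t\varphi(t))=-\Delta_t(\ast_t\varphi(t))$ and $d_7(\ast_t\varphi(t))=0$, where $d_7$ is the exterior derivative on the 7-manifold and $\ast_t$, $\Delta_t$ are the Hodge star and the Hodge Laplacian ($\Delta=dd^*+d^*d$) induced by $\varphi(t)$. *)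

theory Defs
  imports "HOL-Analysis.Analysis" "HOL-Library.Function_Algebras"
begin

text \<open>Sums, differences, negatives and the zero form are the pointwise operations on functions.\<close>


section \<open>Smooth manifolds\<close>

primrec Ck_on :: "nat \<Rightarrow> 'a::real_normed_vector set \<Rightarrow> ('a \<Rightarrow> 'b::real_normed_vector) \<Rightarrow> bool" where
  "Ck_on 0 S f \<longleftrightarrow> continuous_on S f"
| "Ck_on (Suc n) S f \<longleftrightarrow> (\<forall>x\<in>S. f differentiable (at x)) \<and>
     (\<forall>v. Ck_on n S (\<lambda>x. frechet_derivative f (at x) v))"

text \<open>Only used for open \<open>S\<close>: derivatives are taken at the point, not within \<open>S\<close>.\<close>

definition smooth_on :: "'a::real_normed_vector set \<Rightarrow> ('a \<Rightarrow> 'b::real_normed_vector) \<Rightarrow> bool" where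
  "smooth_on S f \<longleftrightarrow> (\<forall>n. Ck_on n S f)"

text \<open>An atlas is a family of charts (domain, coordinate map) indexed by the whole type \<open>'i\<close>.
  The coordinate map is only meaningful on the domain.\<close>

type_synonym ('i, 'm, 'e) atlas = "'i \<Rightarrow> 'm set \<times> ('m \<Rightarrow> 'e)"

definition chart_dom :: "('i, 'm, 'e) atlas \<Rightarrow> 'i \<Rightarrow> 'm set" where
  "chart_dom A i = fst (A i)"

definition coord :: "('i, 'm, 'e) atlas \<Rightarrow> 'i \<Rightarrow> 'm \<Rightarrow> 'e" where
  "coord A i = snd (A i)"

definition img :: "('i, 'm, 'e) atlas \<Rightarrow> 'i \<Rightarrow> 'e set" where
  "img A i = coord A i ` chart_dom A i"

definition transition :: "('i, 'm, 'e) atlas \<Rightarrow> 'i \<Rightarrow> 'i \<Rightarrow> 'e \<Rightarrow> 'e" where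
  "transition A i j = coord A j \<circ> inv_into (chart_dom A i) (coord A i)"

definition smooth_manifold ::
  "'m::{t2_space, second_countable_topology} set \<Rightarrow> ('i, 'm, 'e::euclidean_space) atlas \<Rightarrow> bool" where
  "smooth_manifold M A \<longleftrightarrow>
     (\<Union>i. chart_dom A i) = M \<and>
     (\<forall>i. openin (top_of_set M) (chart_dom A i) \<and> open (img A i) \<and>
          (\<exists>h. homeomorphism (chart_dom A i) (img A i) (coord A i) h)) \<and>
     (\<forall>i j. smooth_on (coord A i ` (chart_dom A i \<inter> chart_dom A j)) (transition A i j))"

definition prod_atlas ::
  "('i, 'm, 'e) atlas \<Rightarrow> ('j, 'n, 'f) atlas \<Rightarrow> ('i \<times> 'j, 'm \<times> 'n, 'e \<times> 'f) atlas" where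
  "prod_atlas A B = (\<lambda>(i, j). (chart_dom A i \<times> chart_dom B j, map_prod (coord A i) (coord B j)))"

text \<open>The unit circle in the complex plane, with the angle \<open>s\<close> as coordinate: for every real \<open>a\<close>
  there is the chart given by the branch of the angle in \<open>(a, a + 2\<pi>)\<close>.\<close>

definition circle_atlas :: "(real, complex, real) atlas" where
  "circle_atlas a = (cis ` {a<..<a + 2 * pi}, inv_into {a<..<a + 2 * pi} cis)"


section \<open>Exterior algebra of a vector space\<close>

text \<open>A \<open>k\<close>-covector is an alternating \<open>k\<close>-linear function of a list of \<open>k\<close> vectors; to make
  equality of covectors equality of functions, it is zero on lists of any other length.\<close>

definition alternating_map :: "nat \<Rightarrow> ('e::real_vector list \<Rightarrow> real) \<Rightarrow> bool" where
  "alternating_map k a \<longleftrightarrow>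
     (\<forall>vs. length vs \<noteq> k \<longrightarrow> a vs = 0) \<and>
     (\<forall>vs i. length vs = k \<and> i < k \<longrightarrow> linear (\<lambda>v. a (vs[i := v]))) \<and>
     (\<forall>vs i j. length vs = k \<and> i < j \<and> j < k \<and> vs ! i = vs ! j \<longrightarrow> a vs = 0)"

text \<open>The wedge product as the signed sum over shuffles. A shuffle is given by the set \<open>S\<close> of the
  positions of the arguments that go to the first factor; its sign counts inversions. Splittings
  of the wrong degree contribute zero. The normalisation is
  \<open>(a \<and> b)(u, v) = a(u) b(v) - a(v) b(u)\<close> for 1-covectors.\<close>

definition wedge :: "('e list \<Rightarrow> real) \<Rightarrow> ('e list \<Rightarrow> real) \<Rightarrow> 'e list \<Rightarrow> real" where
  "wedge a b vs =
     (\<Sum>S\<in>Pow {..<length vs}.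
        (-1) ^ card {(i, j). i \<in> S \<and> j \<in> {..<length vs} - S \<and> j < i} *
        a (nths vs S) * b (nths vs ({..<length vs} - S)))"

text \<open>\<open>coframe_monom e [i, j, k]\<close> is the wedge product of \<open>e i\<close>, \<open>e j\<close>, \<open>e k\<close>.\<close>

primrec coframe_monom :: "(nat \<Rightarrow> 'e list \<Rightarrow> real) \<Rightarrow> nat list \<Rightarrow> 'e list \<Rightarrow> real" where
  "coframe_monom e [] = (\<lambda>vs. if vs = [] then 1 else 0)"
| "coframe_monom e (i # is) = wedge (e i) (coframe_monom e is)"

text \<open>Coframes (bases of the dual space) are indexed from 1.\<close>

definition coframe :: "(nat \<Rightarrow> 'e::euclidean_space list \<Rightarrow> real) \<Rightarrow> bool" where
  "coframe e \<longleftrightarrow>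
     (\<forall>k\<in>{1..DIM('e)}. alternating_map 1 (e k)) \<and>
     (\<forall>c. (\<forall>v. (\<Sum>k = 1..DIM('e). c k * e k [v]) = 0) \<longrightarrow> (\<forall>k\<in>{1..DIM('e)}. c k = 0))"

text \<open>The inner product for which the coframe is orthonormal.\<close>

definition coframe_metric :: "(nat \<Rightarrow> 'e::euclidean_space list \<Rightarrow> real) \<Rightarrow> 'e \<Rightarrow> 'e \<Rightarrow> real" where
  "coframe_metric e u v = (\<Sum>k = 1..DIM('e). e k [u] * e k [v])"

definition orthonormal_basis :: "('e::euclidean_space \<Rightarrow> 'e \<Rightarrow> real) \<Rightarrow> (nat \<Rightarrow> 'e) \<Rightarrow> bool" where
  "orthonormal_basis g b \<longleftrightarrow>
     (\<forall>i\<in>{1..DIM('e)}. \<forall>j\<in>{1..DIM('e)}. g (b i) (b j) = (if i = j then 1 else 0))"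

text \<open>The Hodge star for an inner product \<open>g\<close> and a volume form \<open>vol\<close>: for a \<open>k\<close>-covector \<open>a\<close>, in
  dimension \<open>n\<close>, and any orthonormal basis \<open>b\<close>,
  \<open>(*a)(v\<^sub>1, \<dots>, v\<^sub>n\<^sub>-\<^sub>k) = \<Sum> a(b\<^sub>I) vol(b\<^sub>I, v\<^sub>1, \<dots>, v\<^sub>n\<^sub>-\<^sub>k)\<close> over increasing multi-indices
  \<open>I\<close> of length \<open>k\<close>. This is the convention \<open>c \<and> *a = g(c, a) vol\<close>.\<close>

definition hodge :: "('e::euclidean_space \<Rightarrow> 'e \<Rightarrow> real) \<Rightarrow> ('e list \<Rightarrow> real) \<Rightarrow>
    ('e list \<Rightarrow> real) \<Rightarrow> 'e list \<Rightarrow> real" where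
  "hodge g vol a vs =
     (let b = (SOME b. orthonormal_basis g b) in
      if length vs \<le> DIM('e) then
        (\<Sum>I | I \<subseteq> {1..DIM('e)} \<and> card I = DIM('e) - length vs.
           a (map b (sorted_list_of_set I)) * vol (map b (sorted_list_of_set I) @ vs))
      else 0)"


section \<open>Differential forms\<close>

text \<open>A differential form on a manifold is given by its local representatives \<open>F i\<close> on the images
  of the charts, which are related by pull-back along the transition maps. Representatives are
  zero outside the image, so that equality of forms is equality of functions. Functions on the
  manifold are 0-forms, and multiplication by a function is the wedge product with it.\<close>

type_synonym ('i, 'e) form = "'i \<Rightarrow> 'e \<Rightarrow> 'e list \<Rightarrow> real"

definition is_form :: "('i, 'm, 'e::euclidean_space) atlas \<Rightarrow> nat \<Rightarrow> ('i, 'e) form \<Rightarrow> bool" where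
  "is_form A k F \<longleftrightarrow>
     (\<forall>i x. alternating_map k (F i x)) \<and>
     (\<forall>i x. x \<notin> img A i \<longrightarrow> F i x = 0) \<and>
     (\<forall>i vs. smooth_on (img A i) (\<lambda>x. F i x vs)) \<and>
     (\<forall>i j vs. \<forall>p \<in> chart_dom A i \<inter> chart_dom A j.
        F i (coord A i p) vs =
        F j (coord A j p) (map (frechet_derivative (transition A i j) (at (coord A i p))) vs))"

definition form_scale :: "real \<Rightarrow> ('i, 'e) form \<Rightarrow> ('i, 'e) form" (infixr "*\<^sub>F" 75) where
  "c *\<^sub>F F = (\<lambda>i x vs. c * F i x vs)"

definition form_wedge :: "('i, 'e) form \<Rightarrow> ('i, 'e) form \<Rightarrow> ('i, 'e) form" (infixr "\<and>\<^sub>F" 80) where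
  "F \<and>\<^sub>F G = (\<lambda>i x. wedge (F i x) (G i x))"

text \<open>In each chart, \<open>dF(v\<^sub>0, \<dots>, v\<^sub>k) = \<Sum>\<^sub>j (-1)\<^sup>j D\<^bsub>v\<^sub>j\<^esub> F(v\<^sub>0, \<dots>, v\<^sub>k without v\<^sub>j)\<close>.\<close>

definition ext_d :: "('i, 'm, 'e::euclidean_space) atlas \<Rightarrow> ('i, 'e) form \<Rightarrow> ('i, 'e) form" where
  "ext_d A F = (\<lambda>i x vs.
     if x \<in> img A i then
       (\<Sum>j<length vs. (-1) ^ j *
          frechet_derivative (\<lambda>y. F i y (take j vs @ drop (Suc j) vs)) (at x) (vs ! j))
     else 0)"

text \<open>Pull-back along the two projections of a product manifold.\<close>

definition pull_fst :: "('i, 'm, 'e) atlas \<Rightarrow> ('j, 'n, 'f) atlas \<Rightarrow>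
    ('i, 'e) form \<Rightarrow> ('i \<times> 'j, 'e \<times> 'f) form" where
  "pull_fst A B F = (\<lambda>(i, j) (x, y) vs.
     if (x, y) \<in> img (prod_atlas A B) (i, j) then F i x (map fst vs) else 0)"

definition pull_snd :: "('i, 'm, 'e) atlas \<Rightarrow> ('j, 'n, 'f) atlas \<Rightarrow>
    ('j, 'f) form \<Rightarrow> ('i \<times> 'j, 'e \<times> 'f) form" where
  "pull_snd A B G = (\<lambda>(i, j) (x, y) vs.
     if (x, y) \<in> img (prod_atlas A B) (i, j) then G j y (map snd vs) else 0)"

text \<open>The 1-form \<open>ds\<close> on the circle.\<close>

definition circle_ds :: "(real, real) form" where
  "circle_ds = (\<lambda>a s vs. if s \<in> img circle_atlas a \<and> length vs = 1 then hd vs else 0)"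

text \<open>A metric and a volume form are given by their local representatives, like forms.\<close>

definition form_hodge :: "('i \<Rightarrow> 'e \<Rightarrow> 'e::euclidean_space \<Rightarrow> 'e \<Rightarrow> real) \<Rightarrow> ('i, 'e) form \<Rightarrow>
    ('i, 'e) form \<Rightarrow> ('i, 'e) form" where
  "form_hodge g vol F = (\<lambda>i x. hodge (g i x) (vol i x) (F i x))"

text \<open>The codifferential of a \<open>k\<close>-form on a Riemannian \<open>n\<close>-manifold is
  \<open>(-1)\<^bsup>n(k+1)+1\<^esup> * d *\<close>.\<close>

definition codiff :: "('i, 'm, 'e::euclidean_space) atlas \<Rightarrow> ('i \<Rightarrow> 'e \<Rightarrow> 'e \<Rightarrow> 'e \<Rightarrow> real) \<Rightarrow>
    ('i, 'e) form \<Rightarrow> nat \<Rightarrow> ('i, 'e) form \<Rightarrow> ('i, 'e) form" where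
  "codiff A g vol k F =
     (-1) ^ (DIM('e) * (k + 1) + 1) *\<^sub>F form_hodge g vol (ext_d A (form_hodge g vol F))"

definition hodge_laplacian :: "('i, 'm, 'e::euclidean_space) atlas \<Rightarrow>
    ('i \<Rightarrow> 'e \<Rightarrow> 'e \<Rightarrow> 'e \<Rightarrow> real) \<Rightarrow> ('i, 'e) form \<Rightarrow> nat \<Rightarrow> ('i, 'e) form \<Rightarrow> ('i, 'e) form" where
  "hodge_laplacian A g vol k F =
     ext_d A (codiff A g vol k F) + codiff A g vol (k + 1) (ext_d A F)"

text \<open>Differentiation in time at a fixed point; \<open>T\<close> is the time interval.\<close>

definition time_differentiable :: "real set \<Rightarrow> (real \<Rightarrow> ('i, 'e) form) \<Rightarrow> bool" where
  "time_differentiable T F \<longleftrightarrow>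
     (\<forall>t\<in>T. \<forall>i x vs. (\<lambda>s. F s i x vs) differentiable (at t within T))"

definition time_deriv :: "real set \<Rightarrow> (real \<Rightarrow> ('i, 'e) form) \<Rightarrow> real \<Rightarrow> ('i, 'e) form" where
  "time_deriv T F t = (\<lambda>i x vs. vector_derivative (\<lambda>s. F s i x vs) (at t within T))"

text \<open>Every point has a neighbourhood with a smooth coframe satisfying \<open>P\<close> at each point.\<close>

definition has_local_coframes :: "('i, 'm, 'e::euclidean_space) atlas \<Rightarrow>
    ('i \<Rightarrow> 'e \<Rightarrow> (nat \<Rightarrow> 'e list \<Rightarrow> real) \<Rightarrow> bool) \<Rightarrow> bool" where
  "has_local_coframes A P \<longleftrightarrow>
     (\<forall>i. \<forall>x\<in>img A i. \<exists>W e. open W \<and> x \<in> W \<and> W \<subseteq> img A i \<and>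
        (\<forall>k\<in>{1..DIM('e)}. \<forall>v. smooth_on W (\<lambda>y. e y k [v])) \<and>
        (\<forall>y\<in>W. coframe (e y) \<and> P i y (e y)))"


section \<open>SU(3)-structures\<close>

definition su3_adapted :: "('e::euclidean_space list \<Rightarrow> real) \<Rightarrow> ('e list \<Rightarrow> real) \<Rightarrow>
    ('e list \<Rightarrow> real) \<Rightarrow> (nat \<Rightarrow> 'e list \<Rightarrow> real) \<Rightarrow> bool" where
  "su3_adapted w p m e \<longleftrightarrow>
     w = coframe_monom e [1,2] + coframe_monom e [3,4] + coframe_monom e [5,6] \<and>
     p = coframe_monom e [1,3,5] - coframe_monom e [1,4,6] - coframe_monom e [2,3,6] - coframe_monom e [2,4,5] \<and>
     m = - coframe_monom e [2,4,6] + coframe_monom e [2,3,5] + coframe_monom e [1,4,5] + coframe_monom e [1,3,6]"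

definition su3_structure :: "('i, 'm, real^6) atlas \<Rightarrow>
    ('i, real^6) form \<Rightarrow> ('i, real^6) form \<Rightarrow> ('i, real^6) form \<Rightarrow> bool" where
  "su3_structure A \<omega> \<psi>p \<psi>m \<longleftrightarrow>
     is_form A 2 \<omega> \<and> is_form A 3 \<psi>p \<and> is_form A 3 \<psi>m \<and>
     has_local_coframes A (\<lambda>i y. su3_adapted (\<omega> i y) (\<psi>p i y) (\<psi>m i y))"

definition su3_metric :: "('i, real^6) form \<Rightarrow> ('i, real^6) form \<Rightarrow> ('i, real^6) form \<Rightarrow>
    'i \<Rightarrow> real^6 \<Rightarrow> real^6 \<Rightarrow> real^6 \<Rightarrow> real" where
  "su3_metric \<omega> \<psi>p \<psi>m i x =
     (THE g. \<exists>e. coframe e \<and> su3_adapted (\<omega> i x) (\<psi>p i x) (\<psi>m i x) e \<and> g = coframe_metric e)"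

definition su3_star :: "('i, real^6) form \<Rightarrow> ('i, real^6) form \<Rightarrow> ('i, real^6) form \<Rightarrow>
    ('i, real^6) form \<Rightarrow> ('i, real^6) form" where
  "su3_star \<omega> \<psi>p \<psi>m = form_hodge (su3_metric \<omega> \<psi>p \<psi>m) ((1 / fact 3) *\<^sub>F (\<omega> \<and>\<^sub>F \<omega> \<and>\<^sub>F \<omega>))"

definition Omega2_8 :: "('i, 'm, real^6) atlas \<Rightarrow> ('i, real^6) form \<Rightarrow> ('i, real^6) form \<Rightarrow>
    ('i, real^6) form \<Rightarrow> ('i, real^6) form set" where
  "Omega2_8 A \<omega> \<psi>p \<psi>m =
     {\<sigma>. is_form A 2 \<sigma> \<and> \<sigma> \<and>\<^sub>F \<psi>p = 0 \<and> su3_star \<omega> \<psi>p \<psi>m \<sigma> = - (\<sigma> \<and>\<^sub>F \<omega>)}"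

definition Omega3_12 :: "('i, 'm, real^6) atlas \<Rightarrow> ('i, real^6) form \<Rightarrow> ('i, real^6) form \<Rightarrow>
    ('i, real^6) form \<Rightarrow> ('i, real^6) form set" where
  "Omega3_12 A \<omega> \<psi>p \<psi>m =
     {\<gamma>. is_form A 3 \<gamma> \<and> \<gamma> \<and>\<^sub>F \<omega> = 0 \<and> \<gamma> \<and>\<^sub>F \<psi>p = 0 \<and> \<gamma> \<and>\<^sub>F \<psi>m = 0}"

definition su3_torsion_forms :: "('i, 'm, real^6) atlas \<Rightarrow>
    ('i, real^6) form \<Rightarrow> ('i, real^6) form \<Rightarrow> ('i, real^6) form \<Rightarrow>
    ('i, real^6) form \<Rightarrow> ('i, real^6) form \<Rightarrow> ('i, real^6) form \<Rightarrow> ('i, real^6) form \<Rightarrow>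
    ('i, real^6) form \<Rightarrow> ('i, real^6) form \<Rightarrow> ('i, real^6) form \<Rightarrow> bool" where
  "su3_torsion_forms A \<omega> \<psi>p \<psi>m \<sigma>0 \<pi>0 \<pi>1 \<nu>1 \<pi>2 \<sigma>2 \<nu>3 \<longleftrightarrow>
     is_form A 0 \<sigma>0 \<and> is_form A 0 \<pi>0 \<and> is_form A 1 \<pi>1 \<and> is_form A 1 \<nu>1 \<and>
     \<pi>2 \<in> Omega2_8 A \<omega> \<psi>p \<psi>m \<and> \<sigma>2 \<in> Omega2_8 A \<omega> \<psi>p \<psi>m \<and> \<nu>3 \<in> Omega3_12 A \<omega> \<psi>p \<psi>m \<and>
     ext_d A \<omega> = (-3/2) *\<^sub>F (\<sigma>0 \<and>\<^sub>F \<psi>p) + (3/2) *\<^sub>F (\<pi>0 \<and>\<^sub>F \<psi>m) + \<nu>1 \<and>\<^sub>F \<omega> + \<nu>3 \<and>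
     ext_d A \<psi>p = \<pi>0 \<and>\<^sub>F \<omega> \<and>\<^sub>F \<omega> + \<pi>1 \<and>\<^sub>F \<psi>p - \<pi>2 \<and>\<^sub>F \<omega> \<and>
     ext_d A \<psi>m = \<sigma>0 \<and>\<^sub>F \<omega> \<and>\<^sub>F \<omega> + \<pi>1 \<and>\<^sub>F \<psi>m - \<sigma>2 \<and>\<^sub>F \<omega>"


section \<open>\<open>G\<^sub>2\<close>-structures and the Laplacian coflow\<close>

text \<open>The model is \<open>\<omega> \<and> e\<^sup>7 + \<psi>\<^sub>+\<close>. The orientation is the one of \<open>e\<^sup>1 \<and> \<dots> \<and> e\<^sup>7\<close>.\<close>

definition g2_adapted :: "('e::euclidean_space list \<Rightarrow> real) \<Rightarrow>
    (nat \<Rightarrow> 'e list \<Rightarrow> real) \<Rightarrow> bool" where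
  "g2_adapted p e \<longleftrightarrow>
     p = coframe_monom e [1,2,7] + coframe_monom e [3,4,7] + coframe_monom e [5,6,7] +
         coframe_monom e [1,3,5] - coframe_monom e [1,4,6] - coframe_monom e [2,3,6] - coframe_monom e [2,4,5]"

text \<open>The remaining definitions only make sense for \<open>DIM('e) = 7\<close>.\<close>

definition g2_structure :: "('i, 'm, 'e::euclidean_space) atlas \<Rightarrow> ('i, 'e) form \<Rightarrow> bool" where
  "g2_structure A \<phi> \<longleftrightarrow>
     DIM('e) = 7 \<and> is_form A 3 \<phi> \<and> has_local_coframes A (\<lambda>i y. g2_adapted (\<phi> i y))"

definition g2_metric :: "('i, 'e::euclidean_space) form \<Rightarrow> 'i \<Rightarrow> 'e \<Rightarrow> 'e \<Rightarrow> 'e \<Rightarrow> real" where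
  "g2_metric \<phi> i x =
     (THE g. \<exists>e. coframe e \<and> g2_adapted (\<phi> i x) e \<and> g = coframe_metric e)"

definition g2_volume :: "('i, 'e::euclidean_space) form \<Rightarrow> ('i, 'e) form" where
  "g2_volume \<phi> i x =
     (THE vol. \<exists>e. coframe e \<and> g2_adapted (\<phi> i x) e \<and> vol = coframe_monom e [1,2,3,4,5,6,7])"

definition g2_star :: "('i, 'e::euclidean_space) form \<Rightarrow> ('i, 'e) form \<Rightarrow> ('i, 'e) form" where
  "g2_star \<phi> = form_hodge (g2_metric \<phi>) (g2_volume \<phi>)"

definition g2_coclosed :: "('i, 'm, 'e::euclidean_space) atlas \<Rightarrow> ('i, 'e) form \<Rightarrow> bool" where
  "g2_coclosed A \<phi> \<longleftrightarrow> ext_d A (g2_star \<phi> \<phi>) = 0"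

definition solves_laplacian_coflow ::
  "('i, 'm, 'e::euclidean_space) atlas \<Rightarrow> real set \<Rightarrow> (real \<Rightarrow> ('i, 'e) form) \<Rightarrow> bool" where
  "solves_laplacian_coflow A T \<phi> \<longleftrightarrow>
     (\<forall>t\<in>T. g2_structure A (\<phi> t)) \<and>
     time_differentiable T (\<lambda>t. g2_star (\<phi> t) (\<phi> t)) \<and>
     (\<forall>t\<in>T. time_deriv T (\<lambda>t. g2_star (\<phi> t) (\<phi> t)) t =
              - hodge_laplacian A (g2_metric (\<phi> t)) (g2_volume (\<phi> t)) 4 (g2_star (\<phi> t) (\<phi> t)) \<and>
            g2_coclosed A (\<phi> t))"

text \<open>The warped structure on the product with the circle.\<close>

definition warped_g2 :: "('i, 'm, real^6) atlas \<Rightarrow> real \<Rightarrow> real \<Rightarrow> real \<Rightarrow>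
    ('i, real^6) form \<Rightarrow> ('i, real^6) form \<Rightarrow> ('i, real^6) form \<Rightarrow>
    ('i \<times> real, (real^6) \<times> real) form" where
  "warped_g2 A \<alpha> \<beta> c \<omega> \<psi>p \<psi>m =
     c *\<^sub>F (pull_fst A circle_atlas \<omega> \<and>\<^sub>F pull_snd A circle_atlas circle_ds) +
     pull_fst A circle_atlas (\<alpha> *\<^sub>F \<psi>p - \<beta> *\<^sub>F \<psi>m)"

end

theory Submission
  imports Defs "HOL-Combinatorics.Multiset_Permutations"
begin

text \<open>Write \<open>\<psi>\<^sub>1 = \<alpha>\<psi>\<^sub>+ - \<beta>\<psi>\<^sub>-\<close> and \<open>\<psi>\<^sub>2 = \<beta>\<psi>\<^sub>+ + \<alpha>\<psi>\<^sub>-\<close>, the real and imaginary part of the rotated complex volume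
  form, so that \<open>\<phi> = f \<omega> \<and> ds + \<psi>\<^sub>1\<close> and \<open>*\<phi> = \<omega>\<^sup>2/2 + f \<psi>\<^sub>2 \<and> ds\<close>. Coclosedness gives \<open>d\<omega>\<^sup>2 = 0\<close> and
  \<open>d\<psi>\<^sub>2 = 0\<close>, and comparison of types gives \<open>\<nu>\<^sub>1 = \<pi>\<^sub>1 = 0\<close> and \<open>\<alpha>\<sigma>\<^sub>i + \<beta>\<pi>\<^sub>i = 0\<close>. With
  \<open>a = \<alpha>\<pi>\<^sub>0 - \<beta>\<sigma>\<^sub>0\<close> and \<open>\<tau> = \<alpha>\<pi>\<^sub>2 - \<beta>\<sigma>\<^sub>2\<close> this leaves \<open>d\<omega> = (3/2) a\<psi>\<^sub>2 + \<nu>\<^sub>3\<close> and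
  \<open>d\<psi>\<^sub>1 = a\<omega>\<^sup>2 - \<tau> \<and> \<omega>\<close>, hence \<open>*d\<phi> = K\<^sub>1 + f K\<^sub>2 \<and> ds\<close> for \<open>K\<^sub>1 = (3/2) a\<psi>\<^sub>1 - *\<nu>\<^sub>3\<close> and
  \<open>K\<^sub>2 = 2a\<omega> + \<tau>\<close>. The coflow \<open>\<partial>\<^sub>t *\<phi> = - d*d\<phi>\<close> splits into its part without \<open>ds\<close> and its part with
  \<open>ds\<close>, which are the two equations of the system.\<close>

section \<open>The algebra of the wedge product\<close>

text \<open>The metrics, volume forms and Hodge stars of the statement are picked by
  \<open>THE\<close> and \<open>SOME\<close>, so nothing can be computed before they are known not
  to depend on the adapted coframe. For \<phi> this is the theorem that a G2 3-form determines its
  metric and volume form; for SU(3) it is inherited from the product with a line, where an adapted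
  coframe yields one adapted to the 3-form. Rotating one complex covector by \<alpha> + i \<beta>
  shows that (\<omega>, \<open>\<psi>\<^sub>1\<close>, \<open>\<psi>\<^sub>2\<close>) is again an
  SU(3)-structure with the same metric, so the pointwise algebra is done in the standard model. The
  comparison of types rests on two facts: wedging with the square of \<omega> is injective on
  1-forms, and 4-forms split directly into multiples of that square, products of 1-forms with
  \<open>\<psi>\<^sub>2\<close>, and products of \<omega> with 2-forms of type 8. Taking d of
  \<open>*\<nu>\<^sub>3\<close> by the sum rule requires differentiability of the star of a form,
  although the star itself varies from point to point; smooth adapted coframes provide it.\<close>

definition contr :: "'e \<Rightarrow> ('e list \<Rightarrow> real) \<Rightarrow> 'e list \<Rightarrow> real" where
  "contr v a = (\<lambda>us. a (v # us))"

text \<open>The degree involution. It carries the sign of the Leibniz rule in the length of the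
  argument list instead of in a fixed degree, so that the recursions for wedge product and exterior
  derivative hold for arbitrary functions of lists.\<close>

definition twist :: "('e list \<Rightarrow> real) \<Rightarrow> 'e list \<Rightarrow> real" where
  "twist a = (\<lambda>us. (-1) ^ length us * a us)"

definition cscale :: "real \<Rightarrow> ('e list \<Rightarrow> real) \<Rightarrow> 'e list \<Rightarrow> real" (infixr "*\<^sub>C" 75) where
  "c *\<^sub>C a = (\<lambda>us. c * a us)"

definition one_cov :: "'e list \<Rightarrow> real" where
  "one_cov = (\<lambda>vs. if vs = [] then 1 else 0)"

text \<open>Degree alone, without multilinearity: additivity of degrees and graded commutativity
  already hold at this level.\<close>

definition homog :: "nat \<Rightarrow> ('e list \<Rightarrow> real) \<Rightarrow> bool" where
  "homog k a \<longleftrightarrow> (\<forall>vs. length vs \<noteq> k \<longrightarrow> a vs = 0)"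

lemma cscale_apply: "(c *\<^sub>C a) vs = c * a vs"
  by (simp add: cscale_def)

lemma wedge_Nil [simp]: "wedge a b [] = a [] * b []"
  by (simp add: wedge_def)

text \<open>If the first argument goes to the second factor, each of the \<open>card S\<close>
  positions given to the first factor forms an inversion with it. This is the source of the sign
  \<open>twist\<close> in the recursion for the wedge product.\<close>

lemma card_shuffle_inversions:
  assumes "S \<subseteq> {..<n}"
  shows "card {(i, j). i \<in> Suc ` S \<and> j \<in> {..<Suc n} - Suc ` S \<and> j < i} =
      card {(i, j). i \<in> S \<and> j \<in> {..<n} - S \<and> j < i} + card S"
    (is "card ?L = card ?R + _")
proof -
  have fin: "finite S" using assms finite_subset by blast
  have finR: "finite ?R"
    by (rule finite_subset[of _ "S \<times> {..<n}"]) (auto simp: fin)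
  have eq: "?L = map_prod Suc Suc ` ?R \<union> (\<lambda>i. (Suc i, 0)) ` S"
  proof (intro equalityI subsetI)
    fix p assume "p \<in> ?L"
    then obtain i j where p: "p = (Suc i, j)" "i \<in> S" "j < Suc n" "j \<notin> Suc ` S" "j < Suc i"
      by auto
    then show "p \<in> map_prod Suc Suc ` ?R \<union> (\<lambda>i. (Suc i, 0)) ` S"
      by (cases j) (force simp: image_iff)+
  qed (use assms in auto)
  have "card ?L = card (map_prod Suc Suc ` ?R) + card ((\<lambda>i. (Suc i, 0::nat)) ` S)"
    unfolding eq by (rule card_Un_disjoint) (use fin finR in auto)
  moreover have "card (map_prod Suc Suc ` ?R) = card ?R"
    by (rule card_image) (auto simp: inj_on_def)
  moreover have "card ((\<lambda>i. (Suc i, 0::nat)) ` S) = card S"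
    by (rule card_image) (auto simp: inj_on_def)
  ultimately show ?thesis by simp
qed

text \<open>If the first argument goes to the first factor, it stands before all arguments of the
  second factor and adds no inversion.\<close>

lemma card_shuffle_inversions_0:
  assumes "S \<subseteq> {..<n}"
  shows "card {(i, j). i \<in> insert 0 (Suc ` S) \<and> j \<in> {..<Suc n} - insert 0 (Suc ` S) \<and> j < i} =
      card {(i, j). i \<in> S \<and> j \<in> {..<n} - S \<and> j < i}"
    (is "card ?L = card ?R")
proof -
  have "?L = map_prod Suc Suc ` ?R"
  proof (intro equalityI subsetI)
    fix p assume "p \<in> ?L"
    then obtain i j where p: "p = (Suc i, Suc j)" "i \<in> S" "Suc j < Suc n" "j \<notin> S" "j < i"
      by (auto simp: less_Suc_eq_0_disj) 
    then show "p \<in> map_prod Suc Suc ` ?R"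
      by (force simp: image_iff)
  qed (use assms in auto)
  then show ?thesis
    by (simp add: card_image inj_on_def)
qed

text \<open>Contraction is an antiderivation; this recursion replaces sums over shuffles by induction on the
  list of arguments.\<close>

lemma wedge_Cons:
  "wedge a b (v # vs) = wedge (contr v a) b vs + wedge (twist a) (contr v b) vs"
proof -
  define n where "n = length vs"
  define g where "g S = (-1) ^ card {(i, j). i \<in> S \<and> j \<in> {..<Suc n} - S \<and> j < i} *
        a (nths (v # vs) S) * b (nths (v # vs) ({..<Suc n} - S))" for S
  have "wedge a b (v # vs) = sum g (Pow {..<Suc n})"
    by (simp add: wedge_def g_def n_def)
  \<comment> \<open>The shuffles are split by whether position 0 is given to the first factor; in
    both classes the rest is a shuffle of the tail, shifted by one.\<close>
  also have "Pow {..<Suc n} = (`) Suc ` Pow {..<n} \<union> insert 0 ` (`) Suc ` Pow {..<n}"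
    unfolding lessThan_Suc_eq_insert_0 Pow_insert image_Pow_surj[OF refl] by simp
  also have "sum g \<dots> = sum g ((`) Suc ` Pow {..<n}) + sum g (insert 0 ` (`) Suc ` Pow {..<n})"
    by (rule sum.union_disjoint) auto
  also have "sum g ((`) Suc ` Pow {..<n}) = (\<Sum>S\<in>Pow {..<n}. g (Suc ` S))"
    by (subst sum.reindex) (auto simp: inj_on_def inj_image_eq_iff)
  also have "sum g (insert 0 ` (`) Suc ` Pow {..<n}) = (\<Sum>S\<in>Pow {..<n}. g (insert 0 (Suc ` S)))"
    unfolding image_image by (subst sum.reindex) (auto simp: inj_on_def)
  also have "(\<Sum>S\<in>Pow {..<n}. g (Suc ` S)) = wedge (twist a) (contr v b) vs"
    unfolding wedge_def n_def[symmetric]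
  proof (rule sum.cong[OF refl])
    fix S assume "S \<in> Pow {..<n}"
    then have S: "S \<subseteq> {..<n}" by simp
    have 1: "nths (v # vs) (Suc ` S) = nths vs S"
      by (simp add: nths_Cons image_iff)
    have 2: "nths (v # vs) ({..<Suc n} - Suc ` S) = v # nths vs ({..<n} - S)"
      by (auto simp: nths_Cons intro!: arg_cong[of _ _ "nths vs"])
    have "{i. i < length vs \<and> i \<in> S} = S"
      using S by (auto simp: n_def)
    then have 3: "length (nths vs S) = card S"
      by (simp add: length_nths)
    show "g (Suc ` S) = (- 1) ^ card {(i, j). i \<in> S \<and> j \<in> {..<n} - S \<and> j < i} *
         twist a (nths vs S) * contr v b (nths vs ({..<n} - S))"
      unfolding g_def card_shuffle_inversions[OF S] 1 2
      by (simp add: twist_def contr_def power_add 3)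
  qed
  also have "(\<Sum>S\<in>Pow {..<n}. g (insert 0 (Suc ` S))) = wedge (contr v a) b vs"
    unfolding wedge_def n_def[symmetric]
  proof (rule sum.cong[OF refl])
    fix S assume "S \<in> Pow {..<n}"
    then have S: "S \<subseteq> {..<n}" by simp
    have 1: "nths (v # vs) (insert 0 (Suc ` S)) = v # nths vs S"
      by (simp add: nths_Cons image_iff)
    have 2: "nths (v # vs) ({..<Suc n} - insert 0 (Suc ` S)) = nths vs ({..<n} - S)"
      by (auto simp: nths_Cons intro!: arg_cong[of _ _ "nths vs"])
    show "g (insert 0 (Suc ` S)) = (- 1) ^ card {(i, j). i \<in> S \<and> j \<in> {..<n} - S \<and> j < i} *
         contr v a (nths vs S) * b (nths vs ({..<n} - S))"
      unfolding g_def card_shuffle_inversions_0[OF S] 1 2 by (simp add: contr_def)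
  qed
  finally show ?thesis by simp
qed

section \<open>Linearity, contraction and associativity\<close>

lemma wedge_add_left: "wedge (a + a') b = wedge a b + wedge a' b"
  by (rule ext) (simp add: wedge_def plus_fun_def algebra_simps sum.distrib)

lemma wedge_add_right: "wedge a (b + b') = wedge a b + wedge a b'"
  by (rule ext) (simp add: wedge_def plus_fun_def algebra_simps sum.distrib)

lemma wedge_scale_left: "wedge (c *\<^sub>C a) b = c *\<^sub>C wedge a b"
  by (rule ext) (simp add: wedge_def cscale_def sum_distrib_left algebra_simps)

lemma wedge_scale_right: "wedge a (c *\<^sub>C b) = c *\<^sub>C wedge a b"
  by (rule ext) (simp add: wedge_def cscale_def sum_distrib_left algebra_simps)

lemma wedge_zero_left [simp]: "wedge 0 b = 0"
  by (rule ext) (simp add: wedge_def)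

lemma wedge_zero_right [simp]: "wedge a 0 = 0"
  by (rule ext) (simp add: wedge_def)

lemma wedge_minus_left: "wedge (- a) b = - wedge a b"
  by (rule ext) (simp add: wedge_def sum_negf)

lemma wedge_minus_right: "wedge a (- b) = - wedge a b"
  by (rule ext) (simp add: wedge_def sum_negf)

lemma wedge_diff_left: "wedge (a - a') b = wedge a b - wedge a' b"
  by (metis add_uminus_conv_diff wedge_add_left wedge_minus_left)

lemma wedge_diff_right: "wedge a (b - b') = wedge a b - wedge a b'"
  by (metis add_uminus_conv_diff wedge_add_right wedge_minus_right)

lemmas wedge_linear = wedge_add_left wedge_add_right wedge_minus_left wedge_minus_right
  wedge_diff_left wedge_diff_right wedge_scale_left wedge_scale_right

lemma contr_add: "contr v (a + b) = contr v a + contr v b"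
  and contr_minus: "contr v (- a) = - contr v a"
  and contr_diff: "contr v (a - b) = contr v a - contr v b"
  and contr_scale: "contr v (c *\<^sub>C a) = c *\<^sub>C contr v a"
  and contr_zero [simp]: "contr v 0 = 0"
  by (auto simp: contr_def cscale_def)

lemmas contr_linear = contr_add contr_minus contr_diff contr_scale

lemma twist_add: "twist (a + b) = twist a + twist b"
  and twist_diff: "twist (a - b) = twist a - twist b"
  and twist_scale: "twist (c *\<^sub>C a) = c *\<^sub>C twist a"
  and twist_zero [simp]: "twist 0 = 0"
  by (auto simp: twist_def cscale_def algebra_simps)

lemma twist_twist [simp]: "twist (twist a) = a"
  by (rule ext) (simp add: twist_def flip: mult.assoc power_add)

lemma contr_twist: "contr v (twist a) = - twist (contr v a)"
  by (auto simp: contr_def twist_def)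

lemma contr_wedge: "contr v (wedge a b) = wedge (contr v a) b + wedge (twist a) (contr v b)"
  by (rule ext) (simp add: contr_def[of v "wedge a b"] wedge_Cons)

lemma contr_apply: "a (v # vs) = contr v a vs"
  by (simp add: contr_def)

text \<open>Contraction anticommutes with \<open>twist\<close>, so both sides obey the same
  recursion in the first argument.\<close>

lemma twist_wedge: "twist (wedge a b) = wedge (twist a) (twist b)"
proof
  fix vs show "twist (wedge a b) vs = wedge (twist a) (twist b) vs"
  proof (induction vs arbitrary: a b)
    case Nil
    then show ?case by (simp add: twist_def)
  next
    case (Cons v vs)
    have "twist (wedge a b) (v # vs) = - twist (contr v (wedge a b)) vs"
      by (simp add: contr_apply[of "twist _"] contr_twist)
    also have "\<dots> = wedge (contr v (twist a)) (twist b) vs + wedge a (contr v (twist b)) vs"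
      by (simp add: contr_wedge twist_add Cons contr_twist wedge_minus_left wedge_minus_right)
    finally show ?case by (simp add: wedge_Cons)
  qed
qed

text \<open>Both sides satisfy the same recursion in the first argument and agree on the empty list;
  multiplicativity of \<open>twist\<close> matches the terms in which the contraction passes two
  factors.\<close>

lemma wedge_assoc: "wedge (wedge a b) c = wedge a (wedge b c)"
proof
  fix vs show "wedge (wedge a b) c vs = wedge a (wedge b c) vs"
  proof (induction vs arbitrary: a b c)
    case (Cons v vs)
    show ?case
      by (simp add: wedge_Cons contr_wedge wedge_linear twist_wedge Cons)
  qed (simp add: mult.assoc)
qed

lemma one_wedge [simp]: "wedge one_cov a = a"
proof
  fix vs :: "'a list" show "wedge one_cov a vs = a vs"
  proof (induction vs arbitrary: a)
    case (Cons v vs)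
    have "contr v one_cov = 0" "twist one_cov = (one_cov :: 'a list \<Rightarrow> real)"
      by (auto simp: contr_def one_cov_def twist_def)
    then show ?case by (simp add: wedge_Cons Cons) (simp add: contr_def)
  qed (simp add: one_cov_def)
qed

section \<open>Degrees and graded commutativity\<close>

lemma homog_add: "homog k a \<Longrightarrow> homog k b \<Longrightarrow> homog k (a + b)"
  and homog_diff: "homog k a \<Longrightarrow> homog k b \<Longrightarrow> homog k (a - b)"
  and homog_scale: "homog k a \<Longrightarrow> homog k (c *\<^sub>C a)"
  and homog_zero [simp]: "homog k 0"
  by (auto simp: homog_def cscale_def)

lemma homog_contr: "homog (Suc k) a \<Longrightarrow> homog k (contr v a)"
  by (auto simp: homog_def contr_def)

lemma homog_contr_0: "homog 0 a \<Longrightarrow> contr v a = 0"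
  by (auto simp: homog_def contr_def)

lemma homog_twist: "homog k a \<Longrightarrow> twist a = (-1) ^ k *\<^sub>C a"
  by (rule ext) (auto simp: homog_def twist_def cscale_def)

lemma homog_0_eq: "homog 0 a \<Longrightarrow> a = a [] *\<^sub>C one_cov"
  by (rule ext) (auto simp: homog_def cscale_def one_cov_def)

lemma wedge_homog_0: "homog 0 a \<Longrightarrow> wedge a b = a [] *\<^sub>C b"
  by (metis homog_0_eq one_wedge wedge_scale_left)

lemma homog_wedge:
  assumes "homog k a" "homog l b"
  shows "homog (k + l) (wedge a b)"
  unfolding homog_def
proof (intro allI impI)
  fix vs :: "'a list"
  assume len: "length vs \<noteq> k + l"
  show "wedge a b vs = 0"
    using assms len
  proof (induction vs arbitrary: a b k l)
    case Nil
    then show ?case by (auto simp: homog_def)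
  next
    case (Cons v vs)
    have 1: "wedge (contr v a) b vs = 0"
    proof (cases k)
      case 0
      then show ?thesis using homog_contr_0[of a v] Cons.prems(1) by simp
    next
      case (Suc k')
      then show ?thesis using Cons.IH[of k' "contr v a" l b] homog_contr[of k' a v] Cons.prems by auto
    qed
    have 2: "wedge a (contr v b) vs = 0"
    proof (cases l)
      case 0
      then show ?thesis using homog_contr_0[of b v] Cons.prems(2) by (simp add: cscale_apply)
    next
      case (Suc l')
      then show ?thesis using Cons.IH[of k a l' "contr v b"] homog_contr[of l' b v] Cons.prems by auto
    qed
    show ?case
      by (simp add: wedge_Cons 1 2 homog_twist[OF Cons.prems(1)] wedge_scale_left cscale_apply)
  qed
qed

lemma wedge_commute:
  assumes "homog k a" "homog l b"
  shows "wedge a b = (-1) ^ (k * l) *\<^sub>C wedge b a"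
proof
  fix vs show "wedge a b vs = ((-1) ^ (k * l) *\<^sub>C wedge b a) vs"
    using assms
  proof (induction vs arbitrary: a b k l)
    case Nil
    then show ?case by (cases "k = 0") (auto simp: homog_def cscale_def)
  next
    case (Cons v vs)
    \<comment> \<open>The sign of exponent \<open>(k - 1) * l\<close> is written with exponent
      \<open>k * l + l\<close>, which has the same parity and avoids truncated subtraction; for
      \<open>k = 0\<close> the contraction vanishes.\<close>
    have 1: "wedge (contr v a) b vs = (-1) ^ (k * l + l) * wedge b (contr v a) vs"
    proof (cases k)
      case 0
      then show ?thesis using homog_contr_0[of a v] Cons.prems(1) by simp
    next
      case (Suc k')
      then show ?thesis
        using Cons.IH[OF homog_contr, of k' a l b v] Cons.prems
        by (simp add: cscale_apply flip: power_add mult_2_right)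
          (simp add: power_add mult_2_right flip: power_mult_distrib mult.assoc)
    qed
    have 2: "wedge a (contr v b) vs = (-1) ^ (k * l + k) * wedge (contr v b) a vs"
    proof (cases l)
      case 0
      then show ?thesis using homog_contr_0[of b v] Cons.prems(2) by (simp add: cscale_apply)
    next
      case (Suc l')
      then show ?thesis
        using Cons.IH[OF _ homog_contr, of k a l' b v] Cons.prems
        by (simp add: cscale_apply flip: power_add mult_2_right)
          (simp add: power_add mult_2_right flip: power_mult_distrib mult.assoc)
    qed
    have p2: "(-1) ^ k * (-1) ^ (k * l + k) = ((-1) ^ (k * l) :: real)" for k l
      by (simp add: power_add flip: power_mult_distrib mult.assoc)
    show ?case
      using p2[of k l]
      by (simp add: wedge_Cons 1 2 homog_twist[OF Cons.prems(1)] homog_twist[OF Cons.prems(2)]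
          wedge_scale_left cscale_apply power_add algebra_simps)
  qed
qed

lemma wedge_map: "wedge a b (map h vs) = wedge (\<lambda>us. a (map h us)) (\<lambda>us. b (map h us)) vs"
  by (simp add: wedge_def nths_map)

declare One_nat_def [simp del]

section \<open>Alternating forms\<close>

text \<open>Alternating forms described through contraction, the shape in which the later inductions
  run: linearity in the first argument and equality of the first two are tested, and the other
  positions are reached by contracting. \<open>alternating_map_iff_alt\<close> identifies this with
  the usual notion.\<close>

primrec alt :: "nat \<Rightarrow> ('e::real_vector list \<Rightarrow> real) \<Rightarrow> bool" where
  "alt 0 a \<longleftrightarrow> homog 0 a"
| "alt (Suc k) a \<longleftrightarrow> homog (Suc k) a \<and> (\<forall>vs. linear (\<lambda>v. a (v # vs))) \<and>
     (\<forall>v. alt k (contr v a) \<and> contr v (contr v a) = 0)"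

lemma alt_homog: "alt k a \<Longrightarrow> homog k a"
  by (cases k) auto

lemma linear_zero_cov: "linear (\<lambda>v. 0 :: real)"
  by (simp add: linear_iff)

lemma alt_zero [simp]: "alt k (0 :: 'e::real_vector list \<Rightarrow> real)"
proof (induction k)
  case 0
  show ?case unfolding alt.simps by (rule homog_zero)
next
  case (Suc k)
  have "linear (\<lambda>v. (0 :: 'e list \<Rightarrow> real) (v # vs))" for vs
    unfolding zero_fun_apply by (rule linear_zero_cov)
  then show ?case unfolding alt.simps contr_zero using Suc by (intro conjI allI homog_zero refl)
qed

lemma alt_contr: "alt k a \<Longrightarrow> alt (k - 1) (contr v a)"
  by (cases k) (auto simp: homog_contr_0)

lemma alt_contr_contr: "alt k a \<Longrightarrow> contr v (contr v a) = 0"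
  by (cases k) (auto simp: homog_contr_0)

lemma alt_linear: "alt k a \<Longrightarrow> linear (\<lambda>v. a (v # vs))"
  by (cases k) (auto simp: homog_def linear_zero_cov)

lemma alt_contr_plus: "alt k a \<Longrightarrow> contr (u + v) a = contr u a + contr v a"
  using linear_add[OF alt_linear] by (fastforce simp: contr_def)

lemma alt_contr_scaleR: "alt k a \<Longrightarrow> contr (c *\<^sub>R u) a = c *\<^sub>C contr u a"
  using linear_cmul[OF alt_linear] by (fastforce simp: contr_def cscale_def)

lemma alt_contr_sum:
  assumes "alt k a"
  shows "contr (\<Sum>i\<in>S. c i *\<^sub>R u i) a = (\<lambda>vs. \<Sum>i\<in>S. c i * contr (u i) a vs)"
  by (rule ext) (simp add: contr_def linear_sum[OF alt_linear[OF assms]] linear_cmul[OF alt_linear[OF assms]])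

lemma alt_add: "alt k a \<Longrightarrow> alt k b \<Longrightarrow> alt k (a + b)"
  by (induction k arbitrary: a b)
    (auto simp: homog_add contr_add intro: linear_compose_add)

lemma alt_scale: "alt k a \<Longrightarrow> alt k (c *\<^sub>C a)"
proof (induction k arbitrary: a)
  case (Suc k)
  then have "linear (\<lambda>v. c * a (v # vs))" for vs
    using linear_compose_scale_right[of "\<lambda>v. a (v # vs)" c] by simp
  with Suc show ?case
    by (auto simp: homog_scale contr_scale) (auto simp: cscale_def)
qed (simp add: homog_scale)

lemma cscale_minus_one: "- 1 *\<^sub>C a = - a"
  by (auto simp: cscale_def)

lemma alt_minus: "alt k a \<Longrightarrow> alt k (- a)"
  by (metis alt_scale cscale_minus_one)

lemma alt_diff: "alt k a \<Longrightarrow> alt k b \<Longrightarrow> alt k (a - b)"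
  by (metis alt_add alt_minus add_uminus_conv_diff)

lemma alt_twist: "alt k a \<Longrightarrow> alt k (twist a)"
  by (simp add: homog_twist[OF alt_homog] alt_scale)

text \<open>Contraction with a fixed vector is an antiderivation whose square vanishes on both
  factors; applied twice to the product, its two mixed terms cancel.\<close>

lemma alt_wedge:
  "alt k a \<Longrightarrow> alt l b \<Longrightarrow> alt (k + l) (wedge a b)"
proof (induction "k + l" arbitrary: k l a b)
  case 0
  then show ?case
    using homog_wedge[of 0 a 0 b] by simp
next
  case (Suc n)
  have lin: "linear (\<lambda>v. wedge a b (v # vs))" for vs
    by (rule linearI)
      (simp_all add: wedge_Cons alt_contr_plus[OF Suc.prems(1)] alt_contr_plus[OF Suc.prems(2)]
        alt_contr_scaleR[OF Suc.prems(1)] alt_contr_scaleR[OF Suc.prems(2)] wedge_linear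
        cscale_apply algebra_simps)
  have 1: "alt n (wedge (contr v a) b)" for v
  proof (cases k)
    case 0
    then show ?thesis using Suc.prems homog_contr_0[of a v] by simp
  next
    case (Suc k')
    then show ?thesis using Suc.hyps(1)[of k' l "contr v a" b] \<open>Suc n = k + l\<close> \<open>alt k a\<close> \<open>alt l b\<close>
      by auto
  qed
  have 2: "alt n (wedge (twist a) (contr v b))" for v
  proof (cases l)
    case 0
    then show ?thesis using Suc.prems homog_contr_0[of b v] by simp
  next
    case (Suc l')
    then show ?thesis using Suc.hyps(1)[of k l' "twist a" "contr v b"] \<open>Suc n = k + l\<close> \<open>alt k a\<close>
        \<open>alt l b\<close> alt_twist by auto
  qed
  have 3: "alt n (wedge (contr v a) b + wedge (twist a) (contr v b))" for v
    by (rule alt_add[OF 1 2])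
  have "alt (Suc n) (wedge a b)"
    using lin 3 homog_wedge[OF alt_homog[OF Suc.prems(1)] alt_homog[OF Suc.prems(2)]]
    by (simp add: contr_wedge contr_linear contr_twist alt_contr_contr[OF Suc.prems(1)]
        alt_contr_contr[OF Suc.prems(2)] wedge_linear flip: Suc.hyps(2))
  then show ?case by (simp add: Suc.hyps(2))
qed

text \<open>Polarisation: the double contraction with \<open>x + y\<close> vanishes, and so do those
  with \<open>x\<close> and with \<open>y\<close>. Entries in front of the swapped pair are removed
  by contraction.\<close>

lemma alt_swap: "alt k a \<Longrightarrow> a (xs @ x # y # zs) = - a (xs @ y # x # zs)"
proof (induction xs arbitrary: k a)
  case Nil
  have "contr (x + y) (contr (x + y) a) zs = 0"
    using alt_contr_contr[OF Nil] by simp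
  then have "contr x (contr x a) zs + contr y (contr x a) zs + (contr x (contr y a) zs + contr y (contr y a) zs) = 0"
    by (simp add: alt_contr_plus[OF Nil] alt_contr_plus[OF alt_contr[OF Nil]] contr_add)
  then show ?case
    by (simp add: alt_contr_contr[OF Nil]) (simp add: contr_def)
next
  case (Cons v xs)
  then show ?case using Cons.IH[OF alt_contr[OF Cons.prems], of v] by (simp add: contr_def)
qed

text \<open>A repetition inside the tail is found after contracting with the head. If instead the
  head recurs beyond the second place, a swap brings the second entry to the front and leaves the
  repetition in the tail.\<close>

lemma alt_not_distinct: "alt k a \<Longrightarrow> \<not> distinct vs \<Longrightarrow> a vs = 0"
proof (induction "length vs" arbitrary: vs k a rule: less_induct)
  case less
  obtain v ws where vs: "vs = v # ws" using less.prems by (cases vs) auto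
  show ?case
  proof (cases "distinct ws")
    case False
    then show ?thesis
      using less.hyps[of ws "k - 1" "contr v a"] alt_contr[OF less.prems(1)]
      by (simp add: vs contr_def)
  next
    case True
    then have "v \<in> set ws" using less.prems by (simp add: vs)
    then obtain w us where ws: "ws = w # us" by (cases ws) auto
    show ?thesis
    proof (cases "v = w")
      case True
      then show ?thesis
        using fun_cong[OF alt_contr_contr[OF less.prems(1), of v], of us] by (simp add: vs ws contr_def)
    next
      case False
      then have "\<not> distinct (v # us)" using \<open>v \<in> set ws\<close> ws by auto
      then show ?thesis
        using less.hyps[of "v # us" "k - 1" "contr w a"] alt_contr[OF less.prems(1)]
          alt_swap[OF less.prems(1), of "[]" v w us]
        by (simp add: vs ws contr_def)
    qed
  qed
qed

lemma alternating_map_imp_alt: "alternating_map k a \<Longrightarrow> alt k a"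
proof (induction k arbitrary: a)
  case 0
  then show ?case by (auto simp: alternating_map_def homog_def)
next
  case (Suc k)
  have z: "a vs = 0" if "length vs \<noteq> Suc k" for vs
    using Suc.prems that by (simp add: alternating_map_def)
  have l: "linear (\<lambda>v. a (vs[i := v]))" if "length vs = Suc k" "i < Suc k" for vs i
    using Suc.prems that by (simp add: alternating_map_def)
  have d: "a vs = 0" if "length vs = Suc k" "i < j" "j < Suc k" "vs ! i = vs ! j" for vs i j
    using Suc.prems that unfolding alternating_map_def by blast
  \<comment> \<open>The placeholder in slot 0 is overwritten by the list update.\<close>
  have "linear (\<lambda>v. a (v # vs))" for vs
    using l[of "undefined # vs" 0] z by (cases "length vs = k") (auto simp: linear_zero_cov)
  moreover have "alternating_map k (contr v a)" for v
    unfolding alternating_map_def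
  proof (intro conjI allI impI)
    fix vs :: "'a list" and i
    assume "length vs = k \<and> i < k"
    then show "linear (\<lambda>w. contr v a (vs[i := w]))"
      using l[of "v # vs" "Suc i"] by (simp add: contr_def)
  next
    fix vs :: "'a list" and i j
    assume "length vs = k \<and> i < j \<and> j < k \<and> vs ! i = vs ! j"
    then show "contr v a vs = 0"
      using d[of "v # vs" "Suc i" "Suc j"] by (simp add: contr_def)
  qed (simp add: contr_def z)
  \<comment> \<open>The list \<open>v # v # vs\<close> has length \<open>Suc k\<close> only if
    \<open>1 \<le> k\<close> and \<open>vs\<close> has \<open>k - 1\<close> entries; for all other
    lengths the value is 0 by the degree convention.\<close>
  moreover have "contr v (contr v a) = 0" for v
  proof
    fix vs
    show "contr v (contr v a) vs = 0 vs"
      using z[of "v # v # vs"] d[of "v # v # vs" 0 1]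
      by (cases "length vs = k - 1 \<and> 1 \<le> k") (auto simp: contr_def)
  qed
  ultimately show ?case
    using Suc.IH z by (simp add: homog_def)
qed

lemma alt_linear_update: "alt k a \<Longrightarrow> i < length vs \<Longrightarrow> linear (\<lambda>v. a (vs[i := v]))"
proof (induction vs arbitrary: i k a)
  case (Cons w vs)
  show ?case
  proof (cases i)
    case 0
    then show ?thesis using alt_linear[OF Cons.prems(1)] by simp
  next
    case (Suc i')
    then show ?thesis
      using Cons.IH[OF alt_contr[OF Cons.prems(1)], of i' w] Cons.prems by (simp add: contr_def)
  qed
qed simp

lemma alternating_map_iff_alt: "alternating_map k a \<longleftrightarrow> alt k a"
proof
  assume a: "alt k a"
  show "alternating_map k a"
    unfolding alternating_map_def
  proof (intro conjI allI impI)
    fix vs :: "'a list" and i j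
    assume "length vs = k \<and> i < j \<and> j < k \<and> vs ! i = vs ! j"
    then have "\<not> distinct vs" by (metis less_trans less_irrefl nth_eq_iff_index_eq)
    then show "a vs = 0" by (rule alt_not_distinct[OF a])
  qed (use alt_homog[OF a] alt_linear_update[OF a] in \<open>auto simp: homog_def\<close>)
qed (rule alternating_map_imp_alt)

declare alt.simps(2) [simp del]

lemma alt_one_cov [simp]: "alt 0 (one_cov :: 'e::real_vector list \<Rightarrow> real)"
  unfolding alt.simps homog_def one_cov_def by simp

lemma coframe_monom_Nil: "coframe_monom e [] = one_cov"
  by (auto simp: one_cov_def)

lemma alt_coframe_monom:
  "(\<And>i. i \<in> set is \<Longrightarrow> alt 1 (e i)) \<Longrightarrow> alt (length is) (coframe_monom e is)"
proof (induction "is")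
  case Nil
  show ?case unfolding coframe_monom_Nil list.size by (rule alt_one_cov)
next
  case (Cons i "is")
  then show ?case using alt_wedge[of 1 "e i" "length is"] by (simp add: plus_1_eq_Suc)
qed

lemma coframe_monom_append: "coframe_monom e (xs @ ys) = wedge (coframe_monom e xs) (coframe_monom e ys)"
proof (induction xs)
  case Nil
  show ?case unfolding append_Nil coframe_monom_Nil one_wedge ..
qed (simp add: wedge_assoc)


section \<open>Dual bases\<close>

text \<open>Adjacent swaps generate all permutations: the head of \<open>xs\<close> is bubbled to
  the front of \<open>ys\<close>, and the tails are left to the induction with that head fixed
  inside \<open>P\<close>. The value type of \<open>P\<close> is free, so that it can be a real
  number or the truth value of an equation.\<close>

lemma perm_invariant:
  assumes "\<And>xs x y zs. P (xs @ x # y # zs) = P (xs @ y # x # zs)" and "mset xs = mset ys"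
  shows "P xs = P ys"
  using assms
proof (induction xs arbitrary: ys P)
  case (Cons x xs)
  have "x \<in> set ys" using Cons.prems(2) by (metis list.set_intros(1) set_mset_mset)
  then obtain us vs where ys: "ys = us @ x # vs" by (meson split_list)
  have "P (us @ x # vs) = P (x # us @ vs)" for us vs
  proof (induction us arbitrary: vs rule: rev_induct)
    case (snoc u us)
    have "P ((us @ [u]) @ x # vs) = P (us @ x # u # vs)"
      using Cons.prems(1)[of us u x vs] by simp
    then show ?case using snoc[of "u # vs"] by simp
  qed simp
  moreover have "P (x # xs) = P (x # us @ vs)"
  proof (rule Cons.IH[of "\<lambda>zs. P (x # zs)"])
    show "P (x # xs @ a # b # zs) = P (x # xs @ b # a # zs)" for xs a b zs
      using Cons.prems(1)[of "x # xs"] by simp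
    show "mset xs = mset (us @ vs)" using Cons.prems(2) by (simp add: ys)
  qed
  ultimately show ?case by (simp add: ys)
qed simp

definition dual_basis :: "(nat \<Rightarrow> 'e::euclidean_space list \<Rightarrow> real) \<Rightarrow> (nat \<Rightarrow> 'e) \<Rightarrow> bool" where
  "dual_basis e b \<longleftrightarrow>
     (\<forall>i\<in>{1..DIM('e)}. \<forall>j\<in>{1..DIM('e)}. e i [b j] = (if i = j then 1 else 0)) \<and>
     (\<forall>v. v = (\<Sum>k = 1..DIM('e). e k [v] *\<^sub>R b k))"

lemma dual_basis_expand: "dual_basis e (b :: nat \<Rightarrow> 'e::euclidean_space) \<Longrightarrow> (\<Sum>k = 1..DIM('e). e k [v] *\<^sub>R b k) = v"
  by (simp add: dual_basis_def)

lemma coframe_alt: "coframe (e :: nat \<Rightarrow> 'e::euclidean_space list \<Rightarrow> real) \<Longrightarrow> k \<in> {1..DIM('e)} \<Longrightarrow> alt 1 (e k)"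
  unfolding coframe_def by (metis alternating_map_imp_alt)

lemma coframe_linear: "coframe (e :: nat \<Rightarrow> 'e::euclidean_space list \<Rightarrow> real) \<Longrightarrow> k \<in> {1..DIM('e)} \<Longrightarrow> linear (\<lambda>v. e k [v])"
  using alt_linear[OF coframe_alt] by blast

text \<open>Let \<open>L\<close> send a vector to its coframe coordinates, written in the standard
  basis. Linear independence of the coframe says that the adjoint \<open>L'\<close> is injective,
  hence surjective in finite dimension, which makes \<open>L\<close> injective and so bijective. The
  dual basis is the preimage of the standard basis.\<close>

lemma coframe_dual_basis_exists:
  fixes e :: "nat \<Rightarrow> 'e::euclidean_space list \<Rightarrow> real"
  assumes "coframe e"
  obtains b where "dual_basis e b"
proof -
  let ?n = "DIM('e)"
  obtain B where B: "bij_betw B {1..?n} (Basis :: 'e set)"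
    using ex_bij_betw_nat_finite_1[OF finite_Basis] by blast
  have Bb: "B i \<in> Basis" if "i \<in> {1..?n}" for i
    using bij_betw_apply[OF B that] .
  have BB: "B i \<bullet> B j = (if i = j then 1 else 0)" if "i \<in> {1..?n}" "j \<in> {1..?n}" for i j
    using that by (simp add: inner_Basis Bb inj_on_eq_iff[OF bij_betw_imp_inj_on[OF B]])
  define L where "L v = (\<Sum>k = 1..?n. e k [v] *\<^sub>R B k)" for v
  define r where "r k = (\<Sum>u\<in>Basis. e k [u] *\<^sub>R u)" for k
  define L' where "L' w = (\<Sum>k = 1..?n. (w \<bullet> B k) *\<^sub>R r k)" for w
  have linL: "linear L"
    unfolding L_def
    by (rule linear_compose_sum)
      (use coframe_linear[OF assms] in \<open>auto intro: linear_compose[of _ "\<lambda>c. c *\<^sub>R _", unfolded o_def] linear_scaleR_left\<close>)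
  have linL': "linear L'"
    unfolding L'_def by (rule linearI) (simp_all add: inner_add_left scaleR_add_left sum.distrib scaleR_sum_right)
  have r: "v \<bullet> r k = e k [v]" if "k \<in> {1..?n}" for v k
  proof -
    interpret f: linear "\<lambda>v. e k [v]" using coframe_linear[OF assms that] .
    have "e k [v] = e k [\<Sum>u\<in>Basis. (v \<bullet> u) *\<^sub>R u]" by (simp add: euclidean_representation)
    also have "\<dots> = v \<bullet> r k" by (simp add: f.sum f.scale r_def inner_sum_right mult.commute)
    finally show ?thesis by simp
  qed
  have adj: "L v \<bullet> w = v \<bullet> L' w" for v w
    by (simp add: L_def L'_def inner_sum_left inner_sum_right r inner_commute mult.commute)
  have "inj L'"
    unfolding linear_injective_0[OF linL']
  proof (intro allI impI)
    fix w assume "L' w = 0"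
    then have "(\<Sum>k = 1..?n. (w \<bullet> B k) * e k [v]) = 0"
      for v
      using adj[of v w] by (simp add: L_def inner_sum_left inner_commute[of w] mult.commute)
    then have "w \<bullet> B k = 0" if "k \<in> {1..?n}" for k
      using assms that unfolding coframe_def by meson
    then have "w \<bullet> u = 0" if "u \<in> Basis" for u
      using B that by (metis bij_betw_iff_bijections)
    then show "w = 0" by (metis euclidean_all_zero_iff)
  qed
  then have "surj L'" using linear_injective_imp_surjective linL' by blast
  have "inj L"
    unfolding linear_injective_0[OF linL]
  proof (intro allI impI)
    fix v assume "L v = 0"
    then have "v \<bullet> L' w = 0" for w using adj[of v w] by simp
    then show "v = 0" using \<open>surj L'\<close> by (metis inner_eq_zero_iff surjD)
  qed
  then have "surj L" using linear_injective_imp_surjective linL by blast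
  then have b: "L (inv L (B k)) = B k" for k by (rule surj_f_inv_f)
  define b where "b k = inv L (B k)" for k
  have b: "L (b k) = B k" for k unfolding b_def by (rule b)
  have eL: "e i [v] = L v \<bullet> B i" if "i \<in> {1..?n}" for i v
  proof -
    have "L v \<bullet> B i = (\<Sum>k = 1..?n. e k [v] * (B k \<bullet> B i))"
      by (simp only: L_def inner_sum_left inner_scaleR_left)
    also have "\<dots> = (\<Sum>k = 1..?n. if k = i then e i [v] else 0)"
      by (rule sum.cong[OF refl]) (use BB that in auto)
    finally show ?thesis using that by simp
  qed
  have "dual_basis e b"
    unfolding dual_basis_def
  proof (intro conjI ballI allI)
    fix i j assume "i \<in> {1..?n}" "j \<in> {1..?n}"
    then show "e i [b j] = (if i = j then 1 else 0)"
      using eL[of i "b j"] BB by (auto simp: b)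
  next
    fix v
    have "L (\<Sum>k = 1..?n. e k [v] *\<^sub>R b k) = L v"
      by (simp add: linear_sum[OF linL] linear_cmul[OF linL] b) (simp add: L_def)
    then show "v = (\<Sum>k = 1..?n. e k [v] *\<^sub>R b k)"
      using \<open>inj L\<close> by (simp add: inj_eq)
  qed
  then show ?thesis by (rule that)
qed

lemma alt_eq_0_if_zero_on_basis:
  fixes b :: "nat \<Rightarrow> 'e::euclidean_space"
  assumes b: "dual_basis e b" and "alt k a"
    and "\<And>xs. set xs \<subseteq> {1..DIM('e)} \<Longrightarrow> length xs = k \<Longrightarrow> a (map b xs) = 0"
  shows "a = 0"
  using assms(2,3)
proof (induction k arbitrary: a)
  case 0
  then show ?case by (auto simp: homog_def fun_eq_iff) (metis length_0_conv list.simps(8) empty_subsetI list.set(1))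
next
  case (Suc k)
  have "contr (b i) a = 0" if "i \<in> {1..DIM('e)}" for i
    by (rule Suc.IH) (use alt_contr[OF Suc.prems(1)] Suc.prems(2)[of "i # _"] that in \<open>auto simp: contr_def\<close>)
  then have "contr v a = 0" for v
    using alt_contr_sum[OF Suc.prems(1), of "\<lambda>i. e i [v]" b "{1..DIM('e)}"]
    by (auto simp: dual_basis_expand[OF b])
  then have "a (v # vs) = 0" for v vs
    by (metis contr_def zero_fun_apply)
  moreover have "a [] = 0" using alt_homog[OF Suc.prems(1)] by (simp add: homog_def)
  ultimately show ?case by (metis list.exhaust zero_fun_apply ext)
qed

lemma alt_eq_0_if_zero_on_sorted:
  fixes b :: "nat \<Rightarrow> 'e::euclidean_space"
  assumes b: "dual_basis e b" and a: "alt k a"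
    and z: "\<And>I. I \<subseteq> {1..DIM('e)} \<Longrightarrow> card I = k \<Longrightarrow> a (map b (sorted_list_of_set I)) = 0"
  shows "a = 0"
proof (rule alt_eq_0_if_zero_on_basis[OF b a])
  fix xs :: "nat list" assume xs: "set xs \<subseteq> {1..DIM('e)}" "length xs = k"
  show "a (map b xs) = 0"
  proof (cases "distinct xs")
    case False
    then show ?thesis using alt_not_distinct[OF a, of "map b xs"] by (simp add: distinct_map)
  next
    case True
    then have "mset xs = mset (sorted_list_of_set (set xs))"
      by (simp add: set_eq_iff_mset_eq_distinct[symmetric])
    \<comment> \<open>Sorting the arguments may change the sign of the value but not whether it
      vanishes, so the invariant is the proposition that it is 0.\<close>
    then have "(a (map b xs) = 0) = (a (map b (sorted_list_of_set (set xs))) = 0)"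
      by (rule perm_invariant[where P = "\<lambda>xs. a (map b xs) = 0", rotated])
        (simp, subst alt_swap[OF a], simp)
    then show ?thesis using z[of "set xs"] xs distinct_card[OF True] by simp
  qed
qed


section \<open>The Hodge star in an orthonormal basis\<close>

text \<open>A sum over all \<open>k\<close>-tuples of basis vectors, nested so that one slot at a
  time can be moved to another basis. Increasing multi-indices offer no independent slots.\<close>

primrec tuple_sum :: "nat \<Rightarrow> nat \<Rightarrow> (nat \<Rightarrow> 'e) \<Rightarrow> ('e list \<Rightarrow> real) \<Rightarrow> real" where
  "tuple_sum n 0 b H = H []"
| "tuple_sum n (Suc k) b H = (\<Sum>i = 1..n. tuple_sum n k b (\<lambda>vs. H (b i # vs)))"

lemma tuple_sum_add: "tuple_sum n k b (\<lambda>vs. H vs + H' vs) = tuple_sum n k b H + tuple_sum n k b H'"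
  by (induction k arbitrary: H H') (auto simp: sum.distrib)

lemma tuple_sum_scale: "tuple_sum n k b (\<lambda>vs. c * H vs) = c * tuple_sum n k b H"
  by (induction k arbitrary: H) (auto simp: sum_distrib_left)

lemma tuple_sum_eq:
  "tuple_sum n k b H = (\<Sum>xs | set xs \<subseteq> {1..n} \<and> length xs = k. H (map b xs))"
proof (induction k arbitrary: H)
  case 0
  have "{xs. set xs \<subseteq> {1..n} \<and> length xs = 0} = {[]}" by auto
  then show ?case by simp
next
  case (Suc k)
  let ?L = "\<lambda>k. {xs. set xs \<subseteq> {1..n} \<and> length xs = k}"
  have "?L (Suc k) = (\<lambda>(i, xs). i # xs) ` ({1..n} \<times> ?L k)"
    by (auto simp: image_iff length_Suc_conv)
  then have "(\<Sum>xs\<in>?L (Suc k). H (map b xs)) = (\<Sum>(i, xs)\<in>{1..n} \<times> ?L k. H (b i # map b xs))"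
    by (simp add: sum.reindex inj_on_def case_prod_beta)
  then show ?case by (simp add: Suc sum.cartesian_product)
qed

text \<open>A symmetric summand that vanishes on repetitions takes one value on all
  \<open>k!\<close> orderings of a \<open>k\<close>-set.\<close>

lemma sum_over_lists_eq_sum_over_sets:
  fixes G :: "nat list \<Rightarrow> real"
  assumes swap: "\<And>xs x y zs. G (xs @ x # y # zs) = G (xs @ y # x # zs)"
    and nd: "\<And>xs. \<not> distinct xs \<Longrightarrow> G xs = 0"
  shows "(\<Sum>xs | set xs \<subseteq> {1..n} \<and> length xs = k. G xs) =
      fact k * (\<Sum>I | I \<subseteq> {1..n} \<and> card I = k. G (sorted_list_of_set I))"
proof -
  let ?L = "{xs. set xs \<subseteq> {1..n} \<and> length xs = k}"
  let ?D = "{xs. set xs \<subseteq> {1..n} \<and> length xs = k \<and> distinct xs}"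
  let ?S = "{I. I \<subseteq> {1..n} \<and> card I = k}"
  have finL: "finite ?L" by (rule finite_lists_length_eq) simp
  have finS: "finite ?S" by (rule finite_subset[of _ "Pow {1..n}"]) auto
  have finD: "finite ?D" by (rule finite_subset[OF _ finL]) auto
  have "sum G ?L = sum G ?D"
    by (rule sum.mono_neutral_right[OF finL]) (auto intro: nd)
  also have "\<dots> = (\<Sum>I\<in>?S. sum G {xs \<in> ?D. set xs = I})"
    by (rule sum.group[symmetric]) (use finD finS in \<open>auto simp: distinct_card\<close>)
  also have "\<dots> = (\<Sum>I\<in>?S. fact k * G (sorted_list_of_set I))"
  proof (rule sum.cong[OF refl])
    fix I assume I: "I \<in> ?S"
    then have fin: "finite I" using finite_subset by blast
    have eq: "{xs \<in> ?D. set xs = I} = permutations_of_set I"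
      using I by (auto simp: permutations_of_set_def distinct_card)
    have "sum G (permutations_of_set I) = (\<Sum>xs\<in>permutations_of_set I. G (sorted_list_of_set I))"
    proof (rule sum.cong[OF refl])
      fix xs assume "xs \<in> permutations_of_set I"
      then have "mset xs = mset (sorted_list_of_set I)"
        using fin by (auto simp: permutations_of_set_def set_eq_iff_mset_eq_distinct[symmetric])
      then show "G xs = G (sorted_list_of_set I)"
        by (rule perm_invariant[where P = G, OF swap])
    qed
    then show "sum G {xs \<in> ?D. set xs = I} = fact k * G (sorted_list_of_set I)"
      using I fin unfolding eq by simp
  qed
  finally show ?thesis by (simp add: sum_distrib_left)
qed

text \<open>A product of two alternating factors is symmetric in the basis vectors they share,
  because the two signs cancel.\<close>

lemma sum_over_sets_eq_tuple_sum:
  assumes a: "alt k a" and c: "alt m c"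
  shows "fact k * (\<Sum>I | I \<subseteq> {1..n} \<and> card I = k. a (map b (sorted_list_of_set I)) * c (map b (sorted_list_of_set I) @ us)) =
    tuple_sum n k b (\<lambda>vs. a vs * c (vs @ us))"
  unfolding tuple_sum_eq
proof (rule sum_over_lists_eq_sum_over_sets[symmetric])
  fix xs x y zs
  show "a (map b (xs @ x # y # zs)) * c (map b (xs @ x # y # zs) @ us) =
        a (map b (xs @ y # x # zs)) * c (map b (xs @ y # x # zs) @ us)"
    using alt_swap[OF a, of "map b xs" "b x" "b y" "map b zs"]
      alt_swap[OF c, of "map b xs" "b x" "b y" "map b zs @ us"] by simp
next
  fix xs :: "nat list"
  assume "\<not> distinct xs"
  then have "\<not> distinct (map b xs)" by (simp add: distinct_map)
  then show "a (map b xs) * c (map b xs @ us) = 0"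
    using alt_not_distinct[OF a] by simp
qed

text \<open>The induction hypothesis moves the inner slots to \<open>b'\<close>. What then stands in
  the outermost slot is the trace of the bilinear form \<open>K\<close>, and traces agree in the two
  bases by assumption.\<close>

lemma tuple_sum_basis_change:
  fixes b b' :: "nat \<Rightarrow> 'e::euclidean_space"
  assumes trace: "\<forall>K :: 'e \<Rightarrow> 'e \<Rightarrow> real. (\<forall>v. linear (\<lambda>u. K u v)) \<and> (\<forall>u. linear (K u)) \<longrightarrow>
      (\<Sum>i = 1..n. K (b i) (b i)) = (\<Sum>i = 1..n. K (b' i) (b' i))"
  shows "alt k a \<Longrightarrow> alt m c \<Longrightarrow>
    tuple_sum n k b (\<lambda>vs. a vs * c (vs @ us)) = tuple_sum n k b' (\<lambda>vs. a vs * c (vs @ us))"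
proof (induction k arbitrary: a c m)
  case (Suc k)
  define K where "K u v = tuple_sum n k b' (\<lambda>vs. a (u # vs) * c (v # vs @ us))" for u v
  have "tuple_sum n (Suc k) b (\<lambda>vs. a vs * c (vs @ us)) = (\<Sum>i = 1..n. K (b i) (b i))"
  proof -
    have "tuple_sum n k b (\<lambda>vs. contr (b i) a vs * contr (b i) c (vs @ us)) =
          tuple_sum n k b' (\<lambda>vs. contr (b i) a vs * contr (b i) c (vs @ us))" for i
      by (rule Suc.IH[of _ "m - 1"]) (use alt_contr[OF Suc.prems(1)] alt_contr[OF Suc.prems(2)] in auto)
    then show ?thesis by (simp add: K_def contr_def)
  qed
  also have "\<dots> = (\<Sum>i = 1..n. K (b' i) (b' i))"
  proof -
    have 1: "linear (\<lambda>u. K u v)" for v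
      unfolding K_def
      by (rule linearI)
        (simp_all add: linear_add[OF alt_linear[OF Suc.prems(1)]] linear_cmul[OF alt_linear[OF Suc.prems(1)]]
          distrib_right tuple_sum_add mult.assoc tuple_sum_scale)
    have 2: "linear (K u)" for u
      unfolding K_def
      by (rule linearI)
        (simp_all add: linear_add[OF alt_linear[OF Suc.prems(2)]] linear_cmul[OF alt_linear[OF Suc.prems(2)]]
          distrib_left tuple_sum_add mult.left_commute tuple_sum_scale)
    show ?thesis using trace[rule_format, of K] 1 2 by simp
  qed
  finally show ?case by (simp add: K_def)
qed simp

lemma dual_basis_unique:
  fixes b b' :: "nat \<Rightarrow> 'e::euclidean_space"
  assumes "dual_basis e b"
    and "\<And>i j. i \<in> {1..DIM('e)} \<Longrightarrow> j \<in> {1..DIM('e)} \<Longrightarrow> e i [b' j] = (if i = j then 1 else 0)"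
    and "j \<in> {1..DIM('e)}"
  shows "b' j = b j"
proof -
  have "b' j = (\<Sum>k = 1..DIM('e). e k [b' j] *\<^sub>R b k)"
    using assms(1) by (simp add: dual_basis_expand)
  also have "\<dots> = (\<Sum>k = 1..DIM('e). (if k = j then b j else 0))"
    by (rule sum.cong[OF refl]) (use assms(2,3) in auto)
  finally show ?thesis using assms(3) by simp
qed

section \<open>Independence of the orthonormal basis\<close>

lemma coframe_metric_dual_basis:
  fixes b :: "nat \<Rightarrow> 'e::euclidean_space"
  assumes "dual_basis e b" "j \<in> {1..DIM('e)}"
  shows "coframe_metric e v (b j) = e j [v]"
proof -
  have "coframe_metric e v (b j) = (\<Sum>k = 1..DIM('e). e k [v] * (if k = j then 1 else 0))"
    unfolding coframe_metric_def by (rule sum.cong[OF refl]) (use assms in \<open>auto simp: dual_basis_def\<close>)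
  then show ?thesis using assms(2) by (simp add: if_distrib cong: if_cong)
qed

lemma dual_basis_orthonormal: "dual_basis e b \<Longrightarrow> orthonormal_basis (coframe_metric e) b"
  unfolding orthonormal_basis_def by (simp add: coframe_metric_dual_basis) (simp add: dual_basis_def)

lemma coframe_metric_bilinear:
  assumes "coframe (e :: nat \<Rightarrow> 'e::euclidean_space list \<Rightarrow> real)"
  shows "linear (\<lambda>u. coframe_metric e u v)" "linear (coframe_metric e u)"
  unfolding coframe_metric_def
  by (rule linearI; simp add: linear_add[OF coframe_linear[OF assms]] linear_cmul[OF coframe_linear[OF assms]]
      algebra_simps sum.distrib sum_distrib_left)+

lemma coframe_metric_commute: "coframe_metric e u v = coframe_metric e v u"
  by (simp add: coframe_metric_def mult.commute)

text \<open>Invariance of the metric trace: \<open>b'\<close> is expanded in \<open>b\<close> in one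
  argument only, and the coefficients are absorbed by the other argument through the expansion of
  \<open>b k\<close> in \<open>b'\<close>.\<close>

lemma orthonormal_basis_trace:
  fixes b b' :: "nat \<Rightarrow> 'e::euclidean_space" and K :: "'e \<Rightarrow> 'e \<Rightarrow> real"
  assumes e: "coframe e" "dual_basis e b" and b': "orthonormal_basis (coframe_metric e) b'"
    and K: "\<And>v. linear (\<lambda>u. K u v)" "\<And>u. linear (K u)"
  shows "(\<Sum>i = 1..DIM('e). K (b' i) (b' i)) = (\<Sum>i = 1..DIM('e). K (b i) (b i))"
proof -
  let ?n = "DIM('e)" and ?g = "coframe_metric e"
  \<comment> \<open>The metric duals of \<open>b'\<close> form a coframe and so possess a dual
    basis, which must be \<open>b'\<close> itself. This supplies the expansion of vectors in
    \<open>b'\<close>.\<close>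
  define e' where "e' k vs = (if length vs = 1 then ?g (hd vs) (b' k) else 0)" for k vs
  have e'1: "e' k [v] = ?g v (b' k)" for k v by (simp add: e'_def)
  have "alt 1 (e' k)" for k
    using coframe_metric_bilinear(1)[OF e(1), of "b' k"]
    unfolding One_nat_def alt.simps
    by (auto simp: homog_def e'_def contr_def linear_zero_cov, case_tac "vs = []", auto simp: linear_zero_cov)
  moreover have "c k = 0" if "\<And>v. (\<Sum>k = 1..?n. c k * e' k [v]) = 0" "k \<in> {1..?n}" for c k
  proof -
    have "(\<Sum>k' = 1..?n. c k' * e' k' [b' k]) = (\<Sum>k' = 1..?n. if k' = k then c k else 0)"
      by (rule sum.cong[OF refl]) (use b' that(2) in \<open>auto simp: orthonormal_basis_def e'1\<close>)
    then show ?thesis using that by simp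
  qed
  ultimately have "coframe e'" unfolding coframe_def alternating_map_iff_alt by auto
  then obtain b2 where b2: "dual_basis e' b2" by (rule coframe_dual_basis_exists)
  have "b' j = b2 j" if "j \<in> {1..?n}" for j
    by (rule dual_basis_unique[OF b2 _ that]) (use b' in \<open>auto simp: orthonormal_basis_def e'1\<close>)
  then have exp: "(\<Sum>k = 1..?n. ?g v (b' k) *\<^sub>R b' k) = v" for v
    using dual_basis_expand[OF b2, of v] by (simp add: e'1)
  have "(\<Sum>k = 1..?n. e k [b' i] *\<^sub>R b k) = b' i" for i
    by (rule dual_basis_expand[OF e(2)])
  then have "(\<Sum>i = 1..?n. K (b' i) (b' i)) = (\<Sum>i = 1..?n. K (\<Sum>k = 1..?n. e k [b' i] *\<^sub>R b k) (b' i))"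
    by simp
  also have "\<dots> = (\<Sum>k = 1..?n. \<Sum>i = 1..?n. e k [b' i] * K (b k) (b' i))"
    by (subst sum.swap) (simp add: linear_sum[OF K(1)] linear_cmul[OF K(1)])
  also have "\<dots> = (\<Sum>k = 1..?n. K (b k) (\<Sum>i = 1..?n. ?g (b k) (b' i) *\<^sub>R b' i))"
    by (simp add: linear_sum[OF K(2)] linear_cmul[OF K(2)] coframe_metric_commute[of e "b _"]
        coframe_metric_dual_basis[OF e(2)])
  also have "\<dots> = (\<Sum>k = 1..?n. K (b k) (b k))" by (simp add: exp)
  finally show ?thesis .
qed

text \<open>After multiplication by \<open>fact k\<close> both sides are sums over all tuples, where
  traces can be exchanged slot by slot. It makes the choice of the basis inside \<open>hodge\<close>
  immaterial.\<close>

lemma sum_over_sets_orthonormal_invariant: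
  fixes b b' :: "nat \<Rightarrow> 'e::euclidean_space"
  assumes e: "coframe e" "dual_basis e b" and b': "orthonormal_basis (coframe_metric e) b'"
    and a: "alt k a" and c: "alt m c"
  shows "(\<Sum>I | I \<subseteq> {1..DIM('e)} \<and> card I = k. a (map b' (sorted_list_of_set I)) * c (map b' (sorted_list_of_set I) @ us)) =
    (\<Sum>I | I \<subseteq> {1..DIM('e)} \<and> card I = k. a (map b (sorted_list_of_set I)) * c (map b (sorted_list_of_set I) @ us))"
proof -
  have "fact k * (\<Sum>I | I \<subseteq> {1..DIM('e)} \<and> card I = k. a (map b' (sorted_list_of_set I)) * c (map b' (sorted_list_of_set I) @ us)) =
    fact k * (\<Sum>I | I \<subseteq> {1..DIM('e)} \<and> card I = k. a (map b (sorted_list_of_set I)) * c (map b (sorted_list_of_set I) @ us))"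
    unfolding sum_over_sets_eq_tuple_sum[OF a c]
  proof (rule tuple_sum_basis_change[OF _ a c], intro allI impI)
    fix K :: "'e \<Rightarrow> 'e \<Rightarrow> real"
    assume "(\<forall>v. linear (\<lambda>u. K u v)) \<and> (\<forall>u. linear (K u))"
    then show "(\<Sum>i = 1..DIM('e). K (b' i) (b' i)) = (\<Sum>i = 1..DIM('e). K (b i) (b i))"
      by (intro orthonormal_basis_trace[OF e b']) auto
  qed
  then show ?thesis by simp
qed

lemma hodge_eq:
  fixes b :: "nat \<Rightarrow> 'e::euclidean_space"
  assumes e: "coframe e" "dual_basis e b" and a: "alt k a" and vol: "alt DIM('e) vol" and "k \<le> DIM('e)"
  shows "hodge (coframe_metric e) vol a = (\<lambda>vs.
    \<Sum>I | I \<subseteq> {1..DIM('e)} \<and> card I = k. a (map b (sorted_list_of_set I)) * vol (map b (sorted_list_of_set I) @ vs))"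
    (is "_ = ?R")
proof
  fix vs :: "'e list"
  let ?n = "DIM('e)"
  define b' where "b' = (SOME b. orthonormal_basis (coframe_metric e) b)"
  have b': "orthonormal_basis (coframe_metric e) b'"
    unfolding b'_def
    by (rule someI[where P = "orthonormal_basis (coframe_metric e)", OF dual_basis_orthonormal[OF e(2)]])
  have len: "length (sorted_list_of_set I) = card I" if "I \<subseteq> {1..?n}" for I
    using finite_subset[OF that] by simp
  show "hodge (coframe_metric e) vol a vs = ?R vs"
  proof (cases "length vs + k = ?n")
    case True
    then have "?n - length vs = k" "length vs \<le> ?n" by auto
    then have "hodge (coframe_metric e) vol a vs = (\<Sum>I | I \<subseteq> {1..?n} \<and> card I = k.
       a (map b' (sorted_list_of_set I)) * vol (map b' (sorted_list_of_set I) @ vs))"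
      by (simp add: hodge_def b'_def Let_def)
    then show ?thesis
      using sum_over_sets_orthonormal_invariant[OF e b' a vol] by simp
  next
    \<comment> \<open>In the wrong degree both sides vanish, for different reasons: on the right the
      argument list has the wrong length for \<open>vol\<close>, while in the definition the index
      sets have the wrong size for \<open>a\<close> or the list is too long.\<close>
    case False
    have "?R vs = 0"
      by (rule sum.neutral) (use False alt_homog[OF vol] len in \<open>auto simp: homog_def\<close>)
    moreover have "hodge (coframe_metric e) vol a vs = 0"
    proof (cases "length vs \<le> ?n")
      case le: True
      have "(\<Sum>I | I \<subseteq> {1..?n} \<and> card I = ?n - length vs.
         a (map b' (sorted_list_of_set I)) * vol (map b' (sorted_list_of_set I) @ vs)) = 0"
        by (rule sum.neutral) (use False le alt_homog[OF a] len in \<open>auto simp: homog_def\<close>)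
      then show ?thesis by (simp add: hodge_def b'_def Let_def)
    qed (simp add: hodge_def Let_def)
    ultimately show ?thesis by simp
  qed
qed

lemma hodge_zero [simp]: "hodge g vol 0 = 0"
  by (auto simp: hodge_def Let_def)

section \<open>Evaluation in a coframe\<close>

lemma cscale_one [simp]: "1 *\<^sub>C a = a"
  and cscale_zero_left [simp]: "0 *\<^sub>C a = 0"
  and cscale_zero [simp]: "c *\<^sub>C 0 = 0"
  and cscale_cscale: "c *\<^sub>C d *\<^sub>C a = (c * d) *\<^sub>C a"
  and cscale_minus: "c *\<^sub>C (- a) = - (c *\<^sub>C a)"
  and cscale_add: "c *\<^sub>C (a + b) = c *\<^sub>C a + c *\<^sub>C b"
  and cscale_diff: "c *\<^sub>C (a - b) = c *\<^sub>C a - c *\<^sub>C b"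
  by (auto simp: cscale_def algebra_simps)

lemma wedge_one [simp]: "wedge a one_cov = a"
proof
  fix vs show "wedge a one_cov vs = a vs"
  proof (induction vs arbitrary: a)
    case (Cons v vs)
    have "contr v one_cov = 0"
      by (auto simp: contr_def one_cov_def)
    then show ?case by (simp add: wedge_Cons Cons) (simp add: contr_def)
  qed (simp add: one_cov_def)
qed

lemma contr_one_cov [simp]: "contr v one_cov = 0"
  by (auto simp: contr_def one_cov_def)

lemma one_cov_Nil [simp]: "one_cov [] = 1"
  by (simp add: one_cov_def)

lemma alt_1_contr: "alt 1 a \<Longrightarrow> contr v a = a [v] *\<^sub>C one_cov"
  using homog_0_eq[of "contr v a"] alt_contr[of 1 a v] by (simp add: contr_def)

lemma alt_1_Nil: "alt 1 a \<Longrightarrow> a [] = 0"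
  using alt_homog by (fastforce simp: homog_def)

lemma alt_1_contr_wedge:
  "alt 1 a \<Longrightarrow> contr v (wedge a X) = a [v] *\<^sub>C X - wedge a (contr v X)"
  by (simp add: contr_wedge alt_1_contr wedge_linear homog_twist[OF alt_homog] cscale_minus_one)

lemma wedge_Cons_contr: "wedge a c (v # vs) = contr v (wedge a c) vs"
  by (simp add: contr_def)

lemma sorted_subseqs: "xs \<in> set (subseqs ys) \<Longrightarrow> sorted ys \<Longrightarrow> sorted xs"
proof (induction ys arbitrary: xs)
  case (Cons y ys)
  have "set zs \<subseteq> set ys" if "zs \<in> set (subseqs ys)" for zs
    using subseqs_powset[of ys] that by blast
  with Cons show ?case by (fastforce simp: Let_def)
qed simp

lemma sorted_list_of_set_in_subseqs:
  assumes "I \<subseteq> {1..n}" "card I = k"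
  shows "sorted_list_of_set I \<in> set (filter (\<lambda>xs. length xs = k) (subseqs [1..<Suc n]))"
proof -
  have fin: "finite I" using assms(1) finite_subset by blast
  have "I \<in> set ` set (subseqs [1..<Suc n])"
    unfolding subseqs_powset using assms(1) by (auto simp: atLeastLessThanSuc_atLeastAtMost)
  then obtain xs where xs: "xs \<in> set (subseqs [1..<Suc n])" "I = set xs" by auto
  have "sorted xs" "distinct xs"
    using sorted_subseqs[OF xs(1) sorted_upt] subseqs_distinctD[OF xs(1) distinct_upt] .
  then show ?thesis
    using xs assms(2) by (simp add: sorted_list_of_set.idem_if_sorted_distinct distinct_card)
qed

text \<open>Identities between explicit forms go through this rule. Once the dimension is a numeral,
  the filtered list evaluates to all increasing multi-indices, and each component is decided by
  rewriting.\<close>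

lemma alt_eqI:
  fixes b :: "nat \<Rightarrow> 'e::euclidean_space"
  assumes b: "dual_basis e b" and a: "alt k a" "alt k c"
    and eq: "list_all (\<lambda>xs. a (map b xs) = c (map b xs))
      (filter (\<lambda>xs. length xs = k) (subseqs [1..<Suc DIM('e)]))"
  shows "a = c"
proof -
  have "a - c = 0"
  proof (rule alt_eq_0_if_zero_on_sorted[OF b alt_diff[OF a]])
    fix I :: "nat set" assume "I \<subseteq> {1..DIM('e)}" "card I = k"
    from sorted_list_of_set_in_subseqs[OF this] eq
    show "(a - c) (map b (sorted_list_of_set I)) = 0"
      by (auto simp: list_all_iff)
  qed
  then show ?thesis by simp
qed

text \<open>Any index set of size \<open>k\<close> other than the complement of \<open>J\<close>
  meets \<open>J\<close>, and then \<open>vol\<close> has a repeated argument. The sign of the star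
  stays inside \<open>vol (map b (I @ J))\<close>, to be evaluated later.\<close>

lemma hodge_on_basis:
  fixes b :: "nat \<Rightarrow> 'e::euclidean_space"
  assumes e: "coframe e" "dual_basis e b" and a: "alt k a" and vol: "alt DIM('e) vol"
    and J: "distinct J" "set J \<subseteq> {1..DIM('e)}" "length J + k = DIM('e)"
  defines "I \<equiv> filter (\<lambda>i. i \<notin> set J) [1..<Suc DIM('e)]"
  shows "hodge (coframe_metric e) vol a (map b J) = a (map b I) * vol (map b (I @ J))"
proof -
  let ?n = "DIM('e)"
  define I0 where "I0 = {1..?n} - set J"
  have I0: "I0 \<subseteq> {1..?n}" "card I0 = k" "finite I0"
    using J by (auto simp: I0_def card_Diff_subset distinct_card)
  have I: "sorted_list_of_set I0 = I"
  proof -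
    have "set I = I0" "distinct I" by (auto simp: I_def I0_def simp del: upt.simps)
    moreover have "sorted I" unfolding I_def by (rule sorted_wrt_filter[OF sorted_upt])
    ultimately show ?thesis by (metis sorted_list_of_set.idem_if_sorted_distinct)
  qed
  have "hodge (coframe_metric e) vol a (map b J) = (\<Sum>I | I \<subseteq> {1..?n} \<and> card I = k.
      a (map b (sorted_list_of_set I)) * vol (map b (sorted_list_of_set I) @ map b J))"
    using J(3) by (subst hodge_eq[OF e a vol]) auto
  also have "\<dots> = (\<Sum>I \<in> {I0}.
      a (map b (sorted_list_of_set I)) * vol (map b (sorted_list_of_set I) @ map b J))"
  proof (rule sum.mono_neutral_right)
    show "finite {I. I \<subseteq> {1..?n} \<and> card I = k}"
      by (rule finite_subset[of _ "Pow {1..?n}"]) auto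
    show "\<forall>I \<in> {I. I \<subseteq> {1..?n} \<and> card I = k} - {I0}.
      a (map b (sorted_list_of_set I)) * vol (map b (sorted_list_of_set I) @ map b J) = 0"
    proof
      fix I assume "I \<in> {I. I \<subseteq> {1..?n} \<and> card I = k} - {I0}"
      then have I: "I \<subseteq> {1..?n}" "card I = k" "I \<noteq> I0" "finite I"
        using finite_subset by auto
      have "I \<inter> set J \<noteq> {}"
      proof
        assume "I \<inter> set J = {}"
        then have "I \<subseteq> I0" using I(1) by (auto simp: I0_def)
        then show False using card_subset_eq[OF I0(3)] I I0 by auto
      qed
      then have "\<not> distinct (map b (sorted_list_of_set I @ J))"
        using I(4) unfolding distinct_map by auto
      then show "a (map b (sorted_list_of_set I)) * vol (map b (sorted_list_of_set I) @ map b J) = 0"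
        using alt_not_distinct[OF vol] by simp
    qed
  qed (use I0 in auto)
  finally show ?thesis by (simp add: I)
qed

lemma alt_map_scaleR: "alt k a \<Longrightarrow> a (map (\<lambda>i. c *\<^sub>R f i) xs) = c ^ length xs * a (map f xs)"
proof (induction xs arbitrary: k a)
  case (Cons x xs)
  have "a (map (\<lambda>i. c *\<^sub>R f i) (x # xs)) = c * contr (f x) a (map (\<lambda>i. c *\<^sub>R f i) xs)"
    using alt_contr_scaleR[OF Cons.prems, of c "f x"] by (simp add: contr_apply cscale_apply)
  also have "\<dots> = c ^ length (x # xs) * a (map f (x # xs))"
    unfolding Cons.IH[OF alt_contr[OF Cons.prems]] by (simp add: contr_def)
  finally show ?case .
qed simp

lemma homog_contr_2: "alt 2 a \<Longrightarrow> contr v (contr u a) = a [u, v] *\<^sub>C one_cov"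
  using homog_0_eq[of "contr v (contr u a)"] homog_contr[of 0 "contr u a" v] homog_contr[of 1 a u]
    alt_homog[of 2 a]
  by (simp add: contr_def numeral_2_eq_2 One_nat_def)

text \<open>Rewrite rules for a 2-form known only through its values \<open>a [u, v]\<close>:
  contracted once it behaves like a 1-form, contracted twice like a scalar. Products with an
  unspecified 2-form can thus be evaluated like products of coframe elements.\<close>

lemma alt_2_contr:
  assumes "alt 2 a"
  shows "contr v (contr u a) = a [u, v] *\<^sub>C one_cov" "contr u a [] = 0"
    "contr v (wedge a X) = wedge (contr v a) X + wedge a (contr v X)"
    "contr v (wedge (contr u a) X) = a [u, v] *\<^sub>C X - wedge (contr u a) (contr v X)"
    "a [] = 0" "contr u a [w] = a [u, w]"
proof -
  have 1: "alt 1 (contr u a)" using alt_contr[OF assms, of u] by (simp add: One_nat_def)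
  show "contr v (contr u a) = a [u, v] *\<^sub>C one_cov" "contr u a [] = 0"
    "contr v (wedge (contr u a) X) = a [u, v] *\<^sub>C X - wedge (contr u a) (contr v X)"
    using homog_contr_2[OF assms] alt_1_Nil[OF 1] alt_1_contr_wedge[OF 1] by (simp_all add: contr_def)
  show "contr v (wedge a X) = wedge (contr v a) X + wedge a (contr v X)"
    using homog_twist[OF alt_homog[OF assms]] by (simp add: contr_wedge)
  show "a [] = 0" "contr u a [w] = a [u, w]" using alt_homog[OF assms] by (simp_all add: homog_def contr_def)
qed

lemmas coframe_monom_expand = coframe_monom.simps(2) coframe_monom_Nil

declare coframe_monom.simps [simp del]

locale frame =
  fixes e :: "nat \<Rightarrow> 'e::euclidean_space list \<Rightarrow> real" and b :: "nat \<Rightarrow> 'e"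
  assumes cofr: "coframe e" and dual: "dual_basis e b"
begin

lemma e_alt: "1 \<le> i \<Longrightarrow> i \<le> DIM('e) \<Longrightarrow> alt 1 (e i)"
  using coframe_alt[OF cofr] by simp

lemma e_Nil: "1 \<le> i \<Longrightarrow> i \<le> DIM('e) \<Longrightarrow> e i [] = 0"
  using alt_1_Nil[OF e_alt] .

lemma contr_e: "1 \<le> i \<Longrightarrow> i \<le> DIM('e) \<Longrightarrow> contr v (e i) = e i [v] *\<^sub>C one_cov"
  using alt_1_contr[OF e_alt] .

lemma contr_e_wedge:
  "1 \<le> i \<Longrightarrow> i \<le> DIM('e) \<Longrightarrow> contr v (wedge (e i) X) = e i [v] *\<^sub>C X - wedge (e i) (contr v X)"
  using alt_1_contr_wedge[OF e_alt] .

lemma e_Cons: "1 \<le> i \<Longrightarrow> i \<le> DIM('e) \<Longrightarrow> e i (u # v # vs) = 0"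
  using alt_homog[OF e_alt] by (simp add: homog_def One_nat_def)

lemma e_b: "1 \<le> i \<Longrightarrow> i \<le> DIM('e) \<Longrightarrow> 1 \<le> j \<Longrightarrow> j \<le> DIM('e) \<Longrightarrow> e i [b j] = (if i = j then 1 else 0)"
  using dual by (simp add: dual_basis_def)

lemma e_commute:
  "1 \<le> i \<Longrightarrow> i \<le> DIM('e) \<Longrightarrow> 1 \<le> j \<Longrightarrow> j \<le> DIM('e) \<Longrightarrow> wedge (e i) (e j) = - wedge (e j) (e i)"
  using wedge_commute[OF alt_homog[OF e_alt] alt_homog[OF e_alt], of i j] by (simp add: cscale_minus_one)

lemma alt_monom: "set is \<subseteq> {1..DIM('e)} \<Longrightarrow> length is = k \<Longrightarrow> alt k (coframe_monom e is)"
  using alt_coframe_monom[of "is" e] e_alt by fastforce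

text \<open>Evaluation as rewriting: each argument enters the product as a contraction, which the
  antiderivation rule pushes through the factors until only the numbers \<open>e i [b j]\<close> are
  left.\<close>

lemmas frame_simps = wedge_Cons_contr contr_linear contr_e_wedge contr_e e_Nil e_Cons e_b wedge_linear
  cscale_apply cscale_cscale cscale_minus cscale_add cscale_diff coframe_monom_expand

end

lemma ivl7: "{1..7::nat} = {1, 2, 3, 4, 5, 6, 7}"
  by auto

lemma subseqs7: "filter (\<lambda>xs. length xs = 7) (subseqs [1..<Suc 7]) = [[1, 2, 3, 4, 5, 6, 7::nat]]"
  by code_simp

section \<open>A \<open>G\<^sub>2\<close>-structure determines its metric and volume form\<close>

locale frame7 = frame e b for e :: "nat \<Rightarrow> 'e::euclidean_space list \<Rightarrow> real" and b +
  assumes dim: "DIM('e) = 7"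
begin

definition phi where
  "phi = coframe_monom e [1,2,7] + coframe_monom e [3,4,7] + coframe_monom e [5,6,7] +
         coframe_monom e [1,3,5] - coframe_monom e [1,4,6] - coframe_monom e [2,3,6] - coframe_monom e [2,4,5]"

lemma alt_phi: "alt 3 phi"
  unfolding phi_def by (intro alt_add alt_diff alt_monom) (auto simp: dim)

text \<open>Each of the 21 pairs of basis vectors selects a single covector up to sign, and each
  covector is selected by three pairs: the incidences of the Fano plane, that is, of octonion
  multiplication.\<close>

lemma phi_contr_coefs:
  "contr u phi [b 1, b 2] = e 7 [u]"
  "contr u phi [b 1, b 3] = e 5 [u]"
  "contr u phi [b 1, b 4] = - e 6 [u]"
  "contr u phi [b 1, b 5] = - e 3 [u]"
  "contr u phi [b 1, b 6] = e 4 [u]"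
  "contr u phi [b 1, b 7] = - e 2 [u]"
  "contr u phi [b 2, b 3] = - e 6 [u]"
  "contr u phi [b 2, b 4] = - e 5 [u]"
  "contr u phi [b 2, b 5] = e 4 [u]"
  "contr u phi [b 2, b 6] = e 3 [u]"
  "contr u phi [b 2, b 7] = e 1 [u]"
  "contr u phi [b 3, b 4] = e 7 [u]"
  "contr u phi [b 3, b 5] = e 1 [u]"
  "contr u phi [b 3, b 6] = - e 2 [u]"
  "contr u phi [b 3, b 7] = - e 4 [u]"
  "contr u phi [b 4, b 5] = - e 2 [u]"
  "contr u phi [b 4, b 6] = - e 1 [u]"
  "contr u phi [b 4, b 7] = e 3 [u]"
  "contr u phi [b 5, b 6] = e 7 [u]"
  "contr u phi [b 5, b 7] = - e 6 [u]"
  "contr u phi [b 6, b 7] = e 5 [u]"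
  unfolding phi_def by (simp_all add: frame_simps dim)

text \<open>The factor 6 is visible for \<open>u = v = b 7\<close>: the contraction is \<omega>, its
  square consists of three monomials with coefficient 2, and each of them is completed to the volume
  form by one monomial of \<open>phi\<close>.\<close>

lemma wedge_phi_on_basis:
  "wedge (contr u phi) (wedge (contr v phi) phi) [b 1, b 2, b 3, b 4, b 5, b 6, b 7] =
    6 * coframe_metric e u v"
proof -
  \<comment> \<open>The explicit factor is moved to the front, at no cost in sign because the
    degrees are 4 and 3; its seven monomials then consume three of the arguments and the unspecified
    2-forms the rest.\<close>
  have expand: "wedge \<alpha> (wedge \<beta> phi) [b 1, b 2, b 3, b 4, b 5, b 6, b 7] =
      wedge phi (wedge \<alpha> \<beta>) [b 1, b 2, b 3, b 4, b 5, b 6, b 7]"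
    if "alt 2 \<alpha>" "alt 2 \<beta>" for \<alpha> \<beta>
    using wedge_commute[of 4 "wedge \<alpha> \<beta>" 3 phi] homog_wedge[of 2 \<alpha> 2 \<beta>] that alt_phi
    by (simp add: wedge_assoc alt_homog)
  have 2: "alt 2 (contr w phi)" for w
    using alt_contr[OF alt_phi, of w] by simp
  \<comment> \<open>The contractions are generalised to arbitrary 2-forms and coefficient functions,
    so that \<open>phi\<close> is expanded only once and its contractions enter through their table
    of components.\<close>
  have "wedge phi (wedge \<alpha> \<beta>) [b 1, b 2, b 3, b 4, b 5, b 6, b 7] =
      6 * (\<Sum>k = 1..7. x k * y k)"
    if \<alpha>: "alt 2 \<alpha>" and \<beta>: "alt 2 \<beta>"
      and "\<And>p q. \<alpha> [b p, b q] = contr u phi [b p, b q]" "\<And>p q. \<beta> [b p, b q] = contr v phi [b p, b q]"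
      and "\<And>k. x k = e k [u]" "\<And>k. y k = e k [v]" for \<alpha> \<beta> x y
    by (subst phi_def, simp add: frame_simps dim wedge_assoc alt_2_contr[OF \<alpha>] alt_2_contr[OF \<beta>],
        simp add: that(3-6) phi_contr_coefs ivl7 algebra_simps)
  from this[OF 2 2 refl refl refl refl] show ?thesis
    unfolding expand[OF 2 2] by (simp add: coframe_metric_def dim)
qed

end

lemma (in frame7) vol_on_basis: "coframe_monom e [1,2,3,4,5,6,7] [b 1, b 2, b 3, b 4, b 5, b 6, b 7] = 1"
  by (simp add: frame_simps dim)

lemma (in frame7) alt_vol: "alt 7 (coframe_monom e [1,2,3,4,5,6,7])"
  by (rule alt_monom) (auto simp: dim)

lemma (in frame7) top_form_eq:
  assumes "alt 7 X"
  shows "X = X [b 1, b 2, b 3, b 4, b 5, b 6, b 7] *\<^sub>C coframe_monom e [1,2,3,4,5,6,7]"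
  by (rule alt_eqI[OF dual assms alt_scale[OF alt_vol]])
    (simp only: dim subseqs7, simp add: cscale_apply vol_on_basis)

lemma (in frame7) wedge_phi:
  "wedge (contr u phi) (wedge (contr v phi) phi) =
    (6 * coframe_metric e u v) *\<^sub>C coframe_monom e [1,2,3,4,5,6,7]"
proof -
  have "alt 2 (contr w phi)" for w
    using alt_contr[OF alt_phi, of w] by simp
  then have "alt 7 (wedge (contr u phi) (wedge (contr v phi) phi))"
    using alt_wedge[of 2 "contr u phi" 5 "wedge (contr v phi) phi"] alt_wedge[of 2 "contr v phi" 3 phi]
      alt_phi by simp
  from top_form_eq[OF this] show ?thesis by (simp only: wedge_phi_on_basis)
qed

text \<open>The metric and the volume form are recovered from
  \<open>(u \<lrcorner> \<phi>) \<and> (v \<lrcorner> \<phi>) \<and> \<phi> = 6 g(u, v) vol\<close>, which determines them up to a factor that has to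
  be 1 because the volume form has unit length.\<close>

lemma g2_adapted_unique:
  fixes e e' :: "nat \<Rightarrow> 'e::euclidean_space list \<Rightarrow> real"
  assumes dim: "DIM('e) = 7" and e: "coframe e" "g2_adapted p e" and e': "coframe e'" "g2_adapted p e'"
  shows "coframe_metric e = coframe_metric e'"
    and "coframe_monom e [1,2,3,4,5,6,7] = coframe_monom e' [1,2,3,4,5,6,7]"
proof -
  obtain b where b: "dual_basis e b" using coframe_dual_basis_exists[OF e(1)] .
  obtain b' where b': "dual_basis e' b'" using coframe_dual_basis_exists[OF e'(1)] .
  interpret f: frame7 e b by unfold_locales (fact e b dim)+
  interpret f': frame7 e' b' by unfold_locales (fact e' b' dim)+
  have p: "p = f.phi" "p = f'.phi"
    using e(2) e'(2) by (simp_all add: g2_adapted_def f.phi_def f'.phi_def)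
  let ?vol = "coframe_monom e [1,2,3,4,5,6,7]" and ?vol' = "coframe_monom e' [1,2,3,4,5,6,7]"
  let ?B = "[b 1, b 2, b 3, b 4, b 5, b 6, b 7]" and ?B' = "[b' 1, b' 2, b' 3, b' 4, b' 5, b' 6, b' 7]"
  let ?g = "coframe_metric e" and ?g' = "coframe_metric e'"
  \<comment> \<open>The volume forms differ by the factor \<open>c\<close>. Equating the two
    expressions for the wedge identity then gives \<open>?g = c * ?g'\<close>.\<close>
  define c where "c = ?vol' ?B"
  have vol': "?vol' = c *\<^sub>C ?vol"
    unfolding c_def by (rule f.top_form_eq[OF f'.alt_vol])
  have g: "?g u v = c * ?g' u v" for u v
  proof -
    have "(6 * ?g u v) *\<^sub>C ?vol = (6 * ?g' u v) *\<^sub>C ?vol'"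
      using f.wedge_phi[of u v] f'.wedge_phi[of u v] p by simp
    from fun_cong[OF this, of ?B] show ?thesis
      by (simp add: cscale_apply f.vol_on_basis c_def)
  qed
  have cB': "c * ?vol ?B' = 1"
    using fun_cong[OF vol', of ?B'] by (simp add: f'.vol_on_basis cscale_apply)
  have b'_ortho: "?g' (b' i) (b' j) = (if i = j then 1 else 0)" if "i \<in> {1..7}" "j \<in> {1..7}" for i j
    using dual_basis_orthonormal[OF b'] that by (simp add: orthonormal_basis_def dim)
  have "?g (b' 1) (b' 1) \<ge> 0"
    by (simp add: coframe_metric_def sum_nonneg)
  \<comment> \<open>The vector \<open>b' 1\<close> has unit length for \<open>?g'\<close>, so its
    square length for \<open>?g\<close> is \<open>c\<close>, which is nonnegative;
    \<open>c = 0\<close> would contradict \<open>cB'\<close>.\<close>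
  then have "c > 0"
    using g[of "b' 1" "b' 1"] b'_ortho[of 1 1] cB' by (cases "c = 0") auto
  \<comment> \<open>Scaling by \<open>r\<close> turns the basis that is orthonormal for
    \<open>?g'\<close> into one that is orthonormal for \<open>?g\<close>.\<close>
  define r where "r = inverse (sqrt c)"
  have r: "r * r * c = 1"
    using \<open>c > 0\<close> by (simp add: r_def field_simps flip: real_sqrt_mult)
  have lin: "?g (r *\<^sub>R u) (r *\<^sub>R v) = r * r * ?g u v" for u v
    using linear_cmul[OF coframe_metric_bilinear(1)[OF e(1)]] linear_cmul[OF coframe_metric_bilinear(2)[OF e(1)]]
    by simp
  have ortho: "orthonormal_basis ?g (\<lambda>i. r *\<^sub>R b' i)"
    unfolding orthonormal_basis_def dim lin unfolding g using b'_ortho r by (simp add: mult.assoc)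
  have I: "{I. I \<subseteq> {1..DIM('e)} \<and> card I = 7} = {{1..7}}"
    using card_subset_eq[of "{1..7::nat}"] by (auto simp: dim)
  have sl: "sorted_list_of_set {1..7::nat} = [1,2,3,4,5,6,7]"
    by code_simp
  \<comment> \<open>In degree 7 there is a single index set, so basis invariance says that the
    squared volume is the same on all orthonormal bases.\<close>
  have "?vol (map (\<lambda>i. r *\<^sub>R b' i) [1,2,3,4,5,6,7]) * ?vol (map (\<lambda>i. r *\<^sub>R b' i) [1,2,3,4,5,6,7]) =
      ?vol ?B * ?vol ?B"
    using sum_over_sets_orthonormal_invariant[OF e(1) b ortho f.alt_vol f.alt_vol, of "[]"]
    unfolding I by (simp add: sl)
  then have "r ^ 7 * ?vol ?B' * (r ^ 7 * ?vol ?B') = 1"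
    unfolding alt_map_scaleR[OF f.alt_vol] by (simp add: f.vol_on_basis) (simp add: numeral_eq_Suc)
  then have "(r * r) ^ 7 * ?vol ?B' ^ 2 = 1"
    by (simp add: power_mult_distrib power2_eq_square algebra_simps)
  \<comment> \<open>Seven factors \<open>c\<close> absorb the powers of \<open>r * r\<close> and two
    absorb the square of \<open>?vol ?B'\<close>, which leaves \<open>c ^ 9 = 1\<close>.\<close>
  then have "((r * r) ^ 7 * ?vol ?B' ^ 2) * c ^ 9 = c ^ 9"
    by simp
  moreover have "((r * r) ^ 7 * ?vol ?B' ^ 2) * c ^ 9 = (r * r * c) ^ 7 * (c * ?vol ?B') ^ 2"
    by (simp add: power_mult_distrib algebra_simps flip: power_add)
  ultimately have "c ^ 9 = 1"
    by (simp only: r cB') simp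
  then have "c = 1"
    using \<open>c > 0\<close> power_eq_iff_eq_base[of 9 c 1] by simp
  then show "?g = ?g'" "?vol = ?vol'"
    using g vol' by (auto simp: fun_eq_iff)
qed

section \<open>The algebra of an \<open>SU(3)\<close>-structure\<close>

lemma ivl6: "{1..6::nat} = {1, 2, 3, 4, 5, 6}"
  by auto

lemma upt6: "[1..<Suc 6] = [1, 2, 3, 4, 5, 6::nat]"
  by code_simp

lemma subseqs6_1: "filter (\<lambda>xs. length xs = 1) (subseqs [1..<Suc 6]) =
    [[1], [2], [3], [4], [5], [6::nat]]"
  by code_simp

lemma subseqs6_2: "filter (\<lambda>xs. length xs = 2) (subseqs [1..<Suc 6]) =
    [[1,2], [1,3], [1,4], [1,5], [1,6], [2,3], [2,4], [2,5], [2,6], [3,4], [3,5], [3,6], [4,5], [4,6], [5,6::nat]]"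
  by code_simp

lemma subseqs6_3: "filter (\<lambda>xs. length xs = 3) (subseqs [1..<Suc 6]) =
    [[1,2,3], [1,2,4], [1,2,5], [1,2,6], [1,3,4], [1,3,5], [1,3,6], [1,4,5], [1,4,6], [1,5,6],
     [2,3,4], [2,3,5], [2,3,6], [2,4,5], [2,4,6], [2,5,6], [3,4,5], [3,4,6], [3,5,6], [4,5,6::nat]]"
  by code_simp

lemma subseqs6_4: "filter (\<lambda>xs. length xs = 4) (subseqs [1..<Suc 6]) =
    [[1,2,3,4], [1,2,3,5], [1,2,3,6], [1,2,4,5], [1,2,4,6], [1,2,5,6], [1,3,4,5], [1,3,4,6], [1,3,5,6],
     [1,4,5,6], [2,3,4,5], [2,3,4,6], [2,3,5,6], [2,4,5,6], [3,4,5,6::nat]]"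
  by code_simp

lemma subseqs6_5: "filter (\<lambda>xs. length xs = 5) (subseqs [1..<Suc 6]) =
    [[1,2,3,4,5], [1,2,3,4,6], [1,2,3,5,6], [1,2,4,5,6], [1,3,4,5,6], [2,3,4,5,6::nat]]"
  by code_simp

lemma subseqs6_6: "filter (\<lambda>xs. length xs = 6) (subseqs [1..<Suc 6]) = [[1,2,3,4,5,6::nat]]"
  by code_simp

definition contr_list :: "'e list \<Rightarrow> ('e list \<Rightarrow> real) \<Rightarrow> 'e list \<Rightarrow> real" where
  "contr_list us a = (\<lambda>vs. a (us @ vs))"

lemma contr_list_Nil [simp]: "contr_list [] a = a"
  and contr_list_Cons: "contr_list (u # us) a = contr_list us (contr u a)"
  by (simp_all add: contr_list_def contr_def)

lemma alt_contr_list: "alt k a \<Longrightarrow> alt (k - length us) (contr_list us a)"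
proof (induction us arbitrary: k a)
  case (Cons u us)
  then show ?case using Cons.IH[OF alt_contr[OF Cons.prems, of u]] by (simp add: contr_list_Cons One_nat_def)
qed simp

locale frame6 = frame e b for e :: "nat \<Rightarrow> 'e::euclidean_space list \<Rightarrow> real" and b +
  assumes dim: "DIM('e) = 6"
begin

abbreviation "vol \<equiv> coframe_monom e [1,2,3,4,5,6]"
abbreviation "w \<equiv> coframe_monom e [1,2] + coframe_monom e [3,4] + coframe_monom e [5,6]"
abbreviation "p \<equiv> coframe_monom e [1,3,5] - coframe_monom e [1,4,6] - coframe_monom e [2,3,6] - coframe_monom e [2,4,5]"
abbreviation "m \<equiv> - coframe_monom e [2,4,6] + coframe_monom e [2,3,5] + coframe_monom e [1,4,5] + coframe_monom e [1,3,6]"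
abbreviation "star \<equiv> hodge (coframe_metric e) vol"

lemma alt_vol: "alt 6 vol" by (rule alt_monom) (auto simp: dim)

lemma alt_w: "alt 2 w" by (intro alt_add alt_monom) (auto simp: dim)
lemma alt_p: "alt 3 p" by (intro alt_diff alt_monom) (auto simp: dim)
lemma alt_m: "alt 3 m" by (intro alt_add alt_minus alt_monom) (auto simp: dim)

lemma alt_ww: "alt 4 (wedge w w)"
  using alt_wedge[OF alt_w alt_w] by simp

lemmas eqI_1 = alt_eqI[OF dual, of 1, unfolded dim subseqs6_1]
lemmas eqI_5 = alt_eqI[OF dual, of 5, unfolded dim subseqs6_5]
lemmas eqI_6 = alt_eqI[OF dual, of 6, unfolded dim subseqs6_6]

text \<open>In the dual basis the star of a form is a finite linear combination of iterated
  contractions of the volume form.\<close>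

lemma alt_star:
  assumes "alt k a" "k \<le> 6"
  shows "alt (6 - k) (star a)"
proof -
  have sum: "alt l (\<lambda>vs. \<Sum>I\<in>S. f I vs)" if "finite S" "\<And>I. I \<in> S \<Longrightarrow> alt l (f I)" for S :: "nat set set" and f l
    using that
  proof (induction S rule: finite_induct)
    case (insert I S)
    then show ?case using alt_add[of l "f I" "\<lambda>vs. \<Sum>I\<in>S. f I vs"] by (simp add: plus_fun_def)
  qed (use alt_zero[of l] in \<open>simp add: zero_fun_def\<close>)
  have fin: "finite {I. I \<subseteq> {1..6::nat} \<and> card I = k}"
    by (rule finite_subset[of _ "Pow {1..6::nat}"]) auto
  show ?thesis
    unfolding hodge_eq[OF cofr dual assms(1), unfolded dim, OF alt_vol assms(2)]
  proof (rule sum[OF fin])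
    fix I :: "nat set" assume "I \<in> {I. I \<subseteq> {1..6} \<and> card I = k}"
    then have "length (map b (sorted_list_of_set I)) = k"
      using finite_subset[of I "{1..6}"] by simp
    with alt_contr_list[OF alt_vol, of "map b (sorted_list_of_set I)"]
    have "alt (6 - k) (\<lambda>vs. vol (map b (sorted_list_of_set I) @ vs))" by (simp add: contr_list_def)
    from alt_scale[OF this] show "alt (6 - k) (\<lambda>vs. a (map b (sorted_list_of_set I)) * vol (map b (sorted_list_of_set I) @ vs))"
      by (simp add: cscale_def)
  qed
qed

lemma star_on_basis:
  assumes "alt k a" "distinct J" "set J \<subseteq> {1..6}" "length J + k = 6"
  shows "star a (map b J) = a (map b (filter (\<lambda>i. i \<notin> set J) [1, 2, 3, 4, 5, 6])) *
     vol (map b (filter (\<lambda>i. i \<notin> set J) [1, 2, 3, 4, 5, 6] @ J))"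
  using hodge_on_basis[OF cofr dual assms(1), unfolded dim, OF alt_vol assms(2-4)] unfolding upt6 .

lemma vol_on_basis: "vol [b 1, b 2, b 3, b 4, b 5, b 6] = 1"
  by (simp add: frame_simps dim)

lemma www: "wedge w (wedge w w) = 6 *\<^sub>C vol"
proof (rule eqI_6)
  show "alt 6 (wedge w (wedge w w))"
    using alt_wedge[OF alt_w alt_ww] by simp
qed (intro alt_scale alt_vol, simp add: frame_simps dim wedge_assoc)

lemma w_p: "wedge w p = 0"
proof (rule eqI_5)
  show "alt 5 (wedge w p)"
    using alt_wedge[OF alt_w alt_p] by simp
qed (auto simp: frame_simps dim wedge_assoc)

lemma w_m: "wedge w m = 0"
proof (rule eqI_5)
  show "alt 5 (wedge w m)"
    using alt_wedge[OF alt_w alt_m] by simp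
qed (auto simp: frame_simps dim wedge_assoc)

lemma star_on_basis_all:
  assumes "alt k a" "l + k = 6"
  shows "list_all (\<lambda>J. star a (map b J) = a (map b (filter (\<lambda>i. i \<notin> set J) [1, 2, 3, 4, 5, 6])) *
     vol (map b (filter (\<lambda>i. i \<notin> set J) [1, 2, 3, 4, 5, 6] @ J)))
     (filter (\<lambda>xs. length xs = l) (subseqs [1..<Suc 6]))"
  unfolding list_all_iff
proof
  fix J assume J: "J \<in> set (filter (\<lambda>xs. length xs = l) (subseqs [1..<Suc 6]))"
  then have "set J \<in> Pow (set [1..<Suc 6])" unfolding subseqs_powset[symmetric] by auto
  then have "set J \<subseteq> {1..6}" by auto
  moreover have "distinct J" using J subseqs_distinctD[OF _ distinct_upt] by auto
  ultimately show "star a (map b J) = a (map b (filter (\<lambda>i. i \<notin> set J) [1, 2, 3, 4, 5, 6])) *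
     vol (map b (filter (\<lambda>i. i \<notin> set J) [1, 2, 3, 4, 5, 6] @ J))"
    using star_on_basis[OF assms(1), of J] J assms(2) by auto
qed

lemma star_eqI:
  assumes a: "alt k a" and c: "alt l c" and "l + k = 6"
    and eq: "list_all (\<lambda>J. a (map b (filter (\<lambda>i. i \<notin> set J) [1, 2, 3, 4, 5, 6])) *
     vol (map b (filter (\<lambda>i. i \<notin> set J) [1, 2, 3, 4, 5, 6] @ J)) = c (map b J))
     (filter (\<lambda>xs. length xs = l) (subseqs [1..<Suc 6]))"
  shows "star a = c"
proof (rule alt_eqI[OF dual _ c, unfolded dim])
  have "6 - k = l" "k \<le> 6" using \<open>l + k = 6\<close> by auto
  then show "alt l (star a)" using alt_star[OF a] by simp
  show "list_all (\<lambda>J. star a (map b J) = c (map b J)) (filter (\<lambda>xs. length xs = l) (subseqs [1..<Suc 6]))"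
    using star_on_basis_all[OF a \<open>l + k = 6\<close>] eq unfolding list_all_iff by metis
qed

lemma star_w: "star w = (1/2) *\<^sub>C wedge w w"
  by (rule star_eqI[OF alt_w alt_scale[OF alt_ww]], simp, unfold subseqs6_4)
    (simp add: frame_simps dim wedge_assoc)

lemma star_ww: "star (wedge w w) = 2 *\<^sub>C w"
  by (rule star_eqI[OF alt_ww alt_scale[OF alt_w]], simp, unfold subseqs6_2)
    (simp add: frame_simps dim wedge_assoc)

lemma star_p: "star p = m"
  by (rule star_eqI[OF alt_p alt_m], simp, unfold subseqs6_3)
    (simp add: frame_simps dim wedge_assoc)

lemma star_m: "star m = - p"
  by (rule star_eqI[OF alt_m alt_minus[OF alt_p]], simp, unfold subseqs6_3)
    (simp add: frame_simps dim wedge_assoc)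

text \<open>In dimension 6 the star squares to the identity on 2-forms, because the degrees 2 and 4
  have even product.\<close>

lemma star_star:
  assumes s: "alt 2 s"
  shows "star (star s) = s"
proof -
  have s4: "alt 4 (star s)"
    using alt_star[OF s] by simp
  have "list_all (\<lambda>J. star s (map b J) = s (map b (filter (\<lambda>i. i \<notin> set J) [1, 2, 3, 4, 5, 6])) *
     vol (map b (filter (\<lambda>i. i \<notin> set J) [1, 2, 3, 4, 5, 6] @ J)))
     (filter (\<lambda>xs. length xs = 4) (subseqs [1..<Suc 6]))"
    using star_on_basis_all[OF s, of 4] by simp
  \<comment> \<open>The star formula, instantiated at all fifteen increasing 4-tuples with the
    volume signs computed, becomes a set of rewrite rules for the inner star.\<close>
  note vals = this[unfolded subseqs6_4, simplified, simplified frame_simps dim, simplified]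
  show ?thesis
    by (rule star_eqI[OF s4 s], simp, unfold subseqs6_2) (simp add: frame_simps dim vals)
qed

text \<open>The Lefschetz map is injective on 1-forms: on five of the six basis vectors the product
  takes the value of \<open>n\<close> at the partner of the missing vector, up to a factor of
  absolute value 2.\<close>

lemma wedge_ww_eq_0:
  assumes n: "alt 1 n" and 0: "wedge n (wedge w w) = 0"
  shows "n = 0"
proof (rule eqI_1)
  have "wedge n (wedge w w) [b i1, b i2, b i3, b i4, b i5] = 0" for i1 i2 i3 i4 i5
    using 0 by simp
  from this[of 1 2 3 4 5] this[of 1 2 3 4 6] this[of 1 2 3 5 6] this[of 1 2 4 5 6] this[of 1 3 4 5 6]
    this[of 2 3 4 5 6]
  show "list_all (\<lambda>xs. n (map b xs) = 0 (map b xs)) [[1], [2], [3], [4], [5], [6]]"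
    by (simp add: frame_simps dim wedge_assoc alt_1_contr[OF n] alt_1_contr_wedge[OF n] alt_1_Nil[OF n])
qed (use n in simp_all)

text \<open>The three summands lie in complementary spaces of 4-forms, of dimensions 1, 6 and 8: the
  condition on \<open>star s\<close> places \<open>s\<close> in the eigenspace of type 8, as the
  star acts with other factors relative to wedging with \<open>w\<close> on multiples of
  \<open>w\<close> and on the 2-forms of type 6.\<close>

lemma type_decomposition:
  assumes s0: "alt 0 s0" and n: "alt 1 n" and s: "alt 2 s"
    and star_s: "star s = - wedge s w"
    and 0: "wedge s0 (wedge w w) + wedge n m - wedge s w = 0"
  shows "s0 = 0" "n = 0" "s = 0"
proof -
  have 1: "s0 [] * wedge w w xs + wedge n m xs - wedge s w xs = 0" for xs
    using fun_cong[OF 0, of xs] wedge_homog_0[of s0 "wedge w w"] s0 by (simp add: cscale_apply)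
  \<comment> \<open>Each of the fifteen 4-tuples contributes two scalar equations, one from the
    condition on \<open>star s\<close> and one from the vanishing combination; together they form a
    linear system.\<close>
  have "list_all (\<lambda>J. s (map b (filter (\<lambda>i. i \<notin> set J) [1, 2, 3, 4, 5, 6])) *
     vol (map b (filter (\<lambda>i. i \<notin> set J) [1, 2, 3, 4, 5, 6] @ J)) = - wedge s w (map b J) \<and>
     s0 [] * wedge w w (map b J) + wedge n m (map b J) - wedge s w (map b J) = 0)
     (filter (\<lambda>xs. length xs = 4) (subseqs [1..<Suc 6]))"
    using star_on_basis_all[OF s, of 4] fun_cong[OF star_s] 1 unfolding list_all_iff by simp
  note eqs = this[unfolded subseqs6_4 list.pred_inject]
  note simps = frame_simps dim wedge_assoc alt_1_contr[OF n] alt_1_contr_wedge[OF n] alt_1_Nil[OF n] alt_2_contr[OF s]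
  have "s0 [] = 0 \<and>
      (n [b 1] = 0 \<and> n [b 2] = 0 \<and> n [b 3] = 0 \<and> n [b 4] = 0 \<and> n [b 5] = 0 \<and> n [b 6] = 0) \<and>
      s [b 1, b 2] = 0"
    using eqs by (simp (no_asm_use) add: simps, elim conjE, intro conjI; linarith)
  then have "list_all (\<lambda>xs. n (map b xs) = 0 (map b xs)) [[1], [2], [3], [4], [5], [6]]" "s0 [] = 0"
    by simp_all
  then show "s0 = 0" "n = 0"
    using eqI_1[OF n alt_zero] homog_0_eq[of s0] s0 by simp_all
  \<comment> \<open>With the other two summands gone \<open>wedge s w\<close> vanishes, hence
    \<open>star s\<close> does, and applying the star once more recovers \<open>s\<close>.\<close>
  then have "star s = 0"
    using 0 star_s by simp
  then show "s = 0"
    using star_star[OF s] by simp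
qed

end

text \<open>Evaluating a linear relation on \<open>b k\<close> isolates its \<open>k\<close>-th
  coefficient, so the covectors are independent. Their dual basis is unique, hence equal to
  \<open>b\<close>, which brings the expansion property with it.\<close>

lemma frameI:
  fixes e :: "nat \<Rightarrow> 'e::euclidean_space list \<Rightarrow> real"
  assumes "\<And>k. k \<in> {1..DIM('e)} \<Longrightarrow> alt 1 (e k)"
    and eb: "\<And>i j. i \<in> {1..DIM('e)} \<Longrightarrow> j \<in> {1..DIM('e)} \<Longrightarrow> e i [b j] = (if i = j then 1 else 0)"
  shows "frame e b"
proof -
  let ?n = "DIM('e)"
  have "c k = 0" if c: "\<And>v. (\<Sum>k = 1..?n. c k * e k [v]) = 0" and k: "k \<in> {1..?n}" for c k
  proof -
    have "(\<Sum>k' = 1..?n. c k' * e k' [b k]) = (\<Sum>k' = 1..?n. if k' = k then c k else 0)"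
      by (rule sum.cong[OF refl]) (use eb k in auto)
    then show ?thesis using c k by simp
  qed
  then have co: "coframe e"
    using assms(1) unfolding coframe_def alternating_map_iff_alt by blast
  then obtain b2 where b2: "dual_basis e b2" by (rule coframe_dual_basis_exists)
  have "b j = b2 j" if "j \<in> {1..?n}" for j
    by (rule dual_basis_unique[OF b2 eb that])
  then have "dual_basis e b"
    using eb dual_basis_expand[OF b2] by (simp add: dual_basis_def)
  with co show ?thesis by unfold_locales
qed

section \<open>Rotating an adapted coframe by a unit complex number\<close>

definition rot_coframe :: "real \<Rightarrow> real \<Rightarrow> (nat \<Rightarrow> 'e list \<Rightarrow> real) \<Rightarrow> nat \<Rightarrow> 'e list \<Rightarrow> real" where
  "rot_coframe \<alpha> \<beta> e k = (if k = 1 then \<alpha> *\<^sub>C e 1 - \<beta> *\<^sub>C e 2 else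
     if k = 2 then \<beta> *\<^sub>C e 1 + \<alpha> *\<^sub>C e 2 else e k)"

text \<open>Multiplying \<open>e\<^sup>1 + i e\<^sup>2\<close> by \<open>\<alpha> + i \<beta>\<close> multiplies \<open>\<psi>\<^sub>+ + i \<psi>\<^sub>-\<close> by the same number and fixes
  \<open>\<omega>\<close> and the metric.\<close>

lemma (in frame6) rot_coframe:
  assumes ab: "\<alpha>\<^sup>2 + \<beta>\<^sup>2 = 1"
  shows "frame6 (rot_coframe \<alpha> \<beta> e)
      (\<lambda>k. if k = 1 then \<alpha> *\<^sub>R b 1 - \<beta> *\<^sub>R b 2 else if k = 2 then \<beta> *\<^sub>R b 1 + \<alpha> *\<^sub>R b 2 else b k)"
    and "coframe_metric (rot_coframe \<alpha> \<beta> e) = coframe_metric e"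
    and "su3_adapted w (\<alpha> *\<^sub>C p - \<beta> *\<^sub>C m) (\<beta> *\<^sub>C p + \<alpha> *\<^sub>C m) (rot_coframe \<alpha> \<beta> e)"
proof -
  have ab': "\<alpha> * \<alpha> + \<beta> * \<beta> = 1" using ab by (simp add: power2_eq_square)
  have "frame (rot_coframe \<alpha> \<beta> e)
      (\<lambda>k. if k = 1 then \<alpha> *\<^sub>R b 1 - \<beta> *\<^sub>R b 2 else if k = 2 then \<beta> *\<^sub>R b 1 + \<alpha> *\<^sub>R b 2 else b k)"
  proof (rule frameI)
    fix k assume "k \<in> {1..DIM('e)}"
    then show "alt 1 (rot_coframe \<alpha> \<beta> e k)"
      by (auto simp: rot_coframe_def dim intro!: alt_diff alt_add alt_scale e_alt)
  next
    have lin: "linear (\<lambda>v. e i [v])" if "i \<in> {1..6}" for i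
      using coframe_linear[OF cofr] that by (simp add: dim)
    have 1: "e i [x *\<^sub>R b j + y *\<^sub>R b k] = x * e i [b j] + y * e i [b k]"
      "e i [x *\<^sub>R b j - y *\<^sub>R b k] = x * e i [b j] - y * e i [b k]" if "i \<in> {1..6}" for i j k x y
      using linear_add[OF lin] linear_diff[OF lin] linear_cmul[OF lin] that by simp_all
    fix i j assume ij: "i \<in> {1..DIM('e)}" "j \<in> {1..DIM('e)}"
    then show "rot_coframe \<alpha> \<beta> e i [if j = 1 then \<alpha> *\<^sub>R b 1 - \<beta> *\<^sub>R b 2
        else if j = 2 then \<beta> *\<^sub>R b 1 + \<alpha> *\<^sub>R b 2 else b j] = (if i = j then 1 else 0)"
      using ab' by (auto simp: rot_coframe_def cscale_apply dim 1 e_b algebra_simps)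
  qed
  then show "frame6 (rot_coframe \<alpha> \<beta> e)
      (\<lambda>k. if k = 1 then \<alpha> *\<^sub>R b 1 - \<beta> *\<^sub>R b 2 else if k = 2 then \<beta> *\<^sub>R b 1 + \<alpha> *\<^sub>R b 2 else b k)"
    using dim by (simp add: frame6_def frame6_axioms_def)
  show "coframe_metric (rot_coframe \<alpha> \<beta> e) = coframe_metric e"
  proof (intro ext)
    fix u v
    have "coframe_metric (rot_coframe \<alpha> \<beta> e) u v =
        (\<alpha> * \<alpha> + \<beta> * \<beta>) * (e 1 [u] * e 1 [v] + e 2 [u] * e 2 [v]) +
        (e 3 [u] * e 3 [v] + e 4 [u] * e 4 [v] + e 5 [u] * e 5 [v] + e 6 [u] * e 6 [v])"
      unfolding coframe_metric_def dim ivl6 rot_coframe_def by (simp add: cscale_apply algebra_simps)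
    then show "coframe_metric (rot_coframe \<alpha> \<beta> e) u v = coframe_metric e u v"
      unfolding ab' by (simp add: coframe_metric_def dim ivl6)
  qed
  have sq: "wedge (e 1) (e 1) = 0" "wedge (e 2) (e 2) = 0" "wedge (e 2) (e 1) = - wedge (e 1) (e 2)"
    using e_commute[of 1 1] e_commute[of 2 2] e_commute[of 2 1]
    by (auto simp: dim fun_eq_iff)
  have w: "coframe_monom (rot_coframe \<alpha> \<beta> e) [1, 2] = coframe_monom e [1, 2]"
  proof (rule ext)
    fix vs
    have "coframe_monom (rot_coframe \<alpha> \<beta> e) [1, 2] vs = (\<alpha> * \<alpha> + \<beta> * \<beta>) * coframe_monom e [1, 2] vs"
      by (simp add: coframe_monom_expand rot_coframe_def wedge_linear sq cscale_apply algebra_simps)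
    then show "coframe_monom (rot_coframe \<alpha> \<beta> e) [1, 2] vs = coframe_monom e [1, 2] vs"
      unfolding ab' by simp
  qed
  show "su3_adapted w (\<alpha> *\<^sub>C p - \<beta> *\<^sub>C m) (\<beta> *\<^sub>C p + \<alpha> *\<^sub>C m) (rot_coframe \<alpha> \<beta> e)"
    unfolding su3_adapted_def w
    by (intro conjI ext; simp add: coframe_monom_expand rot_coframe_def wedge_linear cscale_apply algebra_simps)
qed


section \<open>Products with a line\<close>

definition lift :: "('e list \<Rightarrow> real) \<Rightarrow> ('e \<times> 'f) list \<Rightarrow> real" where
  "lift a = (\<lambda>vs. a (map fst vs))"

definition ds :: "('e \<times> real) list \<Rightarrow> real" where
  "ds = (\<lambda>vs. if length vs = 1 then snd (hd vs) else 0)"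

lemma lift_add: "lift (a + b) = lift a + lift b"
  and lift_diff: "lift (a - b) = lift a - lift b"
  and lift_minus: "lift (- a) = - lift a"
  and lift_scale: "lift (c *\<^sub>C a) = c *\<^sub>C lift a"
  and lift_zero [simp]: "lift 0 = 0"
  and lift_one_cov: "lift one_cov = one_cov"
  by (auto simp: lift_def cscale_def one_cov_def)

lemma lift_wedge: "lift (wedge a b) = wedge (lift a) (lift b)"
  by (rule ext) (simp add: lift_def wedge_map)

lemma contr_lift: "contr v (lift a) = lift (contr (fst v) a)"
  by (simp add: contr_def lift_def)

lemma twist_lift: "twist (lift a) = lift (twist a)"
  by (simp add: twist_def lift_def)

lemma homog_lift: "homog k a \<Longrightarrow> homog k (lift a)"
  by (simp add: homog_def lift_def)

lemma alt_lift: "alt k a \<Longrightarrow> alt k (lift a :: ('e::real_vector \<times> 'f::real_vector) list \<Rightarrow> real)"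
proof (induction k arbitrary: a)
  case 0
  then show ?case by (simp add: homog_lift)
next
  case (Suc k)
  have "linear (\<lambda>v :: 'e \<times> 'f. lift a (v # vs))" for vs
    using linear_compose[OF linear_fst alt_linear[OF Suc.prems]] by (simp add: lift_def o_def)
  with Suc show ?case
    by (simp add: alt.simps contr_lift homog_lift)
qed

lemma alt_ds: "alt 1 (ds :: ('e::real_vector \<times> real) list \<Rightarrow> real)"
proof -
  have "linear (\<lambda>v :: 'e \<times> real. ds (v # vs))" for vs
    using linear_snd by (cases vs) (auto simp: ds_def linear_zero_cov)
  then show ?thesis
    by (auto simp: One_nat_def alt.simps homog_def contr_def ds_def)
qed

text \<open>If \<open>e\<close> is orthonormal for g, this coframe is orthonormal for g +
  \<open>c\<^sup>2\<close> \<open>ds\<^sup>2\<close>; its seventh dual vector is accordingly the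
  line direction divided by \<open>c\<close>.\<close>

definition prod_coframe :: "real \<Rightarrow> (nat \<Rightarrow> 'e list \<Rightarrow> real) \<Rightarrow> nat \<Rightarrow> ('e \<times> real) list \<Rightarrow> real" where
  "prod_coframe c e k = (if k = 7 then c *\<^sub>C ds else lift (e k))"

definition prod_basis :: "real \<Rightarrow> (nat \<Rightarrow> 'e::zero) \<Rightarrow> nat \<Rightarrow> 'e \<times> real" where
  "prod_basis c b k = (if k = 7 then (0, 1 / c) else (b k, 0))"

lemma coframe_monom_prod:
  "7 \<notin> set xs \<Longrightarrow> coframe_monom (prod_coframe c e) xs = lift (coframe_monom e xs)"
  by (induction xs) (simp_all add: coframe_monom_expand lift_one_cov lift_wedge prod_coframe_def)

lemma coframe_monom_prod_7:
  "7 \<notin> set xs \<Longrightarrow> coframe_monom (prod_coframe c e) (xs @ [7]) = c *\<^sub>C wedge (lift (coframe_monom e xs)) ds"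
  by (simp add: coframe_monom_append coframe_monom_prod coframe_monom_expand)
    (simp add: prod_coframe_def wedge_scale_right)

lemma (in frame6) prod_frame:
  assumes "c \<noteq> 0"
  shows "frame7 (prod_coframe c e) (prod_basis c b)"
proof -
  have dim7: "DIM('e \<times> real) = 7" by (simp add: dim)
  have "frame (prod_coframe c e) (prod_basis c b)"
  proof (rule frameI)
    fix k assume "k \<in> {1..DIM('e \<times> real)}"
    then show "alt 1 (prod_coframe c e k)"
      unfolding dim7 by (auto simp: prod_coframe_def dim intro!: alt_scale alt_ds alt_lift e_alt)
  next
    fix i j assume ij: "i \<in> {1..DIM('e \<times> real)}" "j \<in> {1..DIM('e \<times> real)}"
    have 0: "e i [0] = 0" if "i \<noteq> 7"
      using linear_0[OF coframe_linear[OF cofr, of i]] that ij unfolding dim7 by (simp add: dim)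
    show "prod_coframe c e i [prod_basis c b j] = (if i = j then 1 else 0)"
      using ij assms 0 unfolding dim7
      by (auto simp: prod_coframe_def prod_basis_def cscale_apply ds_def lift_def e_b dim)
  qed
  then show ?thesis using dim7 by (simp add: frame7_def frame7_axioms_def)
qed

lemma (in frame6) prod_g2_adapted:
  "g2_adapted (c *\<^sub>C wedge (lift w) ds + lift p) (prod_coframe c e)"
  using coframe_monom_prod_7[of "[1,2]" c e] coframe_monom_prod_7[of "[3,4]" c e] coframe_monom_prod_7[of "[5,6]" c e]
  unfolding g2_adapted_def
  by (simp add: coframe_monom_prod lift_add lift_diff wedge_add_left cscale_add)

lemma (in frame6) coframe_metric_prod: "coframe_metric (prod_coframe 1 e) (u, 0) (v, 0) = coframe_metric e u v"
proof -
  have dim7: "DIM('e \<times> real) = 7" by (simp add: dim)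
  show ?thesis
    unfolding coframe_metric_def dim7 dim ivl6 ivl7
    by (simp add: prod_coframe_def lift_def ds_def)
qed

text \<open>With \<open>c = 1\<close> both coframes extend to coframes of the product that are
  adapted to one and the same G2 form. Uniqueness of its metric, restricted to the first factor,
  gives the claim.\<close>

lemma su3_adapted_unique:
  fixes e e' :: "nat \<Rightarrow> 'e::euclidean_space list \<Rightarrow> real"
  assumes dim: "DIM('e) = 6" and e: "coframe e" "su3_adapted w p m e" and e': "coframe e'" "su3_adapted w p m e'"
  shows "coframe_metric e = coframe_metric e'"
proof (intro ext)
  fix u v
  obtain b where b: "dual_basis e b" using coframe_dual_basis_exists[OF e(1)] .
  obtain b' where b': "dual_basis e' b'" using coframe_dual_basis_exists[OF e'(1)] .
  interpret f: frame6 e b by unfold_locales (fact e b dim)+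
  interpret f': frame6 e' b' by unfold_locales (fact e' b' dim)+
  interpret g: frame7 "prod_coframe 1 e" "prod_basis 1 b" by (rule f.prod_frame) simp
  interpret g': frame7 "prod_coframe 1 e'" "prod_basis 1 b'" by (rule f'.prod_frame) simp
  have "coframe_metric (prod_coframe 1 e) = coframe_metric (prod_coframe 1 e')"
    using g2_adapted_unique(1)[OF g.dim g.cofr _ g'.cofr] f.prod_g2_adapted[of 1] f'.prod_g2_adapted[of 1] e(2) e'(2)
    by (metis su3_adapted_def)
  then show "coframe_metric e u v = coframe_metric e' u v"
    using f.coframe_metric_prod f'.coframe_metric_prod by metis
qed

section \<open>The Hodge star of a product with a line\<close>

lemma wedge_sum_left: "wedge (\<lambda>vs. \<Sum>i\<in>S. A i vs) b vs = (\<Sum>i\<in>S. wedge (A i) b vs)"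
  by (simp add: wedge_def sum_distrib_left sum_distrib_right) (rule sum.swap)

lemma alt_zero_vector: "alt k a \<Longrightarrow> 0 \<in> set vs \<Longrightarrow> a vs = 0"
proof (induction vs arbitrary: k a)
  case (Cons v vs)
  show ?case
  proof (cases "v = 0")
    case True
    then show ?thesis using linear_0[OF alt_linear[OF Cons.prems(1)]] by simp
  next
    case False
    then show ?thesis using Cons.IH[OF alt_contr[OF Cons.prems(1)], of v] Cons.prems by (simp add: contr_def)
  qed
qed simp

lemma hodge_cscale: "hodge g vol (c *\<^sub>C a) = c *\<^sub>C hodge g vol a"
  by (rule ext) (simp add: hodge_def cscale_apply sum_distrib_left mult.assoc Let_def)

lemma hodge_add: "hodge g vol (a + b) = hodge g vol a + hodge g vol b"
  by (rule ext) (simp add: hodge_def sum.distrib distrib_right Let_def)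

lemma hodge_minus: "hodge g vol (- a) = - hodge g vol a"
  by (metis hodge_cscale cscale_minus_one)

context frame6
begin

context
  fixes c :: real
  assumes c: "c \<noteq> 0"
begin

interpretation P: frame7 "prod_coframe c e" "prod_basis c b"
  by (rule prod_frame[OF c])

abbreviation "star7 \<equiv> hodge (coframe_metric (prod_coframe c e)) (coframe_monom (prod_coframe c e) [1,2,3,4,5,6,7])"

lemma vol_prod: "coframe_monom (prod_coframe c e) [1,2,3,4,5,6,7] = wedge (lift vol) (c *\<^sub>C ds)"
  using coframe_monom_prod_7[of "[1,2,3,4,5,6]" c e] by (simp add: wedge_scale_right)

text \<open>\<open>ds\<close> vanishes on vectors tangent to the first factor, so contraction with
  them acts on the lifted factor alone.\<close>

lemma wedge_lift_on_basis:
  assumes "set xs \<subseteq> {1..6}"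
  shows "wedge (lift a) (c *\<^sub>C ds) (map (prod_basis c b) xs @ vs) =
    wedge (lift (contr_list (map b xs) a)) (c *\<^sub>C ds) vs"
  using assms
proof (induction xs arbitrary: a)
  case (Cons x xs)
  then have B: "prod_basis c b x = (b x, 0)" by (auto simp: prod_basis_def)
  have "contr (b x, 0 :: real) ds = 0"
    using alt_1_contr[OF alt_ds, of "(b x, 0)"] by (simp add: ds_def)
  then have "contr (b x, 0) (wedge (lift a) (c *\<^sub>C ds)) = wedge (lift (contr (b x) a)) (c *\<^sub>C ds)"
    by (simp add: contr_wedge contr_lift contr_scale)
  then show ?case using Cons by (simp add: B contr_apply[of _ "(b x, 0)"] contr_list_Cons)
qed simp

lemma lift_on_basis: "set xs \<subseteq> {1..6} \<Longrightarrow> lift a (map (prod_basis c b) xs) = a (map b xs)"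
proof -
  assume "set xs \<subseteq> {1..6}"
  then have "map (fst \<circ> prod_basis c b) xs = map b xs" by (auto simp: prod_basis_def)
  then show ?thesis by (simp only: lift_def map_map)
qed

lemma finite_subsets [simp]: "finite {I. I \<subseteq> {1..n::nat} \<and> card I = k}"
  by (rule finite_subset[of _ "Pow {1..n}"]) auto

text \<open>Index sets containing 7 contribute nothing, since a lifted form sees only first
  components and that of \<open>?B 7\<close> is 0. On the remaining sets the contractions act on
  \<open>vol\<close> and leave \<open>ds\<close> as last factor.\<close>

lemma star7_lift:
  assumes a: "alt k a" and k: "k \<le> 6"
  shows "star7 (lift a) = wedge (lift (star a)) (c *\<^sub>C ds)"
proof
  fix vs :: "('e \<times> real) list"
  let ?sl = "sorted_list_of_set :: nat set \<Rightarrow> nat list" and ?B = "prod_basis c b"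
  define S where "S = {I. I \<subseteq> {1..6::nat} \<and> card I = k}"
  define V where "V I = contr_list (map b (?sl I)) vol" for I
  define A :: "nat set \<Rightarrow> ('e \<times> real) list \<Rightarrow> real" where "A I = a (map b (?sl I)) *\<^sub>C lift (V I)" for I
  have sl: "set (?sl I) \<subseteq> {1..6}" if "I \<in> S" for I
    using that finite_subset[of I "{1..6}"] by (auto simp: S_def)
  have "star7 (lift a) vs = (\<Sum>I | I \<subseteq> {1..7} \<and> card I = k. lift a (map ?B (?sl I)) *
      wedge (lift vol) (c *\<^sub>C ds) (map ?B (?sl I) @ vs))"
    using k by (subst hodge_eq[OF P.cofr P.dual alt_lift[OF a], unfolded P.dim, OF P.alt_vol])
      (simp_all add: vol_prod)
  also have "\<dots> = (\<Sum>I\<in>S. lift a (map ?B (?sl I)) * wedge (lift vol) (c *\<^sub>C ds) (map ?B (?sl I) @ vs))"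
  proof (rule sum.mono_neutral_right)
    show "S \<subseteq> {I. I \<subseteq> {1..7} \<and> card I = k}" by (auto simp: S_def)
    show "\<forall>I\<in>{I. I \<subseteq> {1..7} \<and> card I = k} - S.
        lift a (map ?B (?sl I)) * wedge (lift vol) (c *\<^sub>C ds) (map ?B (?sl I) @ vs) = 0"
    proof
      fix I assume I: "I \<in> {I. I \<subseteq> {1..7} \<and> card I = k} - S"
      have "7 \<in> I"
      proof (rule ccontr)
        assume "7 \<notin> I"
        with I have "I \<subseteq> {1..7} - {7}" by auto
        also have "\<dots> \<subseteq> {1..6::nat}" by auto
        finally show False using I by (auto simp: S_def)
      qed
      then have "0 \<in> set (map fst (map ?B (?sl I)))"
        using I finite_subset[of I "{1..7}"] by (force simp: prod_basis_def)
      then show "lift a (map ?B (?sl I)) * wedge (lift vol) (c *\<^sub>C ds) (map ?B (?sl I) @ vs) = 0"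
        using alt_zero_vector[OF a] by (simp add: lift_def)
    qed
  qed simp
  also have "\<dots> = (\<Sum>I\<in>S. a (map b (?sl I)) * wedge (lift (V I)) (c *\<^sub>C ds) vs)"
    by (rule sum.cong[OF refl]) (simp add: wedge_lift_on_basis[OF sl] lift_on_basis[OF sl] V_def)
  also have "\<dots> = (\<Sum>I\<in>S. wedge (A I) (c *\<^sub>C ds) vs)"
    by (simp add: A_def wedge_scale_left cscale_apply)
  also have "\<dots> = wedge (\<lambda>vs. \<Sum>I\<in>S. A I vs) (c *\<^sub>C ds) vs"
    by (simp only: wedge_sum_left)
  also have "(\<lambda>vs. \<Sum>I\<in>S. A I vs) = lift (star a)"
    by (rule ext) (simp add: A_def hodge_eq[OF cofr dual a, unfolded dim, OF alt_vol k] lift_def cscale_apply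
        V_def contr_list_def S_def)
  finally show "star7 (lift a) vs = wedge (lift (star a)) (c *\<^sub>C ds) vs" .
qed

text \<open>Here only index sets containing 7 contribute, since without \<open>?B 7\<close> the
  factor \<open>ds\<close> is evaluated to 0.\<close>

lemma star7_lift_ds:
  assumes a: "alt k a" and k: "k \<le> 6"
  shows "star7 (wedge (lift a) (c *\<^sub>C ds)) = (-1) ^ (6 - k) *\<^sub>C lift (star a)"
proof
  fix vs :: "('e \<times> real) list"
  let ?sl = "sorted_list_of_set :: nat set \<Rightarrow> nat list" and ?B = "prod_basis c b"
  define S where "S = {I. I \<subseteq> {1..6::nat} \<and> card I = k}"
  define V where "V I = contr_list (map b (?sl I)) vol" for I
  have slS: "set (?sl I) \<subseteq> {1..6}" "length (?sl I) = k" if "I \<in> S" for I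
    using that finite_subset[of I "{1..6}"] by (auto simp: S_def)
  have cds: "contr (?B 7) (c *\<^sub>C ds :: ('e \<times> real) list \<Rightarrow> real) = one_cov"
    using c alt_1_contr[OF alt_scale[OF alt_ds], of "(0 :: 'e, 1 / c)" c]
    by (simp add: prod_basis_def cscale_apply ds_def)
  have cds0: "(c *\<^sub>C ds) [] = 0" by (simp add: ds_def cscale_def)
  have alt: "alt (Suc k) (wedge (lift a :: ('e \<times> real) list \<Rightarrow> real) (c *\<^sub>C ds))"
    using alt_wedge[OF alt_lift[OF a] alt_scale[OF alt_ds, of c]] unfolding Suc_eq_plus1 .
  have "star7 (wedge (lift a) (c *\<^sub>C ds)) vs = (\<Sum>I | I \<subseteq> {1..7} \<and> card I = Suc k.
      wedge (lift a) (c *\<^sub>C ds) (map ?B (?sl I)) * wedge (lift vol) (c *\<^sub>C ds) (map ?B (?sl I) @ vs))"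
    using k by (subst hodge_eq[OF P.cofr P.dual alt, unfolded P.dim, OF P.alt_vol])
      (simp_all add: vol_prod)
  also have "\<dots> = (\<Sum>I\<in>insert 7 ` S.
      wedge (lift a) (c *\<^sub>C ds) (map ?B (?sl I)) * wedge (lift vol) (c *\<^sub>C ds) (map ?B (?sl I) @ vs))"
  proof (rule sum.mono_neutral_right)
    show "insert 7 ` S \<subseteq> {I. I \<subseteq> {1..7} \<and> card I = Suc k}"
    proof
      fix I assume "I \<in> insert 7 ` S"
      then obtain J where "I = insert 7 J" "J \<subseteq> {1..6}" "card J = k" by (auto simp: S_def)
      moreover from this have "7 \<notin> J" "finite J" using finite_subset[of J "{1..6}"] by auto
      ultimately show "I \<in> {I. I \<subseteq> {1..7} \<and> card I = Suc k}" by auto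
    qed
    show "\<forall>I\<in>{I. I \<subseteq> {1..7} \<and> card I = Suc k} - insert 7 ` S.
        wedge (lift a) (c *\<^sub>C ds) (map ?B (?sl I)) * wedge (lift vol) (c *\<^sub>C ds) (map ?B (?sl I) @ vs) = 0"
    proof
      fix I assume I: "I \<in> {I. I \<subseteq> {1..7} \<and> card I = Suc k} - insert 7 ` S"
      have fin: "finite I" using I finite_subset[of I "{1..7}"] by auto
      have "7 \<notin> I"
      proof
        assume 7: "7 \<in> I"
        have "I - {7} \<subseteq> {1..7} - {7}" using I by auto
        also have "\<dots> \<subseteq> {1..6::nat}" by auto
        finally have "I - {7} \<in> S" using I 7 fin by (simp add: S_def)
        then have "insert 7 (I - {7}) \<in> insert 7 ` S" by blast
        then show False using I 7 by (simp add: insert_absorb)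
      qed
      with I have "I \<subseteq> {1..7} - {7}" by auto
      also have "\<dots> \<subseteq> {1..6::nat}" by auto
      finally have "set (?sl I) \<subseteq> {1..6}" using fin by simp
      from wedge_lift_on_basis[OF this, of a "[]"]
      have "wedge (lift a) (c *\<^sub>C ds) (map ?B (?sl I)) = 0" by (simp add: cds0)
      then show "wedge (lift a) (c *\<^sub>C ds) (map ?B (?sl I)) * wedge (lift vol) (c *\<^sub>C ds) (map ?B (?sl I) @ vs) = 0"
        by simp
    qed
  qed simp
  also have "\<dots> = (\<Sum>I\<in>S. wedge (lift a) (c *\<^sub>C ds) (map ?B (?sl (insert 7 I))) *
      wedge (lift vol) (c *\<^sub>C ds) (map ?B (?sl (insert 7 I)) @ vs))"
  proof (subst sum.reindex)
    have "7 \<notin> I" if "I \<in> S" for I using that by (auto simp: S_def)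
    then show "inj_on (insert 7) S" unfolding inj_on_def using insert_ident by metis
  qed simp
  also have "\<dots> = (\<Sum>I\<in>S. a (map b (?sl I)) * ((-1) ^ (6 - k) * lift (V I) vs))"
  proof (rule sum.cong[OF refl])
    fix I assume I: "I \<in> S"
    then have fin: "finite I" and I6: "I \<subseteq> {1..6}" using finite_subset[of I "{1..6}"] by (auto simp: S_def)
    have "?sl (insert 7 I) = ?sl I @ [7]"
    proof -
      have "sorted (?sl I @ [7])" "distinct (?sl I @ [7])" "set (?sl I @ [7]) = insert 7 I"
        using fin I6 by (auto simp: sorted_append)
      then show ?thesis by (metis sorted_list_of_set.idem_if_sorted_distinct)
    qed
    moreover have "wedge (lift a) (c *\<^sub>C ds) (map ?B (?sl I) @ [?B 7]) = a (map b (?sl I))"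
    proof -
      have "contr (?B 7) (lift (contr_list (map b (?sl I)) a)) [] = 0"
        by (rule trans[OF _ alt_zero_vector[OF a, of "map b (?sl I) @ [0]"]])
          (simp_all add: contr_lift prod_basis_def, simp add: lift_def contr_def contr_list_def)
      then show ?thesis
        by (simp add: wedge_lift_on_basis[OF slS(1)[OF I]] wedge_Cons cds cds0)
          (simp add: twist_def lift_def contr_list_def)
    qed
    \<comment> \<open>The contraction with \<open>?B 7\<close> has to pass the factor
      \<open>V I\<close> of degree \<open>6 - k\<close> before it meets \<open>ds\<close>; this is
      where the sign arises.\<close>
    moreover have "wedge (lift vol) (c *\<^sub>C ds) (map ?B (?sl I) @ ?B 7 # vs) = (-1) ^ (6 - k) * lift (V I) vs"
    proof -
      have V: "alt (6 - k) (V I)"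
        using alt_contr_list[OF alt_vol, of "map b (?sl I)"] slS(2)[OF I] by (simp add: V_def)
      have "contr (fst (?B 7)) (V I) = 0"
        using alt_zero_vector[OF V] by (auto simp: contr_def prod_basis_def)
      then have "contr (?B 7) (lift (V I)) = 0"
        by (simp add: contr_lift)
      then show ?thesis
        using homog_twist[OF alt_homog[OF V]]
        by (simp add: wedge_lift_on_basis[OF slS(1)[OF I]] wedge_Cons cds twist_lift cscale_apply
            lift_scale flip: V_def)
    qed
    ultimately show "wedge (lift a) (c *\<^sub>C ds) (map ?B (?sl (insert 7 I))) *
        wedge (lift vol) (c *\<^sub>C ds) (map ?B (?sl (insert 7 I)) @ vs) =
        a (map b (?sl I)) * ((-1) ^ (6 - k) * lift (V I) vs)" by simp
  qed
  also have "\<dots> = ((-1) ^ (6 - k) *\<^sub>C lift (star a)) vs"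
    by (simp add: hodge_eq[OF cofr dual a, unfolded dim, OF alt_vol k] lift_def cscale_apply
        V_def contr_list_def S_def sum_distrib_left mult.left_commute)
  finally show "star7 (wedge (lift a) (c *\<^sub>C ds)) vs = ((-1) ^ (6 - k) *\<^sub>C lift (star a)) vs" .
qed

end

end

section \<open>The exterior derivative in a chart\<close>

definition dird :: "'e \<Rightarrow> ('e::real_normed_vector \<Rightarrow> 'e list \<Rightarrow> real) \<Rightarrow> 'e \<Rightarrow> 'e list \<Rightarrow> real" where
  "dird v F x = (\<lambda>us. frechet_derivative (\<lambda>y. F y us) (at x) v)"

text \<open>The chart formula of \<open>ext_d\<close> freed from the case distinction on the chart
  image, so that it can be expanded argument by argument.\<close>

definition dext :: "('e::real_normed_vector \<Rightarrow> 'e list \<Rightarrow> real) \<Rightarrow> 'e \<Rightarrow> 'e list \<Rightarrow> real" where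
  "dext F x = (\<lambda>vs. \<Sum>j<length vs. (-1) ^ j * dird (vs ! j) F x (take j vs @ drop (Suc j) vs))"

text \<open>Differentiability of all components at one point. The product rules consume nothing
  more, and this is the regularity established for the Hodge star of a form.\<close>

definition cov_diff :: "('e::real_normed_vector \<Rightarrow> 'e list \<Rightarrow> real) \<Rightarrow> 'e \<Rightarrow> bool" where
  "cov_diff F x \<longleftrightarrow> (\<forall>us. (\<lambda>y. F y us) differentiable (at x))"

lemma cov_diff_has_derivative:
  "cov_diff F x \<Longrightarrow> ((\<lambda>y. F y us) has_derivative (\<lambda>v. dird v F x us)) (at x)"
  unfolding cov_diff_def dird_def using frechet_derivative_works by blast

lemma dird_eqI: "((\<lambda>y. F y us) has_derivative f') (at x) \<Longrightarrow> dird v F x us = f' v"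
  unfolding dird_def using frechet_derivative_at by metis

lemma cov_diff_add: "cov_diff F x \<Longrightarrow> cov_diff G x \<Longrightarrow> cov_diff (\<lambda>y. F y + G y) x"
  by (simp add: cov_diff_def)

lemma cov_diff_scale: "cov_diff F x \<Longrightarrow> cov_diff (\<lambda>y. c *\<^sub>C F y) x"
  by (simp add: cov_diff_def cscale_def)

lemma cov_diff_minus: "cov_diff F x \<Longrightarrow> cov_diff (\<lambda>y. - F y) x"
  by (simp add: cov_diff_def)

lemma cov_diff_diff: "cov_diff F x \<Longrightarrow> cov_diff G x \<Longrightarrow> cov_diff (\<lambda>y. F y - G y) x"
  by (simp add: cov_diff_def)

lemma cov_diff_const: "cov_diff (\<lambda>y. a) x"
  by (simp add: cov_diff_def)

lemma cov_diff_contr: "cov_diff F x \<Longrightarrow> cov_diff (\<lambda>y. contr v (F y)) x"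
  by (simp add: cov_diff_def contr_def)

lemma cov_diff_twist: "cov_diff F x \<Longrightarrow> cov_diff (\<lambda>y. twist (F y)) x"
  by (simp add: cov_diff_def twist_def)

lemma dird_add: "cov_diff F x \<Longrightarrow> cov_diff G x \<Longrightarrow> dird v (\<lambda>y. F y + G y) x = dird v F x + dird v G x"
  by (rule ext, rule trans[OF dird_eqI]) (auto intro!: derivative_eq_intros cov_diff_has_derivative)

lemma dird_scale: "cov_diff F x \<Longrightarrow> dird v (\<lambda>y. c *\<^sub>C F y) x = c *\<^sub>C dird v F x"
  unfolding cscale_def
  by (rule ext, rule trans[OF dird_eqI]) (auto intro!: derivative_eq_intros cov_diff_has_derivative)

lemma dird_twist: "cov_diff F x \<Longrightarrow> dird v (\<lambda>y. twist (F y)) x = twist (dird v F x)"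
  unfolding twist_def
  by (rule ext, rule trans[OF dird_eqI]) (auto intro!: derivative_eq_intros cov_diff_has_derivative)

lemma dird_const: "dird v (\<lambda>y. a) x = 0"
  by (rule ext) (simp add: dird_def)

lemma wedge_has_derivative:
  assumes "cov_diff F x" "cov_diff G x"
  shows "((\<lambda>y. wedge (F y) (G y) us) has_derivative
    (\<lambda>v. wedge (dird v F x) (G x) us + wedge (F x) (dird v G x) us)) (at x)"
  unfolding wedge_def sum.distrib[symmetric]
proof (rule has_derivative_sum)
  fix S
  show "((\<lambda>y. (- 1) ^ card {(i, j). i \<in> S \<and> j \<in> {..<length us} - S \<and> j < i} *
            F y (nths us S) * G y (nths us ({..<length us} - S))) has_derivative
      (\<lambda>v. (- 1) ^ card {(i, j). i \<in> S \<and> j \<in> {..<length us} - S \<and> j < i} *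
            dird v F x (nths us S) * G x (nths us ({..<length us} - S)) +
            (- 1) ^ card {(i, j). i \<in> S \<and> j \<in> {..<length us} - S \<and> j < i} *
            F x (nths us S) * dird v G x (nths us ({..<length us} - S)))) (at x)"
    by (rule derivative_eq_intros refl cov_diff_has_derivative assms)+ (simp add: algebra_simps)
qed

lemma cov_diff_wedge: "cov_diff F x \<Longrightarrow> cov_diff G x \<Longrightarrow> cov_diff (\<lambda>y. wedge (F y) (G y)) x"
  using wedge_has_derivative unfolding cov_diff_def differentiable_def by blast

lemma dird_wedge:
  "cov_diff F x \<Longrightarrow> cov_diff G x \<Longrightarrow>
    dird v (\<lambda>y. wedge (F y) (G y)) x = wedge (dird v F x) (G x) + wedge (F x) (dird v G x)"
  by (rule ext, rule trans[OF dird_eqI[OF wedge_has_derivative]]) auto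

lemma dext_Nil [simp]: "dext F x [] = 0"
  by (simp add: dext_def)

text \<open>Cartan's formula for a constant vector field. It does for the exterior derivative what
  the antiderivation rule does for the wedge product.\<close>

lemma dext_Cons: "dext F x (v # vs) = dird v F x vs - dext (\<lambda>y. contr v (F y)) x vs"
  unfolding dext_def
  by (simp add: sum.lessThan_Suc_shift sum_negf[symmetric] del: sum.lessThan_Suc) (simp add: dird_def contr_def)

lemma dext_add:
  assumes "cov_diff F x" "cov_diff G x"
  shows "dext (\<lambda>y. F y + G y) x = dext F x + dext G x"
  by (rule ext) (simp add: dext_def dird_add[OF assms] sum.distrib algebra_simps)

lemma dext_scale:
  assumes "cov_diff F x"
  shows "dext (\<lambda>y. c *\<^sub>C F y) x = c *\<^sub>C dext F x"
  by (rule ext) (simp add: dext_def dird_scale[OF assms] cscale_apply sum_distrib_left mult.left_commute)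

lemma dext_minus:
  assumes "cov_diff F x"
  shows "dext (\<lambda>y. - F y) x = - dext F x"
  using dext_scale[OF assms, of "- 1"] by (simp add: cscale_minus_one)

lemma dext_diff:
  assumes "cov_diff F x" "cov_diff G x"
  shows "dext (\<lambda>y. F y - G y) x = dext F x - dext G x"
  using dext_add[OF assms(1) cov_diff_minus[OF assms(2)]] dext_minus[OF assms(2)] by simp

lemma dext_const [simp]: "dext (\<lambda>y. a) x = 0"
  by (rule ext) (simp add: dext_def dird_const)

lemma dext_twist:
  assumes "cov_diff F x"
  shows "dext (\<lambda>y. twist (F y)) x = - twist (dext F x)"
proof
  fix vs
  show "dext (\<lambda>y. twist (F y)) x vs = (- twist (dext F x)) vs"
    using assms
  proof (induction vs arbitrary: F)
    case (Cons v vs)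
    have "dext (\<lambda>y. twist (F y)) x (v # vs) = twist (dird v F x) vs + dext (\<lambda>y. twist (contr v (F y))) x vs"
      using dext_minus[OF cov_diff_twist[OF cov_diff_contr[OF Cons.prems, of v]]]
      by (simp add: dext_Cons dird_twist[OF Cons.prems] contr_twist)
    then show ?case
      using Cons.IH[OF cov_diff_contr[OF Cons.prems]] by (simp add: twist_def dext_Cons algebra_simps)
  qed (simp add: twist_def)
qed

lemma contr_dext: "contr v (dext F x) = dird v F x - dext (\<lambda>y. contr v (F y)) x"
  by (rule ext) (simp add: contr_def[of v "dext F x"] dext_Cons)

text \<open>Cartan's formula and the antiderivation rule reduce one further argument to the product
  rule for directional derivatives; the mixed terms match because \<open>dext\<close> anticommutes
  with \<open>twist\<close>.\<close>

lemma dext_wedge: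
  assumes "cov_diff F x" "cov_diff G x"
  shows "dext (\<lambda>y. wedge (F y) (G y)) x = wedge (dext F x) (G x) + wedge (twist (F x)) (dext G x)"
proof
  fix vs
  show "dext (\<lambda>y. wedge (F y) (G y)) x vs = (wedge (dext F x) (G x) + wedge (twist (F x)) (dext G x)) vs"
    using assms
  proof (induction vs arbitrary: F G)
    case (Cons v vs)
    note F = Cons.prems(1) and G = Cons.prems(2)
    note c = cov_diff_contr[of _ _ v] cov_diff_twist cov_diff_wedge
    have "dext (\<lambda>y. wedge (F y) (G y)) x (v # vs) =
        (wedge (dird v F x) (G x) + wedge (F x) (dird v G x)) vs -
        (dext (\<lambda>y. wedge (contr v (F y)) (G y)) x vs + dext (\<lambda>y. wedge (twist (F y)) (contr v (G y))) x vs)"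
      by (simp add: dext_Cons dird_wedge F G contr_wedge dext_add c)
    moreover have "wedge (\<lambda>a. - t a) b = - wedge t b" for t b :: "'a list \<Rightarrow> real"
      using wedge_minus_left[of t b] by (simp add: fun_Compl_def)
    ultimately show ?case
      by (simp add: Cons.IH c F G dext_twist[OF F])
        (simp add: wedge_Cons contr_dext contr_twist wedge_linear dext_twist twist_diff F)
  qed simp
qed

lemma dext_cong:
  assumes "open U" "x \<in> U" "\<And>y. y \<in> U \<Longrightarrow> F y = G y"
  shows "dext F x = dext G x"
proof -
  have "((\<lambda>y. F y us) has_derivative f') (at x) \<longleftrightarrow> ((\<lambda>y. G y us) has_derivative f') (at x)" for us f'
    using has_derivative_transform_within_open[OF _ assms(1,2)] assms(3) by (metis (no_types, lifting))
  then show ?thesis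
    unfolding dext_def dird_def frechet_derivative_def by simp
qed

lemma homog_dext:
  assumes "\<And>y. homog k (F y)"
  shows "homog (Suc k) (dext F x)"
  unfolding homog_def
proof (intro allI impI)
  fix vs :: "'a list"
  assume len: "length vs \<noteq> Suc k"
  show "dext F x vs = 0"
    unfolding dext_def
  proof (rule sum.neutral, intro ballI)
    fix j assume j: "j \<in> {..<length vs}"
    then have "length (take j vs @ drop (Suc j) vs) \<noteq> k"
      using len by auto
    then have "(\<lambda>y. F y (take j vs @ drop (Suc j) vs)) = (\<lambda>y. 0)"
      using assms by (simp add: homog_def)
    then show "(- 1) ^ j * dird (vs ! j) F x (take j vs @ drop (Suc j) vs) = 0"
      by (simp add: dird_def)
  qed
qed

lemma lift_has_derivative:
  assumes "cov_diff F (fst z)"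
  shows "((\<lambda>z. lift (F (fst z)) us) has_derivative (\<lambda>v. lift (dird (fst v) F (fst z)) us)) (at z)"
  using has_derivative_compose[OF has_derivative_fst[OF has_derivative_ident] cov_diff_has_derivative[OF assms, of "map fst us"]]
  by (simp add: lift_def)

lemma cov_diff_lift: "cov_diff F (fst z) \<Longrightarrow> cov_diff (\<lambda>z. lift (F (fst z))) z"
  using lift_has_derivative unfolding cov_diff_def differentiable_def by blast

lemma dext_lift:
  assumes "cov_diff F (fst z)"
  shows "dext (\<lambda>z. lift (F (fst z))) z = lift (dext F (fst z))"
proof
  fix vs
  have "dird v (\<lambda>z. lift (F (fst z))) z us = lift (dird (fst v) F (fst z)) us" for v us
    using dird_eqI[OF lift_has_derivative[OF assms]] .
  then show "dext (\<lambda>z. lift (F (fst z))) z vs = lift (dext F (fst z)) vs"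
    by (simp add: dext_def lift_def[of "dext F (fst z)"]) (simp add: lift_def take_map drop_map)
qed

lemma ext_d_eq: "ext_d A F i x = (if x \<in> img A i then dext (F i) x else 0)"
  by (rule ext) (simp add: ext_d_def dext_def dird_def)


section \<open>Smooth functions\<close>

text \<open>On an open set agreement of functions passes to their Frechet derivatives. It allows a
  derivative to be replaced by its computed formula at every order.\<close>

lemma Ck_on_cong:
  assumes "open S" "\<And>x. x \<in> S \<Longrightarrow> f x = g x"
  shows "Ck_on n S f \<longleftrightarrow> Ck_on n S g"
  using assms(2)
proof (induction n arbitrary: f g)
  case 0
  then show ?case using continuous_on_cong[of S S f g] by simp
next
  case (Suc n)
  have d: "(f has_derivative f') (at x) \<longleftrightarrow> (g has_derivative f') (at x)" if "x \<in> S" for x f'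
    using has_derivative_transform_within_open[OF _ assms(1) that] Suc.prems by metis
  then have "frechet_derivative f (at x) = frechet_derivative g (at x)" if "x \<in> S" for x
    using that by (simp add: frechet_derivative_def)
  then have "Ck_on n S (\<lambda>x. frechet_derivative f (at x) v) \<longleftrightarrow> Ck_on n S (\<lambda>x. frechet_derivative g (at x) v)" for v
    by (intro Suc.IH) simp
  then show ?case using d by (auto simp: differentiable_def)
qed

lemma smooth_on_cong: "open S \<Longrightarrow> (\<And>x. x \<in> S \<Longrightarrow> f x = g x) \<Longrightarrow> smooth_on S f \<longleftrightarrow> smooth_on S g"
  unfolding smooth_on_def using Ck_on_cong by blast

lemma Ck_on_const: "Ck_on n S (\<lambda>x. c)"
  by (induction n arbitrary: c) auto

lemma smooth_on_const: "smooth_on S (\<lambda>x. c)"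
  by (simp add: smooth_on_def Ck_on_const)

lemma Ck_on_add:
  assumes "open S"
  shows "Ck_on n S f \<Longrightarrow> Ck_on n S g \<Longrightarrow> Ck_on n S (\<lambda>x. f x + g x)"
proof (induction n arbitrary: f g)
  case (Suc n)
  have "frechet_derivative (\<lambda>x. f x + g x) (at x) v = frechet_derivative f (at x) v + frechet_derivative g (at x) v"
    if "x \<in> S" for x v
  proof -
    have "(f has_derivative frechet_derivative f (at x)) (at x)" "(g has_derivative frechet_derivative g (at x)) (at x)"
      using Suc.prems that by (auto simp: mem_Times_iff simp flip: frechet_derivative_works)
    from frechet_derivative_at[OF has_derivative_add[OF this]] show ?thesis by metis
  qed
  then have "Ck_on n S (\<lambda>x. frechet_derivative (\<lambda>x. f x + g x) (at x) v) \<longleftrightarrow>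
      Ck_on n S (\<lambda>x. frechet_derivative f (at x) v + frechet_derivative g (at x) v)" for v
    by (intro Ck_on_cong assms)
  then have "Ck_on n S (\<lambda>x. frechet_derivative (\<lambda>x. f x + g x) (at x) v)" for v
    using Suc.IH[of "\<lambda>x. frechet_derivative f (at x) v" "\<lambda>x. frechet_derivative g (at x) v"] Suc.prems by simp
  then show ?case using Suc.prems by auto
qed (auto intro: continuous_on_add)

lemma smooth_on_add: "open S \<Longrightarrow> smooth_on S f \<Longrightarrow> smooth_on S g \<Longrightarrow> smooth_on S (\<lambda>x. f x + g x)"
  by (simp add: smooth_on_def Ck_on_add)

lemma Ck_on_mult_const:
  fixes f :: "'a::real_normed_vector \<Rightarrow> real"
  assumes "open S"
  shows "Ck_on n S f \<Longrightarrow> Ck_on n S (\<lambda>x. c * f x)"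
proof (induction n arbitrary: f)
  case (Suc n)
  have "frechet_derivative (\<lambda>x. c * f x) (at x) v = c * frechet_derivative f (at x) v"
    if "x \<in> S" for x v
  proof -
    have "(f has_derivative frechet_derivative f (at x)) (at x)"
      using Suc.prems that by (auto simp: mem_Times_iff simp flip: frechet_derivative_works)
    from frechet_derivative_at[OF has_derivative_mult_right[OF this, of c]] show ?thesis by metis
  qed
  then have "Ck_on n S (\<lambda>x. frechet_derivative (\<lambda>x. c * f x) (at x) v) \<longleftrightarrow>
      Ck_on n S (\<lambda>x. c * frechet_derivative f (at x) v)" for v
    by (intro Ck_on_cong assms)
  then have "Ck_on n S (\<lambda>x. frechet_derivative (\<lambda>x. c * f x) (at x) v)" for v
    using Suc.IH[of "\<lambda>x. frechet_derivative f (at x) v"] Suc.prems by simp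
  then show ?case using Suc.prems by auto
qed (auto intro: continuous_intros)

lemma smooth_on_mult_const:
  fixes f :: "'a::real_normed_vector \<Rightarrow> real"
  shows "open S \<Longrightarrow> smooth_on S f \<Longrightarrow> smooth_on S (\<lambda>x. c * f x)"
  by (simp add: smooth_on_def Ck_on_mult_const)

lemma smooth_on_sum:
  assumes "open S" "finite I" "\<And>i. i \<in> I \<Longrightarrow> smooth_on S (f i)"
  shows "smooth_on S (\<lambda>x. \<Sum>i\<in>I. f i x)"
  using assms(2,3)
  by (induction I rule: finite_induct) (auto intro: smooth_on_const smooth_on_add[OF assms(1)])

lemma Ck_on_fst:
  assumes "open S" "open T"
  shows "Ck_on n S f \<Longrightarrow> Ck_on n (S \<times> T) (\<lambda>z. f (fst z))"
proof (induction n arbitrary: f)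
  case 0
  then show ?case
    by (auto intro!: continuous_on_compose2[of S f] continuous_intros)
next
  case (Suc n)
  have d: "((\<lambda>z. f (fst z)) has_derivative (\<lambda>v. frechet_derivative f (at (fst z)) (fst v))) (at z)"
    if "z \<in> S \<times> T" for z
  proof -
    have "(f has_derivative frechet_derivative f (at (fst z))) (at (fst z))"
      using Suc.prems that by (auto simp: mem_Times_iff simp flip: frechet_derivative_works)
    from has_derivative_compose[OF has_derivative_fst[OF has_derivative_ident] this]
    show ?thesis .
  qed
  have "frechet_derivative (\<lambda>z. f (fst z)) (at z) v = frechet_derivative f (at (fst z)) (fst v)"
    if "z \<in> S \<times> T" for z v
    using frechet_derivative_at[OF d[OF that]] by metis
  then have "Ck_on n (S \<times> T) (\<lambda>z. frechet_derivative (\<lambda>z. f (fst z)) (at z) v) \<longleftrightarrow>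
      Ck_on n (S \<times> T) (\<lambda>z. (\<lambda>x. frechet_derivative f (at x) (fst v)) (fst z))" for v
    by (intro Ck_on_cong open_Times assms) auto
  then have "Ck_on n (S \<times> T) (\<lambda>z. frechet_derivative (\<lambda>z. f (fst z)) (at z) v)" for v
    using Suc.IH[of "\<lambda>x. frechet_derivative f (at x) (fst v)"] Suc.prems by simp
  then show ?case using d unfolding Ck_on.simps differentiable_def by blast
qed

lemma smooth_on_fst: "open S \<Longrightarrow> open T \<Longrightarrow> smooth_on S f \<Longrightarrow> smooth_on (S \<times> T) (\<lambda>z. f (fst z))"
  by (simp add: smooth_on_def Ck_on_fst)

lemma smooth_on_differentiable: "smooth_on S f \<Longrightarrow> x \<in> S \<Longrightarrow> f differentiable (at x)"
  unfolding smooth_on_def using Ck_on.simps(2)[of 0 S f] by blast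

lemma is_form_cov_diff: "is_form A k F \<Longrightarrow> x \<in> img A i \<Longrightarrow> cov_diff (F i) x"
  unfolding is_form_def cov_diff_def using smooth_on_differentiable by fast

section \<open>Differentiability of the Hodge star\<close>

text \<open>Cramer's rule: when \<open>c\<close> is expanded in the coframe, every term except the
  \<open>j\<close>-th repeats a factor of the monomial.\<close>

lemma (in frame6) coframe_monom_update:
  assumes c: "alt 1 c" and j: "j \<in> {1..6}"
  shows "coframe_monom (e(j := c)) [1,2,3,4,5,6] = c [b j] *\<^sub>C vol"
proof (rule eqI_6)
  have "alt 1 ((e(j := c)) i)" if "i \<in> {1..6}" for i
    using c e_alt that by (auto simp: dim)
  then have "alt k (coframe_monom (e(j := c)) is)" if "length is = k" "set is \<subseteq> {1..6}" for k "is"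
    using alt_coframe_monom[of "is" "e(j := c)"] that by blast
  from this[of "[1,2,3,4,5,6]" 6] show "alt 6 (coframe_monom (e(j := c)) [1,2,3,4,5,6])" by simp
  have "j = 1 \<or> j = 2 \<or> j = 3 \<or> j = 4 \<or> j = 5 \<or> j = 6"
    using j by auto
  then show "list_all (\<lambda>xs. coframe_monom (e(j := c)) [1,2,3,4,5,6] (map b xs) = (c [b j] *\<^sub>C vol) (map b xs))
      [[1, 2, 3, 4, 5, 6]]"
    by (elim disjE; simp add: frame_simps dim alt_1_contr[OF c] alt_1_contr_wedge[OF c] alt_1_Nil[OF c])
qed (intro alt_scale alt_vol)

lemma cov_diff_coframe_monom:
  "(\<And>i. i \<in> set is \<Longrightarrow> cov_diff (\<lambda>y. e y i) x) \<Longrightarrow> cov_diff (\<lambda>y. coframe_monom (e y) is) x"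
  by (induction "is") (simp_all add: coframe_monom_expand cov_diff_const cov_diff_wedge)

text \<open>By Cramer's rule, the dual basis has coordinates that are quotients of monomials in the coframe.\<close>

lemma dual_basis_differentiable:
  fixes e :: "'e::euclidean_space \<Rightarrow> nat \<Rightarrow> 'e list \<Rightarrow> real"
  assumes W: "open W" "x \<in> W" and fr: "\<And>y. y \<in> W \<Longrightarrow> frame6 (e y) (b y)"
    and diff: "\<And>k. k \<in> {1..6} \<Longrightarrow> cov_diff (\<lambda>y. e y k) x" and j: "j \<in> {1..6}"
  shows "(\<lambda>y. b y j \<bullet> u) differentiable (at x)"
proof -
  interpret x: frame6 "e x" "b x" by (rule fr[OF W(2)])
  \<comment> \<open>The covector \<open>v \<mapsto> v \<bullet> u\<close>, so that its value at
    \<open>b y j\<close> is the coordinate whose differentiability is claimed.\<close>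
  define c :: "'e list \<Rightarrow> real" where "c vs = (if length vs = 1 then hd vs \<bullet> u else 0)" for vs
  have "linear (\<lambda>v. c (v # vs))" for vs
    by (cases vs) (auto simp: c_def linear_zero_cov intro: linearI inner_add_left)
  then have c: "alt 1 c"
    by (auto simp: One_nat_def alt.simps homog_def contr_def c_def)
  \<comment> \<open>The arguments are frozen at the base point. Numerator and denominator then
    depend on \<open>y\<close> through the coframe only, and the denominator is 1 at
    \<open>x\<close>, hence nonzero nearby.\<close>
  define cs where "cs = [b x 1, b x 2, b x 3, b x 4, b x 5, b x 6]"
  define N where "N y = coframe_monom ((e y)(j := c)) [1,2,3,4,5,6] cs" for y
  define D where "D y = coframe_monom (e y) [1,2,3,4,5,6] cs" for y
  have "cov_diff (\<lambda>y. coframe_monom ((e y)(j := c)) [1,2,3,4,5,6]) x"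
  proof (rule cov_diff_coframe_monom)
    fix i :: nat assume "i \<in> set [1,2,3,4,5,6]"
    then show "cov_diff (\<lambda>y. ((e y)(j := c)) i) x"
      by (cases "i = j") (use diff cov_diff_const in auto)
  qed
  then have N: "N differentiable (at x)" by (simp add: cov_diff_def N_def[abs_def])
  have "cov_diff (\<lambda>y. coframe_monom (e y) [1,2,3,4,5,6]) x"
    by (rule cov_diff_coframe_monom) (use diff in auto)
  then have D: "D differentiable (at x)" by (simp add: cov_diff_def D_def[abs_def])
  have "D x = 1" using x.vol_on_basis by (simp add: D_def cs_def)
  then have "(\<lambda>y. N y / D y) differentiable (at x)"
    using N D by (intro differentiable_divide) auto
  then obtain f' where f': "((\<lambda>y. N y / D y) has_derivative f') (at x)"
    by (auto simp: differentiable_def)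
  have ND: "N y = (b y j \<bullet> u) * D y" if "y \<in> W" for y
  proof -
    interpret y: frame6 "e y" "b y" by (rule fr[OF that])
    show ?thesis using y.coframe_monom_update[OF c j] by (simp add: N_def D_def cscale_apply c_def)
  qed
  have "isCont D x" using D by (rule differentiable_imp_continuous_within)
  then have "\<forall>\<^sub>F y in at x. D y \<noteq> 0"
    using \<open>D x = 1\<close> by (intro tendsto_imp_eventually_ne[of D 1]) (auto simp: isCont_def)
  moreover have "\<forall>\<^sub>F y in at x. y \<in> W"
    using W by (rule eventually_at_in_open')
  ultimately have "\<forall>\<^sub>F y in at x. N y / D y = b y j \<bullet> u"
    by eventually_elim (simp add: ND)
  from has_derivative_transform_eventually[OF f' this] show ?thesis
    using ND[OF W(2)] \<open>D x = 1\<close> by (auto simp: differentiable_def)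
qed

text \<open>Each moving vector is expanded in the fixed standard basis, which turns the expression
  into a finite sum of products of differentiable coordinates with contractions by constant
  vectors.\<close>

lemma cov_diff_on_basis:
  fixes F :: "'e::euclidean_space \<Rightarrow> 'e list \<Rightarrow> real"
  assumes W: "open W" "x \<in> W"
    and b: "\<And>j u. j \<in> set xs \<Longrightarrow> (\<lambda>y. b y j \<bullet> u) differentiable (at x)"
    and F: "\<And>y. y \<in> W \<Longrightarrow> alt k (F y)" "cov_diff F x"
  shows "(\<lambda>y. F y (map (b y) xs @ us)) differentiable (at x)"
  using b F
proof (induction xs arbitrary: F k)
  case Nil
  then show ?case by (simp add: cov_diff_def)
next
  case (Cons j xs)
  have d: "(\<lambda>y. contr u (F y) (map (b y) xs @ us)) differentiable (at x)" for u
    by (rule Cons.IH) (use Cons.prems in \<open>auto intro: alt_contr cov_diff_contr\<close>)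
  have "(\<lambda>y. \<Sum>u\<in>Basis. (b y j \<bullet> u) * contr u (F y) (map (b y) xs @ us)) differentiable (at x)"
    using Cons.prems(1) d by (intro differentiable_sum differentiable_mult) auto
  then obtain f' where f': "((\<lambda>y. \<Sum>u\<in>Basis. (b y j \<bullet> u) * contr u (F y) (map (b y) xs @ us)) has_derivative f') (at x)"
    by (auto simp: differentiable_def)
  have "F y (map (b y) (j # xs) @ us) = (\<Sum>u\<in>Basis. (b y j \<bullet> u) * contr u (F y) (map (b y) xs @ us))"
    if "y \<in> W" for y
    using alt_contr_sum[OF Cons.prems(2)[OF that], of "\<lambda>u. b y j \<bullet> u" "\<lambda>u. u" Basis]
    by (simp add: euclidean_representation contr_apply[of "F y"])
  then have "((\<lambda>y. F y (map (b y) (j # xs) @ us)) has_derivative f') (at x)"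
    by (intro has_derivative_transform_within_open[OF f' W]) simp
  then show ?case by (auto simp: differentiable_def)
qed

text \<open>The star may be computed at every point in the dual basis of the moving coframe, which
  is differentiable, whereas the basis chosen by \<open>SOME\<close> need not depend on the point in
  any regular way.\<close>

lemma cov_diff_hodge:
  fixes e :: "'e::euclidean_space \<Rightarrow> nat \<Rightarrow> 'e list \<Rightarrow> real"
  assumes W: "open W" "x \<in> W" and fr: "\<And>y. y \<in> W \<Longrightarrow> frame6 (e y) (b y)"
    and diff: "\<And>k. k \<in> {1..6} \<Longrightarrow> cov_diff (\<lambda>y. e y k) x"
    and F: "\<And>y. y \<in> W \<Longrightarrow> alt k (F y)" "cov_diff F x" and k: "k \<le> 6"
  shows "cov_diff (\<lambda>y. hodge (coframe_metric (e y)) (coframe_monom (e y) [1,2,3,4,5,6]) (F y)) x"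
  unfolding cov_diff_def
proof
  fix us
  let ?sl = "sorted_list_of_set :: nat set \<Rightarrow> nat list"
  let ?vol = "\<lambda>y. coframe_monom (e y) [1,2,3,4,5,6]"
  let ?S = "{I. I \<subseteq> {1..6::nat} \<and> card I = k}"
  have bd: "(\<lambda>y. b y j \<bullet> u) differentiable (at x)" if "j \<in> {1..6}" for j u
    by (rule dual_basis_differentiable[OF W fr diff that])
  have vol: "cov_diff ?vol x"
    by (rule cov_diff_coframe_monom) (use diff in auto)
  have alt_vol: "alt 6 (?vol y)" if "y \<in> W" for y
    using frame6.alt_vol[OF fr[OF that]] .
  have "(\<lambda>y. F y (map (b y) (?sl I)) * ?vol y (map (b y) (?sl I) @ us)) differentiable (at x)"
    if "I \<in> ?S" for I
  proof -
    have "set (?sl I) \<subseteq> {1..6}" using that finite_subset[of I "{1..6}"] by auto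
    then have 1: "(\<lambda>y. b y j \<bullet> u) differentiable (at x)" if "j \<in> set (?sl I)" for j u
      using bd that by blast
    show ?thesis
      using cov_diff_on_basis[OF W 1 F, where us = "[]"] cov_diff_on_basis[OF W 1 alt_vol vol, where us = us]
      by (intro differentiable_mult) auto
  qed
  then have "(\<lambda>y. \<Sum>I\<in>?S. F y (map (b y) (?sl I)) * ?vol y (map (b y) (?sl I) @ us)) differentiable (at x)"
    by (intro differentiable_sum) auto
  then obtain f' where f': "((\<lambda>y. \<Sum>I\<in>?S. F y (map (b y) (?sl I)) * ?vol y (map (b y) (?sl I) @ us)) has_derivative f') (at x)"
    by (auto simp: differentiable_def)
  have "hodge (coframe_metric (e y)) (?vol y) (F y) us =
      (\<Sum>I\<in>?S. F y (map (b y) (?sl I)) * ?vol y (map (b y) (?sl I) @ us))" if "y \<in> W" for y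
  proof -
    interpret y: frame6 "e y" "b y" by (rule fr[OF that])
    show ?thesis
      by (subst hodge_eq[OF y.cofr y.dual F(1)[OF that], unfolded y.dim, OF y.alt_vol k]) simp
  qed
  then have "((\<lambda>y. hodge (coframe_metric (e y)) (?vol y) (F y) us) has_derivative f') (at x)"
    by (intro has_derivative_transform_within_open[OF f' W]) simp
  then show "(\<lambda>y. hodge (coframe_metric (e y)) (?vol y) (F y) us) differentiable (at x)"
    by (auto simp: differentiable_def)
qed


section \<open>The product of a manifold and the circle\<close>

lemma cis_eq_cis_iff: "cis s = cis t \<longleftrightarrow> (\<exists>n::int. s = t + 2 * pi * n)"
  using sin_cos_eq_iff[of s t] by (auto simp: complex_eq_iff)

lemma inj_on_cis: "inj_on cis {a<..<a + 2 * pi}"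
proof (rule inj_onI)
  fix s t assume st: "s \<in> {a<..<a + 2 * pi}" "t \<in> {a<..<a + 2 * pi}" "cis s = cis t"
  then obtain n :: int where n: "s = t + 2 * pi * n" using cis_eq_cis_iff by blast
  have "s < a + 2 * pi" "a < s" "t < a + 2 * pi" "a < t" using st(1,2) by auto
  then have "s - t < 2 * pi" "- (2 * pi) < s - t" by linarith+
  moreover have "s - t = 2 * pi * real_of_int n" by (simp add: n)
  ultimately have "2 * pi * real_of_int n < 2 * pi * 1" "2 * pi * (- 1) < 2 * pi * real_of_int n"
    by linarith+
  then have "real_of_int n < 1" "- 1 < real_of_int n"
    using mult_less_cancel_left_pos[of "2 * pi" "real_of_int n" 1]
      mult_less_cancel_left_pos[of "2 * pi" "- 1" "real_of_int n"] pi_gt_zero by linarith+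
  then have "n = 0" by linarith
  then show "s = t" by (simp add: n)
qed

lemma coord_circle_atlas: "s \<in> {a<..<a + 2 * pi} \<Longrightarrow> coord circle_atlas a (cis s) = s"
  by (simp add: coord_def circle_atlas_def inv_into_f_f[OF inj_on_cis])

lemma chart_dom_circle_atlas: "chart_dom circle_atlas a = cis ` {a<..<a + 2 * pi}"
  by (simp add: chart_dom_def circle_atlas_def)

lemma img_circle_atlas: "img circle_atlas a = {a<..<a + 2 * pi}"
  unfolding img_def chart_dom_circle_atlas image_image using coord_circle_atlas by force

lemma img_prod_atlas: "img (prod_atlas A B) (i, j) = img A i \<times> img B j"
  by (force simp: img_def prod_atlas_def chart_dom_def coord_def)

text \<open>\<open>s' - s\<close> is a multiple of \<open>2 * pi\<close>. The overlap of two charts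
  can have two components with different translations, so the formula is claimed only on a
  neighbourhood of the given point.\<close>

lemma transition_circle_atlas:
  assumes "s \<in> {a<..<a + 2 * pi}" "s' \<in> {a'<..<a' + 2 * pi}" "cis s = cis s'"
  shows "\<exists>U. open U \<and> s \<in> U \<and> U \<subseteq> {a<..<a + 2 * pi} \<and>
    (\<forall>r\<in>U. transition circle_atlas a a' r = r + (s' - s))"
proof -
  obtain n :: int where n: "s = s' + 2 * pi * n" using assms(3) cis_eq_cis_iff by blast
  define U where "U = {a<..<a + 2 * pi} \<inter> {a' + (s - s')<..<a' + (s - s') + 2 * pi}"
  have "transition circle_atlas a a' r = r + (s' - s)" if "r \<in> U" for r
  proof -
    have "inv_into (chart_dom circle_atlas a) (coord circle_atlas a) r = cis r"
    proof (rule inv_into_f_eq)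
      show "inj_on (coord circle_atlas a) (chart_dom circle_atlas a)"
        unfolding chart_dom_circle_atlas by (auto intro!: inj_onI simp: coord_circle_atlas)
    qed (use that in \<open>auto simp: chart_dom_circle_atlas coord_circle_atlas U_def\<close>)
    moreover have "cis r = cis (r + (s' - s))"
      unfolding cis_eq_cis_iff by (rule exI[of _ n]) (simp add: n)
    ultimately show ?thesis
      using that coord_circle_atlas[of "r + (s' - s)" a'] by (simp add: transition_def U_def)
  qed
  then show ?thesis
    using assms by (intro exI[of _ U]) (auto simp: U_def open_Int)
qed

section \<open>Warped products\<close>

lemma form_scale_apply: "(c *\<^sub>F F) i x = c *\<^sub>C F i x"
  by (simp add: form_scale_def cscale_def)

lemma form_wedge_apply: "(F \<and>\<^sub>F G) i x = wedge (F i x) (G i x)"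
  by (simp add: form_wedge_def)

lemma pull_fst_apply:
  "pull_fst A B F (i, j) z = (if z \<in> img (prod_atlas A B) (i, j) then lift (F i (fst z)) else 0)"
  by (rule ext) (simp add: pull_fst_def lift_def case_prod_beta)

lemma pull_snd_circle_ds_apply:
  "pull_snd A circle_atlas circle_ds (i, a) z = (if z \<in> img (prod_atlas A circle_atlas) (i, a) then ds else 0)"
proof
  fix vs
  show "pull_snd A circle_atlas circle_ds (i, a) z vs =
      (if z \<in> img (prod_atlas A circle_atlas) (i, a) then ds else 0) vs"
    by (cases vs) (auto simp: pull_snd_def circle_ds_def case_prod_beta img_prod_atlas ds_def mem_Times_iff)
qed

lemmas form_apply = form_scale_apply form_wedge_apply pull_fst_apply pull_snd_circle_ds_apply

lemma is_form_alt: "is_form A k F \<Longrightarrow> alt k (F i x)"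
  by (simp add: is_form_def alternating_map_iff_alt)

lemma is_form_outside: "is_form A k F \<Longrightarrow> x \<notin> img A i \<Longrightarrow> F i x = 0"
  by (simp add: is_form_def)

lemma lift_eq_0_iff [simp]: "lift a = (0 :: ('e \<times> 'f) list \<Rightarrow> real) \<longleftrightarrow> a = 0"
proof
  assume 0: "lift a = 0"
  show "a = 0"
  proof
    fix us
    show "a us = 0 us"
      using fun_cong[OF 0, of "map (\<lambda>u. (u, undefined)) us"] by (simp add: lift_def o_def)
  qed
qed simp

lemma twist_ds: "twist ds = (- ds :: ('e \<times> real) list \<Rightarrow> real)"
  by (auto simp: twist_def ds_def)

lemma contr_ds: "contr v ds = (snd v *\<^sub>C one_cov :: ('e \<times> real) list \<Rightarrow> real)"
  by (auto simp: contr_def ds_def cscale_def one_cov_def)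

text \<open>On vectors tangent to the first factor the \<open>ds\<close> term vanishes, which
  isolates \<open>a\<close>; putting the unit vector of the line in front then isolates
  \<open>b\<close>.\<close>

lemma lift_wedge_ds_eq_0:
  assumes b: "homog k b" and 0: "lift a + wedge (lift b) ds = (0 :: ('e::real_vector \<times> real) list \<Rightarrow> real)"
  shows "a = 0" "b = 0"
proof -
  define E where "E = map (\<lambda>u :: 'e. (u, 0 :: real))"
  have comm: "wedge (lift b) ds = (-1) ^ k *\<^sub>C wedge ds (lift b :: ('e \<times> real) list \<Rightarrow> real)"
    using wedge_commute[OF homog_lift[OF b] alt_homog[OF alt_ds]] by simp
  \<comment> \<open>The factor \<open>c\<close> is there for the induction: contraction with a
    vector of the first factor changes the sign of \<open>ds\<close>.\<close>
  have ds0: "wedge (c *\<^sub>C ds) X (E us) = 0" for X :: "('e \<times> real) list \<Rightarrow> real" and us c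
  proof (induction us arbitrary: X c)
    case Nil
    then show ?case by (simp add: E_def ds_def cscale_def)
  next
    case (Cons u us)
    have "- (c *\<^sub>C ds) = (- c) *\<^sub>C (ds :: ('e \<times> real) list \<Rightarrow> real)"
      by (auto simp: cscale_def)
    then show ?case
      using Cons.IH[of "- c"] by (simp add: E_def wedge_Cons contr_scale contr_ds twist_ds twist_scale cscale_minus)
  qed
  show "a = 0"
  proof
    fix us
    have "(lift a + wedge (lift b) ds) (E us) = 0" by (simp add: 0)
    then show "a us = 0 us"
      using ds0[of 1 "lift b" us] by (simp add: comm cscale_apply) (simp add: lift_def E_def o_def)
  qed
  show "b = 0"
  proof
    fix us
    have "wedge ds (lift b) ((0, 1) # E us) = 0"
    proof -
      have "wedge (lift b) ds ((0, 1) # E us) = 0"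
        using fun_cong[OF 0, of "(0, 1) # E us"] \<open>a = 0\<close> by simp
      then show ?thesis by (simp add: comm cscale_apply)
    qed
    then have "lift b (E us) = 0"
      using ds0[of "- 1" "contr (0, 1) (lift b)" us]
      by (simp add: wedge_Cons contr_ds twist_ds cscale_minus_one)
    then show "b us = 0 us" by (simp add: lift_def E_def o_def)
  qed
qed

text \<open>The situation at one fixed time, with \<open>c\<close> for the value of the warping
  function.\<close>

locale warped =
  fixes M :: "'m::{t2_space, second_countable_topology} set"
    and A :: "('i, 'm, real^6) atlas" and \<alpha> \<beta> c :: real
    and \<omega> \<psi>p \<psi>m :: "('i, real^6) form"
  assumes man: "smooth_manifold M A" and ab: "\<alpha>\<^sup>2 + \<beta>\<^sup>2 = 1" and c: "c \<noteq> 0"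
    and su3: "su3_structure A \<omega> \<psi>p \<psi>m"
begin

abbreviation "Z \<equiv> prod_atlas A circle_atlas"
abbreviation "P \<equiv> pull_fst A circle_atlas"
abbreviation "S \<equiv> pull_snd A circle_atlas circle_ds"
abbreviation "\<psi>1 \<equiv> \<alpha> *\<^sub>F \<psi>p - \<beta> *\<^sub>F \<psi>m"
abbreviation "\<psi>2 \<equiv> \<beta> *\<^sub>F \<psi>p + \<alpha> *\<^sub>F \<psi>m"
abbreviation "\<phi> \<equiv> warped_g2 A \<alpha> \<beta> c \<omega> \<psi>p \<psi>m"

lemma open_img: "open (img A i)"
  using man by (simp add: smooth_manifold_def)

lemma img_Z: "img Z (i, a) = img A i \<times> {a<..<a + 2 * pi}"
  by (simp add: img_prod_atlas img_circle_atlas)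

lemma open_img_Z: "open (img Z (i, a))"
  by (simp add: img_Z open_Times open_img)

lemma is_form: "is_form A 2 \<omega>" "is_form A 3 \<psi>p" "is_form A 3 \<psi>m"
  using su3 by (simp_all add: su3_structure_def)

lemma phi_apply:
  "\<phi> (i, a) z = (if z \<in> img Z (i, a) then c *\<^sub>C wedge (lift (\<omega> i (fst z))) ds + lift (\<psi>1 i (fst z)) else 0)"
  by (simp add: warped_g2_def form_apply)

text \<open>The coframe is adapted to the rotated forms, while the metric is that of the original
  structure; the rotation of a given adapted coframe leaves the metric unchanged.\<close>

lemma adapted_frames:
  assumes "x \<in> img A i"
  obtains W e b where "open W" "x \<in> W" "W \<subseteq> img A i"
    "\<And>k v. k \<in> {1..6} \<Longrightarrow> smooth_on W (\<lambda>y. e y k [v])"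
    "\<And>y. y \<in> W \<Longrightarrow> frame6 (e y) (b y)"
    "\<And>y. y \<in> W \<Longrightarrow> su3_adapted (\<omega> i y) (\<psi>1 i y) (\<psi>2 i y) (e y)"
    "\<And>y. y \<in> W \<Longrightarrow> su3_metric \<omega> \<psi>p \<psi>m i y = coframe_metric (e y)"
proof -
  have dim: "DIM(real^6) = 6" by simp
  have "\<exists>W e. open W \<and> x \<in> W \<and> W \<subseteq> img A i \<and> (\<forall>k\<in>{1..6}. \<forall>v. smooth_on W (\<lambda>y. e y k [v])) \<and>
      (\<forall>y\<in>W. coframe (e y) \<and> su3_adapted (\<omega> i y) (\<psi>p i y) (\<psi>m i y) (e y))"
    using su3 assms unfolding su3_structure_def has_local_coframes_def dim by blast
  then obtain W e where W: "open W" "x \<in> W" "W \<subseteq> img A i"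
    and sm: "\<And>k v. k \<in> {1..6} \<Longrightarrow> smooth_on W (\<lambda>y. e y k [v])"
    and e: "\<And>y. y \<in> W \<Longrightarrow> coframe (e y)" "\<And>y. y \<in> W \<Longrightarrow> su3_adapted (\<omega> i y) (\<psi>p i y) (\<psi>m i y) (e y)"
    by blast
  define b where "b y = (SOME b. dual_basis (e y) b)" for y
  have fr: "frame6 (e y) (b y)" if "y \<in> W" for y
  proof -
    have "dual_basis (e y) (b y)"
      unfolding b_def using coframe_dual_basis_exists[OF e(1)[OF that]] someI_ex by metis
    then show ?thesis using e(1)[OF that] by unfold_locales auto
  qed
  show ?thesis
  proof (rule that[OF W, of "\<lambda>y. rot_coframe \<alpha> \<beta> (e y)" "\<lambda>y k. if k = 1 then \<alpha> *\<^sub>R b y 1 - \<beta> *\<^sub>R b y 2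
        else if k = 2 then \<beta> *\<^sub>R b y 1 + \<alpha> *\<^sub>R b y 2 else b y k"])
    fix k :: nat and v assume "k \<in> {1..6}"
    then show "smooth_on W (\<lambda>y. rot_coframe \<alpha> \<beta> (e y) k [v])"
      using smooth_on_add[OF W(1) smooth_on_mult_const[OF W(1) sm, of 1 \<alpha> v] smooth_on_mult_const[OF W(1) sm, of 2 "- \<beta>" v]]
        smooth_on_add[OF W(1) smooth_on_mult_const[OF W(1) sm, of 1 \<beta> v] smooth_on_mult_const[OF W(1) sm, of 2 \<alpha> v]] sm
      by (cases "k = 1"; cases "k = 2") (auto simp: rot_coframe_def cscale_apply)
  next
    fix y assume y: "y \<in> W"
    interpret frame6 "e y" "b y" by (rule fr[OF y])
    have ad: "\<omega> i y = w" "\<psi>p i y = p" "\<psi>m i y = m"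
      using e(2)[OF y] by (simp_all add: su3_adapted_def)
    show "frame6 (rot_coframe \<alpha> \<beta> (e y)) (\<lambda>k. if k = 1 then \<alpha> *\<^sub>R b y 1 - \<beta> *\<^sub>R b y 2
        else if k = 2 then \<beta> *\<^sub>R b y 1 + \<alpha> *\<^sub>R b y 2 else b y k)"
      by (rule rot_coframe[OF ab])
    show "su3_adapted (\<omega> i y) (\<psi>1 i y) (\<psi>2 i y) (rot_coframe \<alpha> \<beta> (e y))"
      using rot_coframe(3)[OF ab] by (simp add: ad form_apply)
    show "su3_metric \<omega> \<psi>p \<psi>m i y = coframe_metric (rot_coframe \<alpha> \<beta> (e y))"
      unfolding rot_coframe(2)[OF ab] su3_metric_def
    proof (rule the_equality)
      fix g assume "\<exists>e. coframe e \<and> su3_adapted (\<omega> i y) (\<psi>p i y) (\<psi>m i y) e \<and> g = coframe_metric e"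
      then show "g = coframe_metric (e y)"
        using su3_adapted_unique[OF dim] e y by metis
    qed (use e y in blast)
  qed
qed

lemma su3_star_eq:
  assumes "frame6 e b" "su3_adapted (\<omega> i y) (\<psi>1 i y) (\<psi>2 i y) e"
    "su3_metric \<omega> \<psi>p \<psi>m i y = coframe_metric e"
  shows "su3_star \<omega> \<psi>p \<psi>m X i y = hodge (coframe_metric e) (coframe_monom e [1,2,3,4,5,6]) (X i y)"
proof -
  interpret frame6 e b by fact
  have "((1 / fact 3) *\<^sub>F (\<omega> \<and>\<^sub>F \<omega> \<and>\<^sub>F \<omega>)) i y = vol"
    using www assms(2) by (simp add: form_apply su3_adapted_def cscale_cscale fact_numeral)
  then show ?thesis by (simp add: su3_star_def form_hodge_def assms(3))
qed

text \<open>The product coframe is adapted to \<open>\<phi>\<close>, and uniqueness of the metric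
  and the volume form resolves both occurrences of \<open>THE\<close>.\<close>

lemma g2_star_eq:
  assumes "frame6 e b" "su3_adapted (\<omega> i y) (\<psi>1 i y) (\<psi>2 i y) e" and z: "z \<in> img Z (i, a)" "fst z = y"
  shows "g2_star \<phi> X (i, a) z = hodge (coframe_metric (prod_coframe c e))
    (coframe_monom (prod_coframe c e) [1,2,3,4,5,6,7]) (X (i, a) z)"
proof -
  interpret frame6 e b by fact
  interpret Q: frame7 "prod_coframe c e" "prod_basis c b" by (rule prod_frame[OF c])
  have ad: "g2_adapted (\<phi> (i, a) z) (prod_coframe c e)"
    using prod_g2_adapted[of c] assms(2) z by (simp add: phi_apply su3_adapted_def)
  have "g2_metric \<phi> (i, a) z = coframe_metric (prod_coframe c e)"
    unfolding g2_metric_def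
  proof (rule the_equality)
    fix g assume "\<exists>e. coframe e \<and> g2_adapted (\<phi> (i, a) z) e \<and> g = coframe_metric e"
    then show "g = coframe_metric (prod_coframe c e)"
      using g2_adapted_unique(1)[OF Q.dim] ad Q.cofr by metis
  qed (use ad Q.cofr in blast)
  moreover have "g2_volume \<phi> (i, a) z = coframe_monom (prod_coframe c e) [1,2,3,4,5,6,7]"
    unfolding g2_volume_def
  proof (rule the_equality)
    fix v assume "\<exists>e. coframe e \<and> g2_adapted (\<phi> (i, a) z) e \<and> v = coframe_monom e [1,2,3,4,5,6,7]"
    then show "v = coframe_monom (prod_coframe c e) [1,2,3,4,5,6,7]"
      using g2_adapted_unique(2)[OF Q.dim] ad Q.cofr by metis
  qed (use ad Q.cofr in blast)
  ultimately show ?thesis by (simp add: g2_star_def form_hodge_def)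
qed

text \<open>Near the point the transition of the circle is a translation, so its derivative is the
  identity and only the transition of the base contributes.\<close>

lemma transition_Z:
  assumes x: "q \<in> chart_dom A i \<inter> chart_dom A i'" and s: "\<zeta> \<in> chart_dom circle_atlas a \<inter> chart_dom circle_atlas a'"
  shows "frechet_derivative (transition Z (i, a) (i', a')) (at (coord A i q, coord circle_atlas a \<zeta>)) =
    (\<lambda>v. (frechet_derivative (transition A i i') (at (coord A i q)) (fst v), snd v))"
proof -
  define x where "x = coord A i q"
  obtain s s' where ss: "s \<in> {a<..<a + 2 * pi}" "s' \<in> {a'<..<a' + 2 * pi}" "cis s = cis s'" "\<zeta> = cis s"
    using s by (auto simp: chart_dom_circle_atlas)
  obtain U where U: "open U" "s \<in> U" "U \<subseteq> {a<..<a + 2 * pi}"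
    "\<And>r. r \<in> U \<Longrightarrow> transition circle_atlas a a' r = r + (s' - s)"
    using transition_circle_atlas[OF ss(1-3)] by blast
  have inj: "inj_on (coord A i) (chart_dom A i)"
  proof -
    obtain h where "homeomorphism (chart_dom A i) (img A i) (coord A i) h"
      using man unfolding smooth_manifold_def by blast
    then show ?thesis unfolding homeomorphism_def by (auto intro: inj_on_inverseI)
  qed
  have injc: "inj_on (coord circle_atlas a) (chart_dom circle_atlas a)"
    unfolding chart_dom_circle_atlas by (auto intro!: inj_onI simp: coord_circle_atlas)
  have tr: "transition Z (i, a) (i', a') z = (transition A i i' (fst z), snd z + (s' - s))"
    if "z \<in> img A i \<times> U" for z
  proof -
    have "fst z \<in> coord A i ` chart_dom A i"
      using that unfolding img_def[symmetric] by auto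
    then obtain p where p: "fst z = coord A i p" "p \<in> chart_dom A i" by blast
    define r where "r = snd z"
    have z: "z = (coord A i p, r)" "p \<in> chart_dom A i" "r \<in> U"
      using that p by (auto simp: r_def mem_Times_iff prod_eq_iff)
    have r: "coord circle_atlas a (cis r) = r" "cis r \<in> chart_dom circle_atlas a"
      using z(3) U(3) coord_circle_atlas by (auto simp: chart_dom_circle_atlas)
    have "inv_into (chart_dom Z (i, a)) (coord Z (i, a)) z = (p, cis r)"
    proof (rule inv_into_f_eq)
      show "inj_on (coord Z (i, a)) (chart_dom Z (i, a))"
        using inj injc by (auto simp: prod_atlas_def chart_dom_def coord_def inj_on_def)
    qed (use z r in \<open>auto simp: prod_atlas_def chart_dom_def coord_def\<close>)
    moreover have "inv_into (chart_dom A i) (coord A i) (coord A i p) = p"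
      using z inj by (simp add: inv_into_f_f)
    moreover have "inv_into (chart_dom circle_atlas a) (coord circle_atlas a) r = cis r"
      using r injc by (intro inv_into_f_eq) auto
    ultimately show ?thesis
      using U(4)[OF z(3)] z by (simp add: transition_def prod_atlas_def coord_def)
  qed
  have "(transition A i i' has_derivative frechet_derivative (transition A i i') (at x)) (at x)"
  proof -
    have "smooth_on (coord A i ` (chart_dom A i \<inter> chart_dom A i')) (transition A i i')"
      using man by (simp add: smooth_manifold_def)
    then have "transition A i i' differentiable (at x)"
      by (rule smooth_on_differentiable) (use x in \<open>simp add: x_def\<close>)
    then show ?thesis using frechet_derivative_works by blast
  qed
  then have "((\<lambda>z. (transition A i i' (fst z), snd z + (s' - s))) has_derivative
      (\<lambda>v. (frechet_derivative (transition A i i') (at x) (fst v), snd v))) (at (x, s))"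
    by (auto intro!: derivative_eq_intros has_derivative_compose[of fst, OF has_derivative_fst[OF has_derivative_ident], unfolded o_def])
  then have tZ: "(transition Z (i, a) (i', a') has_derivative
      (\<lambda>v. (frechet_derivative (transition A i i') (at x) (fst v), snd v))) (at (x, s))"
    by (rule has_derivative_transform_within_open[of _ _ _ _ "img A i \<times> U"])
      (use U open_img x tr in \<open>auto simp: x_def img_def intro: open_Times\<close>)
  have "coord circle_atlas a \<zeta> = s" using coord_circle_atlas[OF ss(1)] ss(4) by simp
  then show ?thesis using frechet_derivative_at[OF tZ] by (simp add: x_def[symmetric])
qed

lemma is_form_phi: "is_form Z 3 \<phi>"
  unfolding is_form_def
proof (intro conjI allI impI ballI)
  fix I :: "'i \<times> real" and z
  obtain i a where I: "I = (i, a)" by (cases I)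
  show "alternating_map 3 (\<phi> I z)"
    unfolding alternating_map_iff_alt I
    using is_form_alt[OF is_form(1), of i "fst z"] is_form_alt[OF is_form(2), of i "fst z"]
      is_form_alt[OF is_form(3), of i "fst z"]
    using alt_wedge[OF alt_lift[OF is_form_alt[OF is_form(1), of i "fst z"]] alt_ds]
    by (auto simp: phi_apply form_apply intro!: alt_add alt_scale alt_lift alt_diff)
  show "z \<notin> img Z I \<Longrightarrow> \<phi> I z = 0" by (simp add: I phi_apply)
next
  fix I :: "'i \<times> real" and vs
  obtain i a where I: "I = (i, a)" by (cases I)
  have sm: "smooth_on (img Z (i, a)) (\<lambda>z. F i (fst z) us)" if "is_form A k F" for k F us
    unfolding img_Z
    by (rule smooth_on_fst[of _ _ "\<lambda>x. F i x us"]) (use that open_img in \<open>auto simp: is_form_def\<close>)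
  \<comment> \<open>The values of \<open>ds\<close> on fixed vectors are constants, so the component
    is a constant-coefficient combination of smooth functions of the first coordinate.\<close>
  let ?R = "\<lambda>z. c * (\<Sum>Q\<in>Pow {..<length vs}.
      ((-1) ^ card {(i, j). i \<in> Q \<and> j \<in> {..<length vs} - Q \<and> j < i} * ds (nths vs ({..<length vs} - Q))) *
        \<omega> i (fst z) (map fst (nths vs Q))) +
      (\<alpha> * \<psi>p i (fst z) (map fst vs) + (- \<beta>) * \<psi>m i (fst z) (map fst vs))"
  have "smooth_on (img Z (i, a)) ?R"
    by (intro smooth_on_add smooth_on_mult_const smooth_on_sum open_img_Z sm[OF is_form(1)] sm[OF is_form(2)]
        sm[OF is_form(3)]) auto
  moreover have "\<phi> (i, a) z vs = ?R z"
    if "z \<in> img Z (i, a)" for z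
    using that by (simp add: phi_apply form_apply wedge_def cscale_apply lift_def mult_ac)
  ultimately show "smooth_on (img Z I) (\<lambda>z. \<phi> I z vs)"
    unfolding I by (subst smooth_on_cong[OF open_img_Z, of i a _ ?R])
next
  fix I I' :: "'i \<times> real" and vs p
  assume p: "p \<in> chart_dom Z I \<inter> chart_dom Z I'"
  obtain i a where I: "I = (i, a)" by (cases I)
  obtain i' a' where I': "I' = (i', a')" by (cases I')
  obtain q \<zeta> where p_eq: "p = (q, \<zeta>)" by (cases p)
  have q: "q \<in> chart_dom A i \<inter> chart_dom A i'" and \<zeta>: "\<zeta> \<in> chart_dom circle_atlas a \<inter> chart_dom circle_atlas a'"
    using p by (auto simp: I I' p_eq prod_atlas_def chart_dom_def)
  have co: "coord Z (i, a) p = (coord A i q, coord circle_atlas a \<zeta>)" "coord Z (i', a') p = (coord A i' q, coord circle_atlas a' \<zeta>)"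
    by (simp_all add: p_eq prod_atlas_def coord_def)
  define D where "D = frechet_derivative (transition A i i') (at (coord A i q))"
  define DZ where "DZ = (\<lambda>v :: (real^6) \<times> real. (D (fst v), snd v))"
  have tr: "frechet_derivative (transition Z (i, a) (i', a')) (at (coord Z (i, a) p)) = DZ"
    using transition_Z[OF q \<zeta>] by (simp add: co DZ_def D_def)
  have img: "coord Z (i, a) p \<in> img Z (i, a)" "coord Z (i', a') p \<in> img Z (i', a')"
    using q \<zeta> unfolding co img_prod_atlas by (auto simp: img_def)
  have F: "lift (F i' (coord A i' q)) (map DZ us) = lift (F i (coord A i q)) us" if "is_form A k F" for k F us
  proof -
    have "F i (coord A i q) (map fst us) = F i' (coord A i' q) (map D (map fst us))"
      using that q unfolding is_form_def D_def by blast
    then show ?thesis by (simp add: lift_def DZ_def o_def)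
  qed
  have ds: "ds (map DZ us) = ds us" for us
    by (cases us) (auto simp: ds_def DZ_def)
  show "\<phi> I (coord Z I p) vs = \<phi> I' (coord Z I' p)
      (map (frechet_derivative (transition Z I I') (at (coord Z I p))) vs)"
    unfolding I I' tr using img
    by (simp add: phi_apply co cscale_apply form_apply lift_diff lift_scale wedge_map[of _ _ DZ]
        F[OF is_form(1)] F[OF is_form(2)] F[OF is_form(3)] ds)
qed

lemma g2_structure_phi: "g2_structure Z \<phi>"
  unfolding g2_structure_def
proof (intro conjI is_form_phi)
  show dim7: "DIM((real^6) \<times> real) = 7" by simp
  show "has_local_coframes Z (\<lambda>i y. g2_adapted (\<phi> i y))"
    unfolding has_local_coframes_def dim7
  proof (intro allI ballI)
    fix I z assume z: "z \<in> img Z I"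
    obtain i a where I: "I = (i, a)" by (cases I)
    obtain W e b where W: "open W" "fst z \<in> W" "W \<subseteq> img A i"
      and sm: "\<And>k v. k \<in> {1..6} \<Longrightarrow> smooth_on W (\<lambda>y. e y k [v])"
      and fr: "\<And>y. y \<in> W \<Longrightarrow> frame6 (e y) (b y)"
      and ad: "\<And>y. y \<in> W \<Longrightarrow> su3_adapted (\<omega> i y) (\<psi>1 i y) (\<psi>2 i y) (e y)"
      and "\<And>y. y \<in> W \<Longrightarrow> su3_metric \<omega> \<psi>p \<psi>m i y = coframe_metric (e y)"
      by (rule adapted_frames[of "fst z" i]) (use z in \<open>auto simp: I img_Z\<close>)
    let ?V = "W \<times> {a<..<a + 2 * pi}"
    let ?E = "\<lambda>z. prod_coframe c (e (fst z))"
    show "\<exists>W E. open W \<and> z \<in> W \<and> W \<subseteq> img Z I \<and> (\<forall>k\<in>{1..7}. \<forall>v. smooth_on W (\<lambda>y. E y k [v])) \<and>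
        (\<forall>y\<in>W. coframe (E y) \<and> g2_adapted (\<phi> I y) (E y))"
    proof (intro exI[of _ ?V] exI[of _ ?E] conjI ballI allI)
      show "open ?V" using W by (simp add: open_Times)
      show "z \<in> ?V" using z W by (auto simp: I img_Z)
      show "?V \<subseteq> img Z I" using W by (auto simp: I img_Z)
    next
      fix k v assume k: "k \<in> {1..7::nat}"
      show "smooth_on ?V (\<lambda>y. prod_coframe c (e (fst y)) k [v])"
      proof (cases "k = 7")
        case True
        then show ?thesis by (simp add: prod_coframe_def smooth_on_const)
      next
        case False
        then have "k \<in> {1..6}" using k by auto
        from smooth_on_fst[OF W(1) _ sm[OF this, of "fst v"], of "{a<..<a + 2 * pi}"] False
        show ?thesis by (simp add: prod_coframe_def lift_def)
      qed
    next
      fix y assume y: "y \<in> ?V"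
      then have y1: "fst y \<in> W" by auto
      interpret frame6 "e (fst y)" "b (fst y)" by (rule fr[OF y1])
      interpret Q: frame7 "prod_coframe c (e (fst y))" "prod_basis c (b (fst y))" by (rule prod_frame[OF c])
      show "coframe (prod_coframe c (e (fst y)))" by (rule Q.cofr)
      have "y \<in> img Z (i, a)" using y W by (auto simp: img_Z)
      then show "g2_adapted (\<phi> I y) (prod_coframe c (e (fst y)))"
        using prod_g2_adapted[of c] ad[OF y1] by (simp add: I phi_apply su3_adapted_def)
    qed
  qed
qed

end

section \<open>Star and exterior derivative of forms X + c Y \<and> ds on the product\<close>

context warped
begin

lemma frame_at:
  assumes "x \<in> img A i"
  obtains e b where "frame6 e b" "su3_adapted (\<omega> i x) (\<psi>1 i x) (\<psi>2 i x) e"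
    "su3_metric \<omega> \<psi>p \<psi>m i x = coframe_metric e"
  by (rule adapted_frames[OF assms]) (use that in blast)

text \<open>The expected dual 4-form; \<open>g2_star_phi\<close> identifies it with the Hodge dual
  of \<open>\<phi>\<close>.\<close>

abbreviation "\<Xi> \<equiv> (1/2) *\<^sub>F P (\<omega> \<and>\<^sub>F \<omega>) + c *\<^sub>F (P \<psi>2 \<and>\<^sub>F S)"

lemma cyl_apply:
  "(P X + c *\<^sub>F (P Y \<and>\<^sub>F S)) (i, a) z =
    (if z \<in> img Z (i, a) then lift (X i (fst z)) + wedge (lift (Y i (fst z))) (c *\<^sub>C ds) else 0)"
  by (simp add: form_apply wedge_scale_right)

lemma Xi_eq: "\<Xi> = P ((1/2) *\<^sub>F (\<omega> \<and>\<^sub>F \<omega>)) + c *\<^sub>F (P \<psi>2 \<and>\<^sub>F S)"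
  by (auto simp: fun_eq_iff[of _ "P ((1/2) *\<^sub>F (\<omega> \<and>\<^sub>F \<omega>))"] form_apply lift_scale)

lemma phi_eq: "\<phi> = P \<psi>1 + c *\<^sub>F (P \<omega> \<and>\<^sub>F S)"
  by (simp add: warped_g2_def)

lemma ext_eqI: "(\<And>i a z. F (i, a) z = G (i, a) z) \<Longrightarrow> F = G" for F G :: "('i \<times> real, (real^6) \<times> real) form"
  by (auto simp: fun_eq_iff)

text \<open>Pull-backs are set to 0 outside the chart images, so equality on the product says
  nothing about representatives there and agreement is assumed. Inside, homogeneity of the second
  parts lets the \<open>ds\<close> part be separated.\<close>

lemma cyl_eq_iff:
  assumes "\<And>i x. x \<notin> img A i \<Longrightarrow> X i x = X' i x" "\<And>i x. x \<notin> img A i \<Longrightarrow> Y i x = Y' i x"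
    and "\<And>i x. homog k (Y i x)" "\<And>i x. homog k (Y' i x)"
  shows "P X + c *\<^sub>F (P Y \<and>\<^sub>F S) = P X' + c *\<^sub>F (P Y' \<and>\<^sub>F S) \<longleftrightarrow> X = X' \<and> Y = Y'"
proof
  assume eq: "P X + c *\<^sub>F (P Y \<and>\<^sub>F S) = P X' + c *\<^sub>F (P Y' \<and>\<^sub>F S)"
  have "X i x = X' i x \<and> Y i x = Y' i x" for i x
  proof (cases "x \<in> img A i")
    case True
    \<comment> \<open>The value \<open>pi\<close> lies in the interval from 0 to
      \<open>2 * pi\<close>, the image of the circle chart with index 0. The components do not
      depend on the circle coordinate, so a single point suffices.\<close>
    let ?z = "(x, pi) :: (real^6) \<times> real"
    have "?z \<in> img Z (i, 0)" using True by (simp add: img_Z)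
    then have "lift (X i x) + wedge (lift (Y i x)) (c *\<^sub>C ds) = lift (X' i x) + wedge (lift (Y' i x)) (c *\<^sub>C (ds :: ((real^6) \<times> real) list \<Rightarrow> real))"
      using fun_cong[OF fun_cong[OF eq, of "(i, 0)"], of ?z] unfolding cyl_apply by simp
    then have "lift (X i x - X' i x) + wedge (lift (c *\<^sub>C (Y i x - Y' i x))) ds = (0 :: ((real^6) \<times> real) list \<Rightarrow> real)"
      by (simp add: lift_diff lift_scale wedge_scale_left wedge_scale_right wedge_diff_left cscale_diff algebra_simps)
    from lift_wedge_ds_eq_0[OF homog_scale[OF homog_diff[OF assms(3,4)]] this]
    have "X i x - X' i x = 0" "c *\<^sub>C (Y i x - Y' i x) = 0" .
    then show ?thesis using c by (auto simp: cscale_def fun_eq_iff)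
  qed (use assms in auto)
  then show "X = X' \<and> Y = Y'" by (auto simp: fun_eq_iff)
qed auto

text \<open>\<open>c\<close> is a constant and \<open>ds\<close> has constant coefficients, so in
  the Leibniz rule only the pulled-back factors are differentiated.\<close>

lemma ext_d_cyl:
  assumes "\<And>i x. x \<in> img A i \<Longrightarrow> cov_diff (X i) x" "\<And>i x. x \<in> img A i \<Longrightarrow> cov_diff (Y i) x"
  shows "ext_d Z (P X + c *\<^sub>F (P Y \<and>\<^sub>F S)) = P (ext_d A X) + c *\<^sub>F (P (ext_d A Y) \<and>\<^sub>F S)"
proof (rule ext_eqI)
  fix i a z
  show "ext_d Z (P X + c *\<^sub>F (P Y \<and>\<^sub>F S)) (i, a) z = (P (ext_d A X) + c *\<^sub>F (P (ext_d A Y) \<and>\<^sub>F S)) (i, a) z"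
  proof (cases "z \<in> img Z (i, a)")
    case True
    then have x: "fst z \<in> img A i" by (auto simp: img_Z)
    note d = assms[OF x]
    have "ext_d Z (P X + c *\<^sub>F (P Y \<and>\<^sub>F S)) (i, a) z = dext ((P X + c *\<^sub>F (P Y \<and>\<^sub>F S)) (i, a)) z"
      using True by (simp add: ext_d_eq)
    also have "\<dots> = dext (\<lambda>z. lift (X i (fst z)) + wedge (lift (Y i (fst z))) (c *\<^sub>C ds)) z"
      by (rule dext_cong[OF open_img_Z True], subst cyl_apply) simp
    also have "\<dots> = lift (dext (X i) (fst z)) + wedge (lift (dext (Y i) (fst z))) (c *\<^sub>C ds)"
      by (simp add: dext_add dext_wedge dext_lift d cov_diff_lift cov_diff_wedge cov_diff_const)
    finally show ?thesis
      using True x by (simp only: cyl_apply[of "ext_d A X"] ext_d_eq[of A] if_True)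
  next
    case False
    then show ?thesis by (simp only: cyl_apply[of "ext_d A X"] ext_d_eq[of Z] if_False)
  qed
qed

text \<open>The star interchanges the parts with and without \<open>ds\<close>; with
  \<open>c *\<^sub>C ds\<close> as unit covector the factor \<open>c\<close> is kept in its
  place.\<close>

lemma g2_star_cyl:
  assumes X: "\<And>i x. alt (Suc k) (X i x)" and Y: "\<And>i x. alt k (Y i x)" and k: "k \<le> 5"
  shows "g2_star \<phi> (P X + c *\<^sub>F (P Y \<and>\<^sub>F S)) =
    P ((-1) ^ (6 - k) *\<^sub>F su3_star \<omega> \<psi>p \<psi>m Y) + c *\<^sub>F (P (su3_star \<omega> \<psi>p \<psi>m X) \<and>\<^sub>F S)"
proof (rule ext_eqI)
  fix i a z
  show "g2_star \<phi> (P X + c *\<^sub>F (P Y \<and>\<^sub>F S)) (i, a) z =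
    (P ((-1) ^ (6 - k) *\<^sub>F su3_star \<omega> \<psi>p \<psi>m Y) + c *\<^sub>F (P (su3_star \<omega> \<psi>p \<psi>m X) \<and>\<^sub>F S)) (i, a) z"
  proof (cases "z \<in> img Z (i, a)")
    case True
    then have x: "fst z \<in> img A i" by (auto simp: img_Z)
    obtain e b where e: "frame6 e b" "su3_adapted (\<omega> i (fst z)) (\<psi>1 i (fst z)) (\<psi>2 i (fst z)) e"
      "su3_metric \<omega> \<psi>p \<psi>m i (fst z) = coframe_metric e" by (rule frame_at[OF x])
    interpret frame6 e b by (rule e(1))
    show ?thesis
      unfolding g2_star_eq[OF e(1,2) True refl] cyl_apply
      using True star7_lift[OF c X] star7_lift_ds[OF c Y] k
      by (simp add: hodge_add su3_star_eq[OF e] form_apply lift_scale add.commute)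
  next
    case False
    have "g2_star \<phi> (P X + c *\<^sub>F (P Y \<and>\<^sub>F S)) (i, a) z = hodge (g2_metric \<phi> (i, a) z) (g2_volume \<phi> (i, a) z) 0"
      using False cyl_apply[of X Y i a z] by (simp add: g2_star_def form_hodge_def)
    then show ?thesis using False cyl_apply[of _ _ i a z] by simp
  qed
qed

lemma form_eqI:
  fixes F G :: "('i, real^6) form"
  assumes "\<And>i x. x \<notin> img A i \<Longrightarrow> F i x = G i x"
    and "\<And>i x e b. x \<in> img A i \<Longrightarrow> frame6 e b \<Longrightarrow> su3_adapted (\<omega> i x) (\<psi>1 i x) (\<psi>2 i x) e \<Longrightarrow>
      su3_metric \<omega> \<psi>p \<psi>m i x = coframe_metric e \<Longrightarrow> F i x = G i x"
  shows "F = G"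
proof (intro ext)
  fix i x vs
  have "F i x = G i x"
  proof (cases "x \<in> img A i")
    case True
    then show ?thesis by (rule frame_at) (rule assms(2)[OF True])
  qed (rule assms(1))
  then show "F i x vs = G i x vs" by simp
qed

lemma outside: "x \<notin> img A i \<Longrightarrow> \<omega> i x = 0" "x \<notin> img A i \<Longrightarrow> \<psi>p i x = 0" "x \<notin> img A i \<Longrightarrow> \<psi>m i x = 0"
  by (simp_all add: is_form_outside[OF is_form(1)] is_form_outside[OF is_form(2)] is_form_outside[OF is_form(3)])

lemma su3_star_outside: "X i x = 0 \<Longrightarrow> su3_star \<omega> \<psi>p \<psi>m X i x = 0"
  by (simp add: su3_star_def form_hodge_def)

lemma su3_star_forms:
  "su3_star \<omega> \<psi>p \<psi>m \<omega> = (1/2) *\<^sub>F (\<omega> \<and>\<^sub>F \<omega>)"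
  "su3_star \<omega> \<psi>p \<psi>m (\<omega> \<and>\<^sub>F \<omega>) = 2 *\<^sub>F \<omega>"
  "su3_star \<omega> \<psi>p \<psi>m \<psi>1 = \<psi>2"
  "su3_star \<omega> \<psi>p \<psi>m \<psi>2 = - \<psi>1"
proof -
  have "su3_star \<omega> \<psi>p \<psi>m \<omega> i x = ((1/2) *\<^sub>F (\<omega> \<and>\<^sub>F \<omega>)) i x \<and>
      su3_star \<omega> \<psi>p \<psi>m (\<omega> \<and>\<^sub>F \<omega>) i x = (2 *\<^sub>F \<omega>) i x \<and>
      su3_star \<omega> \<psi>p \<psi>m \<psi>1 i x = \<psi>2 i x \<and> su3_star \<omega> \<psi>p \<psi>m \<psi>2 i x = - (\<psi>1 i x)" for i x
  proof (cases "x \<in> img A i")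
    case True
    then show ?thesis
    proof (rule frame_at)
      fix e b assume fr: "frame6 e b" and a: "su3_adapted (\<omega> i x) (\<psi>1 i x) (\<psi>2 i x) e"
        "su3_metric \<omega> \<psi>p \<psi>m i x = coframe_metric e"
      interpret frame6 e b by (rule fr)
      have "\<omega> i x = w" "\<psi>1 i x = p" "\<psi>2 i x = m"
        using a(1) by (auto simp only: su3_adapted_def)
      then show ?thesis
        unfolding su3_star_eq[OF fr a] form_scale_apply form_wedge_apply
        by (simp only: star_w star_ww star_p star_m simp_thms)
    qed
  qed (simp add: su3_star_outside outside form_apply)
  then show "su3_star \<omega> \<psi>p \<psi>m \<omega> = (1/2) *\<^sub>F (\<omega> \<and>\<^sub>F \<omega>)"
    "su3_star \<omega> \<psi>p \<psi>m (\<omega> \<and>\<^sub>F \<omega>) = 2 *\<^sub>F \<omega>"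
    "su3_star \<omega> \<psi>p \<psi>m \<psi>1 = \<psi>2"
    "su3_star \<omega> \<psi>p \<psi>m \<psi>2 = - \<psi>1"
    by (intro ext; simp only: uminus_apply)+
qed

lemma su3_star_star:
  assumes "\<And>i x. alt 2 (X i x)" and out: "\<And>i x. x \<notin> img A i \<Longrightarrow> X i x = 0"
  shows "su3_star \<omega> \<psi>p \<psi>m (su3_star \<omega> \<psi>p \<psi>m X) = X"
proof (rule form_eqI)
  fix i x e b assume "frame6 e b" and a: "su3_adapted (\<omega> i x) (\<psi>1 i x) (\<psi>2 i x) e"
    "su3_metric \<omega> \<psi>p \<psi>m i x = coframe_metric e"
  interpret frame6 e b by fact
  show "su3_star \<omega> \<psi>p \<psi>m (su3_star \<omega> \<psi>p \<psi>m X) i x = X i x"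
    unfolding su3_star_eq[OF \<open>frame6 e b\<close> a] by (rule star_star[OF assms(1)])
qed (simp add: su3_star_outside out)

lemma su3_star_cov_diff:
  assumes X: "is_form A k X" and "k \<le> 6" and x: "x \<in> img A i"
  shows "cov_diff (su3_star \<omega> \<psi>p \<psi>m X i) x"
proof (rule adapted_frames[OF x])
  fix W e b assume W: "open W" "x \<in> W" "W \<subseteq> img A i"
    and sm: "\<And>k v. k \<in> {1..6} \<Longrightarrow> smooth_on W (\<lambda>y. e y k [v])"
    and fr: "\<And>y. y \<in> W \<Longrightarrow> frame6 (e y) (b y)"
    and ad: "\<And>y. y \<in> W \<Longrightarrow> su3_adapted (\<omega> i y) (\<psi>1 i y) (\<psi>2 i y) (e y)"
    "\<And>y. y \<in> W \<Longrightarrow> su3_metric \<omega> \<psi>p \<psi>m i y = coframe_metric (e y)"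
  have e: "cov_diff (\<lambda>y. e y k) x" if k: "k \<in> {1..6}" for k
    unfolding cov_diff_def
  proof
    fix us
    \<comment> \<open>Smoothness of the coframe is given on single vectors; on lists of any other
      length the covectors vanish throughout \<open>W\<close>.\<close>
    show "(\<lambda>y. e y k us) differentiable (at x)"
    proof (cases "length us = 1")
      case True
      then obtain v where "us = [v]" by (auto simp: One_nat_def length_Suc_conv)
      then show ?thesis using smooth_on_differentiable[OF sm[OF k] W(2)] by simp
    next
      case False
      have "e y k us = 0" if "y \<in> W" for y
      proof -
        interpret frame6 "e y" "b y" by (rule fr[OF that])
        show ?thesis using alt_homog[OF e_alt[of k]] k False by (simp add: homog_def)
      qed
      then have "((\<lambda>y. e y k us) has_derivative (\<lambda>v. 0)) (at x)"
        by (intro has_derivative_transform_within_open[OF has_derivative_const W(1,2)]) simp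
      then show ?thesis by (auto simp: differentiable_def)
    qed
  qed
  have "cov_diff (\<lambda>y. hodge (coframe_metric (e y)) (coframe_monom (e y) [1,2,3,4,5,6]) (X i y)) x"
    by (rule cov_diff_hodge[OF W(1,2) fr e is_form_alt[OF X] is_form_cov_diff[OF X x] \<open>k \<le> 6\<close>])
  then have "((\<lambda>y. hodge (coframe_metric (e y)) (coframe_monom (e y) [1,2,3,4,5,6]) (X i y) us) has_derivative
      (\<lambda>v. dird v (\<lambda>y. hodge (coframe_metric (e y)) (coframe_monom (e y) [1,2,3,4,5,6]) (X i y)) x us)) (at x)" for us
    by (rule cov_diff_has_derivative)
  then have "((\<lambda>y. su3_star \<omega> \<psi>p \<psi>m X i y us) has_derivative
      (\<lambda>v. dird v (\<lambda>y. hodge (coframe_metric (e y)) (coframe_monom (e y) [1,2,3,4,5,6]) (X i y)) x us)) (at x)" for us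
    by (rule has_derivative_transform_within_open[OF _ W(1,2)]) (simp add: su3_star_eq[OF fr ad])
  then show ?thesis unfolding cov_diff_def differentiable_def by blast
qed

lemma su3_star_scale: "su3_star \<omega> \<psi>p \<psi>m (r *\<^sub>F X) = r *\<^sub>F su3_star \<omega> \<psi>p \<psi>m X"
  by (intro ext) (simp add: su3_star_def form_hodge_def form_scale_apply hodge_cscale)

lemma su3_star_add: "su3_star \<omega> \<psi>p \<psi>m (X + Y) = su3_star \<omega> \<psi>p \<psi>m X + su3_star \<omega> \<psi>p \<psi>m Y"
  by (intro ext) (simp add: su3_star_def form_hodge_def hodge_add)

lemma su3_star_minus: "su3_star \<omega> \<psi>p \<psi>m (- X) = - su3_star \<omega> \<psi>p \<psi>m X"
proof (intro ext)
  fix i x vs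
  have "(- X) i x = - (X i x)" by (auto simp: fun_eq_iff)
  then show "su3_star \<omega> \<psi>p \<psi>m (- X) i x vs = (- su3_star \<omega> \<psi>p \<psi>m X) i x vs"
    by (simp only: su3_star_def form_hodge_def hodge_minus uminus_apply)
qed

lemma su3_star_diff: "su3_star \<omega> \<psi>p \<psi>m (X - Y) = su3_star \<omega> \<psi>p \<psi>m X - su3_star \<omega> \<psi>p \<psi>m Y"
  by (metis add_uminus_conv_diff su3_star_add su3_star_minus)

lemma su3_star_mult:
  assumes "\<And>i x. alt 0 (a i x)"
  shows "su3_star \<omega> \<psi>p \<psi>m (a \<and>\<^sub>F X) = a \<and>\<^sub>F su3_star \<omega> \<psi>p \<psi>m X"
proof (intro ext)
  fix i x vs
  have "homog 0 (a i x)" using assms[of i x] by simp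
  then show "su3_star \<omega> \<psi>p \<psi>m (a \<and>\<^sub>F X) i x vs = (a \<and>\<^sub>F su3_star \<omega> \<psi>p \<psi>m X) i x vs"
    by (simp add: su3_star_def form_hodge_def form_wedge_apply wedge_homog_0 hodge_cscale)
qed

lemma alt_forms: "alt 2 (\<omega> i x)" "alt 3 (\<psi>p i x)" "alt 3 (\<psi>m i x)" "alt 3 (\<psi>1 i x)" "alt 3 (\<psi>2 i x)"
    "alt 4 ((\<omega> \<and>\<^sub>F \<omega>) i x)" "alt 4 (((1/2) *\<^sub>F (\<omega> \<and>\<^sub>F \<omega>)) i x)"
proof -
  show f: "alt 2 (\<omega> i x)" "alt 3 (\<psi>p i x)" "alt 3 (\<psi>m i x)"
    by (simp_all add: is_form_alt[OF is_form(1)] is_form_alt[OF is_form(2)] is_form_alt[OF is_form(3)])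
  then show "alt 3 (\<psi>1 i x)" "alt 3 (\<psi>2 i x)" "alt 4 ((\<omega> \<and>\<^sub>F \<omega>) i x)" "alt 4 (((1/2) *\<^sub>F (\<omega> \<and>\<^sub>F \<omega>)) i x)"
    using alt_wedge[OF f(1) f(1)] by (auto simp: form_apply intro!: alt_scale alt_add alt_diff)
qed

lemma g2_star_phi: "g2_star \<phi> \<phi> = \<Xi>"
proof -
  have "g2_star \<phi> (P \<psi>1 + c *\<^sub>F (P \<omega> \<and>\<^sub>F S)) =
      P ((-1) ^ (6 - 2) *\<^sub>F su3_star \<omega> \<psi>p \<psi>m \<omega>) + c *\<^sub>F (P (su3_star \<omega> \<psi>p \<psi>m \<psi>1) \<and>\<^sub>F S)"
    by (rule g2_star_cyl) (use alt_forms in \<open>simp_all add: numeral_eq_Suc\<close>)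
  moreover have "(-1) ^ (6 - 2) *\<^sub>F X = X" for X :: "('i, real^6) form"
    by (simp add: form_scale_def)
  ultimately show ?thesis
    unfolding phi_eq[symmetric] Xi_eq su3_star_forms by simp
qed

lemma g2_star_Xi: "g2_star \<phi> \<Xi> = \<phi>"
proof -
  have "g2_star \<phi> (P ((1/2) *\<^sub>F (\<omega> \<and>\<^sub>F \<omega>)) + c *\<^sub>F (P \<psi>2 \<and>\<^sub>F S)) =
      P ((-1) ^ (6 - 3) *\<^sub>F su3_star \<omega> \<psi>p \<psi>m \<psi>2) + c *\<^sub>F (P (su3_star \<omega> \<psi>p \<psi>m ((1/2) *\<^sub>F (\<omega> \<and>\<^sub>F \<omega>))) \<and>\<^sub>F S)"
    by (rule g2_star_cyl) (use alt_forms in \<open>simp_all add: numeral_eq_Suc\<close>)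
  moreover have "(-1) ^ (6 - 3) *\<^sub>F (- X) = X" "(1/2) *\<^sub>F (2 *\<^sub>F X) = X" for X :: "('i, real^6) form"
    by (simp_all add: form_scale_def fun_eq_iff)
  ultimately show ?thesis
    unfolding phi_eq Xi_eq su3_star_scale su3_star_forms by (simp only:)
qed

end

section \<open>Torsion forms of coclosed warped structures\<close>

lemma cov_diff_form:
  "cov_diff (F i) x \<Longrightarrow> cov_diff ((r *\<^sub>F F) i) x"
  "cov_diff (F i) x \<Longrightarrow> cov_diff (G i) x \<Longrightarrow> cov_diff ((F + G) i) x"
  "cov_diff (F i) x \<Longrightarrow> cov_diff (G i) x \<Longrightarrow> cov_diff ((F - G) i) x"
  "cov_diff (F i) x \<Longrightarrow> cov_diff (G i) x \<Longrightarrow> cov_diff ((F \<and>\<^sub>F G) i) x"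
  using cov_diff_scale[of "F i" x r] cov_diff_add[of "F i" x "G i"] cov_diff_diff[of "F i" x "G i"]
    cov_diff_wedge[of "F i" x "G i"]
  by (simp_all add: form_scale_def cscale_def form_wedge_def plus_fun_def fun_diff_def)

lemma ext_d_form:
  assumes "x \<in> img A i" "cov_diff (F i) x"
  shows "ext_d A (r *\<^sub>F F) i x = r *\<^sub>C ext_d A F i x"
    and "cov_diff (G i) x \<Longrightarrow> ext_d A (F + G) i x = ext_d A F i x + ext_d A G i x"
    and "cov_diff (G i) x \<Longrightarrow> ext_d A (F - G) i x = ext_d A F i x - ext_d A G i x"
    and "cov_diff (G i) x \<Longrightarrow> ext_d A (F \<and>\<^sub>F G) i x = wedge (ext_d A F i x) (G i x) + wedge (twist (F i x)) (ext_d A G i x)"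
  using assms dext_scale[of "F i" x r] dext_add[of "F i" x "G i"] dext_diff[of "F i" x "G i"]
    dext_wedge[of "F i" x "G i"]
  by (simp_all add: ext_d_eq form_scale_def cscale_def form_wedge_def plus_fun_def fun_diff_def)

lemma ext_d_outside: "x \<notin> img A i \<Longrightarrow> ext_d A F i x = 0"
  by (simp add: ext_d_eq)

lemma homog_ext_d: "(\<And>y. homog k (F i y)) \<Longrightarrow> homog (Suc k) (ext_d A F i x)"
  by (cases "x \<in> img A i") (simp_all add: ext_d_eq homog_dext ext_d_outside)

lemma ext_d_zero [simp]: "ext_d A 0 = 0"
  by (intro ext) (simp add: ext_d_eq dext_def dird_def)

lemma form_hodge_zero: "form_hodge g vol 0 = 0"
  by (intro ext) (simp add: form_hodge_def)

lemma form_scale_zero: "r *\<^sub>F 0 = 0"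
  by (simp add: form_scale_def fun_eq_iff)

lemma form_scale_one: "1 *\<^sub>F F = F"
  by (simp add: form_scale_def)

locale coclosed_warped = warped M A \<alpha> \<beta> c \<omega> \<psi>p \<psi>m
  for M :: "'m::{t2_space, second_countable_topology} set" and A :: "('i, 'm, real^6) atlas"
    and \<alpha> \<beta> c :: real and \<omega> \<psi>p \<psi>m :: "('i, real^6) form" +
  fixes \<sigma>0 \<pi>0 \<pi>1 \<nu>1 \<pi>2 \<sigma>2 \<nu>3 :: "('i, real^6) form"
  assumes torsion: "su3_torsion_forms A \<omega> \<psi>p \<psi>m \<sigma>0 \<pi>0 \<pi>1 \<nu>1 \<pi>2 \<sigma>2 \<nu>3"
    and coclosed: "g2_coclosed Z \<phi>"
begin

lemma torsion_forms: "is_form A 0 \<sigma>0" "is_form A 0 \<pi>0" "is_form A 1 \<pi>1" "is_form A 1 \<nu>1"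
    "is_form A 2 \<pi>2" "is_form A 2 \<sigma>2" "is_form A 3 \<nu>3"
  using torsion by (simp_all add: su3_torsion_forms_def Omega2_8_def Omega3_12_def)

lemma torsion_outside:
  assumes "x \<notin> img A i"
  shows "\<sigma>0 i x = 0" "\<pi>0 i x = 0" "\<pi>1 i x = 0" "\<nu>1 i x = 0" "\<pi>2 i x = 0" "\<sigma>2 i x = 0" "\<nu>3 i x = 0"
  using torsion_forms[THEN is_form_outside, OF assms] by simp_all

lemma torsion_alt:
  "alt 0 (\<sigma>0 i x)" "alt 0 (\<pi>0 i x)" "alt 1 (\<pi>1 i x)" "alt 1 (\<nu>1 i x)" "alt 2 (\<pi>2 i x)" "alt 2 (\<sigma>2 i x)" "alt 3 (\<nu>3 i x)"
  using torsion_forms[THEN is_form_alt, of i x] by simp_all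

lemma diff:
  assumes "x \<in> img A i"
  shows "cov_diff (\<omega> i) x" "cov_diff (\<psi>p i) x" "cov_diff (\<psi>m i) x"
    "cov_diff (\<sigma>0 i) x" "cov_diff (\<pi>0 i) x" "cov_diff (\<pi>1 i) x" "cov_diff (\<nu>1 i) x" "cov_diff (\<pi>2 i) x"
    "cov_diff (\<sigma>2 i) x" "cov_diff (\<nu>3 i) x"
  using is_form[THEN is_form_cov_diff, OF assms] torsion_forms[THEN is_form_cov_diff, OF assms] by simp_all

lemma structure_equations:
  "ext_d A \<omega> i x = (-3/2) *\<^sub>C wedge (\<sigma>0 i x) (\<psi>p i x) + (3/2) *\<^sub>C wedge (\<pi>0 i x) (\<psi>m i x) +
    wedge (\<nu>1 i x) (\<omega> i x) + \<nu>3 i x"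
  "ext_d A \<psi>p i x = wedge (\<pi>0 i x) (wedge (\<omega> i x) (\<omega> i x)) + wedge (\<pi>1 i x) (\<psi>p i x) - wedge (\<pi>2 i x) (\<omega> i x)"
  "ext_d A \<psi>m i x = wedge (\<sigma>0 i x) (wedge (\<omega> i x) (\<omega> i x)) + wedge (\<pi>1 i x) (\<psi>m i x) - wedge (\<sigma>2 i x) (\<omega> i x)"
  using torsion by (simp_all add: su3_torsion_forms_def form_apply)

lemma torsion_star:
  "su3_star \<omega> \<psi>p \<psi>m \<pi>2 = - (\<pi>2 \<and>\<^sub>F \<omega>)" "su3_star \<omega> \<psi>p \<psi>m \<sigma>2 = - (\<sigma>2 \<and>\<^sub>F \<omega>)" "wedge (\<nu>3 i x) (\<omega> i x) = 0"
proof -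
  show "su3_star \<omega> \<psi>p \<psi>m \<pi>2 = - (\<pi>2 \<and>\<^sub>F \<omega>)" "su3_star \<omega> \<psi>p \<psi>m \<sigma>2 = - (\<sigma>2 \<and>\<^sub>F \<omega>)"
    using torsion by (simp_all add: su3_torsion_forms_def Omega2_8_def)
  have "\<nu>3 \<and>\<^sub>F \<omega> = 0" using torsion by (simp add: su3_torsion_forms_def Omega3_12_def)
  from fun_cong[OF fun_cong[OF this, of i], of x] show "wedge (\<nu>3 i x) (\<omega> i x) = 0"
    by (simp add: form_wedge_apply)
qed

lemma ext_d_Xi: "ext_d Z \<Xi> = 0"
  using coclosed by (simp add: g2_coclosed_def g2_star_phi)

text \<open>The two parts of the derivative of \<open>\<Xi>\<close> vanish separately, because a
  form on the product determines its part without \<open>ds\<close> and its part with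
  \<open>ds\<close>.\<close>

lemma ext_d_dual:
  "ext_d A ((1/2) *\<^sub>F (\<omega> \<and>\<^sub>F \<omega>)) = 0" "ext_d A \<psi>2 = 0"
proof -
  have d: "ext_d Z (P ((1/2) *\<^sub>F (\<omega> \<and>\<^sub>F \<omega>)) + c *\<^sub>F (P \<psi>2 \<and>\<^sub>F S)) =
      P (ext_d A ((1/2) *\<^sub>F (\<omega> \<and>\<^sub>F \<omega>))) + c *\<^sub>F (P (ext_d A \<psi>2) \<and>\<^sub>F S)"
    by (intro ext_d_cyl cov_diff_form diff)
  have 0: "P 0 + c *\<^sub>F (P 0 \<and>\<^sub>F S) = 0"
    by (rule ext_eqI) (subst cyl_apply, simp)
  have "homog 4 (ext_d A \<psi>2 i x)" for i x
    using homog_ext_d[of 3 \<psi>2 i A x] alt_homog[OF alt_forms(5)] by simp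
  then have "P (ext_d A ((1/2) *\<^sub>F (\<omega> \<and>\<^sub>F \<omega>))) + c *\<^sub>F (P (ext_d A \<psi>2) \<and>\<^sub>F S) = P 0 + c *\<^sub>F (P 0 \<and>\<^sub>F S) \<longleftrightarrow>
      ext_d A ((1/2) *\<^sub>F (\<omega> \<and>\<^sub>F \<omega>)) = 0 \<and> ext_d A \<psi>2 = 0"
    by (intro cyl_eq_iff) (simp_all add: ext_d_outside)
  then show "ext_d A ((1/2) *\<^sub>F (\<omega> \<and>\<^sub>F \<omega>)) = 0" "ext_d A \<psi>2 = 0"
    using ext_d_Xi d unfolding Xi_eq 0 by simp_all
qed

lemma psi_rotate: "\<psi>p i x = \<alpha> *\<^sub>C \<psi>1 i x + \<beta> *\<^sub>C \<psi>2 i x" "\<psi>m i x = \<alpha> *\<^sub>C \<psi>2 i x - \<beta> *\<^sub>C \<psi>1 i x"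
proof -
  have 1: "\<alpha> * \<alpha> + \<beta> * \<beta> = 1" using ab by (simp add: power2_eq_square)
  show "\<psi>p i x = \<alpha> *\<^sub>C \<psi>1 i x + \<beta> *\<^sub>C \<psi>2 i x"
  proof
    fix vs
    have "(\<alpha> *\<^sub>C \<psi>1 i x + \<beta> *\<^sub>C \<psi>2 i x) vs = (\<alpha> * \<alpha> + \<beta> * \<beta>) * \<psi>p i x vs"
      by (simp add: form_apply cscale_apply algebra_simps)
    then show "\<psi>p i x vs = (\<alpha> *\<^sub>C \<psi>1 i x + \<beta> *\<^sub>C \<psi>2 i x) vs" by (simp add: 1)
  qed
  show "\<psi>m i x = \<alpha> *\<^sub>C \<psi>2 i x - \<beta> *\<^sub>C \<psi>1 i x"
  proof
    fix vs
    have "(\<alpha> *\<^sub>C \<psi>2 i x - \<beta> *\<^sub>C \<psi>1 i x) vs = (\<alpha> * \<alpha> + \<beta> * \<beta>) * \<psi>m i x vs"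
      by (simp add: form_apply cscale_apply algebra_simps)
    then show "\<psi>m i x vs = (\<alpha> *\<^sub>C \<psi>2 i x - \<beta> *\<^sub>C \<psi>1 i x) vs" by (simp add: 1)
  qed
qed

lemma psi_wedge_omega: "wedge (\<psi>p i x) (\<omega> i x) = 0" "wedge (\<psi>m i x) (\<omega> i x) = 0"
proof -
  have "wedge (\<omega> i x) (\<psi>1 i x) = 0 \<and> wedge (\<omega> i x) (\<psi>2 i x) = 0"
  proof (cases "x \<in> img A i")
    case True
    then show ?thesis
    proof (rule frame_at)
      fix e b assume "frame6 e b" and a: "su3_adapted (\<omega> i x) (\<psi>1 i x) (\<psi>2 i x) e"
      interpret frame6 e b by fact
      have "\<omega> i x = w" "\<psi>1 i x = p" "\<psi>2 i x = m"
        using a by (auto simp only: su3_adapted_def)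
      then show ?thesis using w_p w_m by (simp only:)
    qed
  qed (simp add: outside)
  moreover have "wedge (\<psi>1 i x) (\<omega> i x) = wedge (\<omega> i x) (\<psi>1 i x)" "wedge (\<psi>2 i x) (\<omega> i x) = wedge (\<omega> i x) (\<psi>2 i x)"
    using wedge_commute[OF alt_homog[OF alt_forms(4)] alt_homog[OF alt_forms(1)], of i x i x]
      wedge_commute[OF alt_homog[OF alt_forms(5)] alt_homog[OF alt_forms(1)], of i x i x] by simp_all
  ultimately have "wedge (\<psi>1 i x) (\<omega> i x) = 0" "wedge (\<psi>2 i x) (\<omega> i x) = 0"
    by (simp_all only:)
  then show "wedge (\<psi>p i x) (\<omega> i x) = 0" "wedge (\<psi>m i x) (\<omega> i x) = 0"
    unfolding psi_rotate[of i x] wedge_linear by simp_all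
qed

text \<open>In \<open>ext_d A \<omega> \<and>\<^sub>F \<omega>\<close>, which is the derivative of
  half the square of \<open>\<omega>\<close> and therefore 0, the terms with \<open>\<psi>p\<close>,
  \<open>\<psi>m\<close> and \<open>\<nu>3\<close> drop out. What is left is the Lefschetz image of
  \<open>\<nu>1\<close>.\<close>

lemma nu1_eq_0: "\<nu>1 = 0"
proof (rule form_eqI)
  fix i x e b assume x: "x \<in> img A i" and "frame6 e b" and a: "su3_adapted (\<omega> i x) (\<psi>1 i x) (\<psi>2 i x) e"
  interpret frame6 e b by fact
  have w: "\<omega> i x = w" using a by (auto simp only: su3_adapted_def)
  have h: "homog 3 (ext_d A \<omega> i x)"
    using homog_ext_d[of 2 \<omega> i A x] alt_homog[OF alt_forms(1)] by simp
  have "wedge (\<omega> i x) (ext_d A \<omega> i x) = wedge (ext_d A \<omega> i x) (\<omega> i x)"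
    using wedge_commute[OF alt_homog[OF alt_forms(1)] h, of i x] by simp
  moreover have "twist (\<omega> i x) = \<omega> i x"
    using homog_twist[OF alt_homog[OF alt_forms(1)], of i x] by simp
  ultimately have "ext_d A ((1/2) *\<^sub>F (\<omega> \<and>\<^sub>F \<omega>)) i x = wedge (ext_d A \<omega> i x) (\<omega> i x)"
    by (simp add: ext_d_form x diff[OF x] cov_diff_form) (auto simp: cscale_def fun_eq_iff)
  then have 0: "wedge (ext_d A \<omega> i x) (\<omega> i x) = 0"
    unfolding ext_d_dual by simp
  have "wedge (ext_d A \<omega> i x) (\<omega> i x) = wedge (\<nu>1 i x) (wedge (\<omega> i x) (\<omega> i x))"
    unfolding structure_equations by (simp add: wedge_linear wedge_assoc psi_wedge_omega torsion_star)
  with 0 show "\<nu>1 i x = 0 i x"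
    using wedge_ww_eq_0[OF torsion_alt(4)[of i x]] by (simp add: w)
qed (simp add: torsion_outside)

text \<open>Combining the structure equations with coefficients \<open>\<beta>\<close> and
  \<open>\<alpha>\<close> writes \<open>ext_d A \<psi>2 = 0\<close> as a sum of three components of
  different type, whose coefficients are exactly the forms claimed to vanish.\<close>

lemma torsion_relations: "\<alpha> *\<^sub>F \<sigma>0 + \<beta> *\<^sub>F \<pi>0 = 0" "\<pi>1 = 0" "\<alpha> *\<^sub>F \<sigma>2 + \<beta> *\<^sub>F \<pi>2 = 0"
proof -
  have *: "(\<alpha> *\<^sub>F \<sigma>0 + \<beta> *\<^sub>F \<pi>0) i x = 0 \<and> \<pi>1 i x = 0 \<and> (\<alpha> *\<^sub>F \<sigma>2 + \<beta> *\<^sub>F \<pi>2) i x = 0"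
    if x: "x \<in> img A i" for i x
  proof (rule frame_at[OF x])
    fix e b assume fr: "frame6 e b" and a: "su3_adapted (\<omega> i x) (\<psi>1 i x) (\<psi>2 i x) e"
      and g: "su3_metric \<omega> \<psi>p \<psi>m i x = coframe_metric e"
    interpret frame6 e b by (rule fr)
    have w: "\<omega> i x = w" and m: "\<psi>2 i x = m" using a by (auto simp only: su3_adapted_def)
    define s0 where "s0 = (\<alpha> *\<^sub>F \<sigma>0 + \<beta> *\<^sub>F \<pi>0) i x"
    define s where "s = (\<alpha> *\<^sub>F \<sigma>2 + \<beta> *\<^sub>F \<pi>2) i x"
    have 1: "alt 0 s0" "alt 1 (\<pi>1 i x)" "alt 2 s"
      using torsion_alt[of i x] alt_add[of 0 "\<alpha> *\<^sub>C \<sigma>0 i x" "\<beta> *\<^sub>C \<pi>0 i x"] alt_scale[of 0]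
      by (auto simp: s0_def s_def form_apply intro!: alt_add alt_scale simp del: alt.simps)
    have "star s = su3_star \<omega> \<psi>p \<psi>m (\<alpha> *\<^sub>F \<sigma>2 + \<beta> *\<^sub>F \<pi>2) i x"
      by (simp only: su3_star_eq[OF fr a g] s_def)
    also have "\<dots> = - wedge s w"
      unfolding su3_star_add su3_star_scale torsion_star
      by (rule ext) (simp add: form_apply s_def w wedge_linear cscale_apply algebra_simps)
    finally have 2: "star s = - wedge s w" .
    have "0 = ext_d A \<psi>2 i x" unfolding ext_d_dual by simp
    also have "\<dots> = \<beta> *\<^sub>C ext_d A \<psi>p i x + \<alpha> *\<^sub>C ext_d A \<psi>m i x"
      by (simp add: ext_d_form x diff[OF x] cov_diff_form)
    also have "\<dots> = wedge s0 (wedge (\<omega> i x) (\<omega> i x)) + wedge (\<pi>1 i x) (\<psi>2 i x) - wedge s (\<omega> i x)"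
      unfolding structure_equations
      by (rule ext) (simp add: s0_def s_def form_apply wedge_linear cscale_apply algebra_simps)
    finally have 3: "wedge s0 (wedge w w) + wedge (\<pi>1 i x) m - wedge s w = 0"
      unfolding w m by simp
    from type_decomposition[OF 1 2 3] show ?thesis by (simp add: s0_def s_def)
  qed
  have out: "(\<alpha> *\<^sub>F \<sigma>0 + \<beta> *\<^sub>F \<pi>0) i x = 0 \<and> \<pi>1 i x = 0 \<and> (\<alpha> *\<^sub>F \<sigma>2 + \<beta> *\<^sub>F \<pi>2) i x = 0"
    if "x \<notin> img A i" for i x
    using torsion_outside[OF that] by (simp add: form_apply)
  show "\<alpha> *\<^sub>F \<sigma>0 + \<beta> *\<^sub>F \<pi>0 = 0" "\<pi>1 = 0" "\<alpha> *\<^sub>F \<sigma>2 + \<beta> *\<^sub>F \<pi>2 = 0"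
    using * out by (intro ext; metis zero_fun_apply)+
qed

section \<open>The Laplacian of the dual 4-form in terms of the torsion\<close>

abbreviation "a \<equiv> \<alpha> *\<^sub>F \<pi>0 - \<beta> *\<^sub>F \<sigma>0"
abbreviation "\<tau> \<equiv> \<alpha> *\<^sub>F \<pi>2 - \<beta> *\<^sub>F \<sigma>2"
abbreviation "K1 \<equiv> (3/2) *\<^sub>F (a \<and>\<^sub>F \<psi>1) - su3_star \<omega> \<psi>p \<psi>m \<nu>3"
abbreviation "K2 \<equiv> 2 *\<^sub>F (a \<and>\<^sub>F \<omega>) + \<tau>"

lemma form_ext:
  fixes F G :: "('i, real^6) form"
  assumes "\<And>i x. x \<in> img A i \<Longrightarrow> F i x = G i x" "\<And>i x. x \<notin> img A i \<Longrightarrow> F i x = G i x"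
  shows "F = G"
proof (intro ext)
  fix i x vs
  show "F i x vs = G i x vs" using assms[of x i] by (cases "x \<in> img A i") simp_all
qed

lemma a_alt: "alt 0 (a i x)"
  using torsion_alt(1,2)[of i x] by (simp add: form_apply homog_diff homog_scale)

lemma tau_alt: "alt 2 (\<tau> i x)"
  using torsion_alt(5,6)[of i x] by (simp add: form_apply alt_diff alt_scale)

lemma ext_d_psi1: "ext_d A \<psi>1 = a \<and>\<^sub>F (\<omega> \<and>\<^sub>F \<omega>) - \<tau> \<and>\<^sub>F \<omega>"
proof (rule form_ext)
  fix i x assume x: "x \<in> img A i"
  have "ext_d A \<psi>1 i x = \<alpha> *\<^sub>C ext_d A \<psi>p i x - \<beta> *\<^sub>C ext_d A \<psi>m i x"
    by (simp add: ext_d_form x diff[OF x] cov_diff_form)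
  also have "\<dots> = (a \<and>\<^sub>F (\<omega> \<and>\<^sub>F \<omega>) - \<tau> \<and>\<^sub>F \<omega>) i x"
    unfolding structure_equations torsion_relations
    by (rule ext) (simp add: form_apply wedge_linear cscale_apply algebra_simps)
  finally show "ext_d A \<psi>1 i x = (a \<and>\<^sub>F (\<omega> \<and>\<^sub>F \<omega>) - \<tau> \<and>\<^sub>F \<omega>) i x" .
qed (simp add: ext_d_outside form_apply outside)

lemma ext_d_omega: "ext_d A \<omega> = (-3/2) *\<^sub>F (\<sigma>0 \<and>\<^sub>F \<psi>p) + (3/2) *\<^sub>F (\<pi>0 \<and>\<^sub>F \<psi>m) + \<nu>3"
  by (intro ext) (simp add: structure_equations nu1_eq_0 form_apply)

text \<open>The pair of functions (\<open>\<pi>0\<close>, \<open>\<sigma>0\<close>) is orthogonal to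
  (\<open>\<beta>\<close>, \<open>\<alpha>\<close>), hence \<open>a\<close> times
  (\<open>\<alpha>\<close>, \<open>-\<beta>\<close>).\<close>

lemma a_psi2: "a \<and>\<^sub>F \<psi>2 = \<pi>0 \<and>\<^sub>F \<psi>m - \<sigma>0 \<and>\<^sub>F \<psi>p"
proof (intro ext)
  fix i x vs
  define s p where "s = \<sigma>0 i x []" and "p = \<pi>0 i x []"
  have rel: "\<alpha> * s + \<beta> * p = 0"
    using fun_cong[OF fun_cong[OF fun_cong[OF torsion_relations(1), of i], of x], of "[]"]
    by (simp add: form_apply cscale_apply s_def p_def)
  have 1: "\<alpha> * \<alpha> + \<beta> * \<beta> = 1" using ab by (simp add: power2_eq_square)
  \<comment> \<open>Both identities are arranged so that the torsion relation and
    \<open>\<alpha> * \<alpha> + \<beta> * \<beta> = 1\<close> can be substituted.\<close>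
  have "(\<alpha> * p - \<beta> * s) * \<beta> = \<alpha> * (\<alpha> * s + \<beta> * p) - (\<alpha> * \<alpha> + \<beta> * \<beta>) * s"
    "(\<alpha> * p - \<beta> * s) * \<alpha> = (\<alpha> * \<alpha> + \<beta> * \<beta>) * p - \<beta> * (\<alpha> * s + \<beta> * p)"
    by algebra+
  then have c: "(\<alpha> * p - \<beta> * s) * \<beta> = - s" "(\<alpha> * p - \<beta> * s) * \<alpha> = p"
    unfolding rel 1 by simp_all
  have h: "homog 0 (a i x)" "homog 0 (\<pi>0 i x)" "homog 0 (\<sigma>0 i x)"
    using a_alt[of i x] torsion_alt(1,2)[of i x] by simp_all
  have "a i x [] = \<alpha> * p - \<beta> * s"
    by (simp add: form_apply cscale_apply s_def p_def)
  moreover have "(a \<and>\<^sub>F \<psi>2) i x vs = a i x [] * \<psi>2 i x vs"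
    by (simp only: form_wedge_apply wedge_homog_0[OF h(1)] cscale_apply)
  moreover have "\<psi>2 i x vs = \<beta> * \<psi>p i x vs + \<alpha> * \<psi>m i x vs"
    by (simp add: form_apply cscale_apply)
  ultimately have "(a \<and>\<^sub>F \<psi>2) i x vs = (\<alpha> * p - \<beta> * s) * (\<beta> * \<psi>p i x vs + \<alpha> * \<psi>m i x vs)"
    by (simp only:)
  also have "\<dots> = ((\<alpha> * p - \<beta> * s) * \<beta>) * \<psi>p i x vs + ((\<alpha> * p - \<beta> * s) * \<alpha>) * \<psi>m i x vs"
    by (simp only: distrib_left mult.assoc)
  also have "\<dots> = (\<pi>0 \<and>\<^sub>F \<psi>m - \<sigma>0 \<and>\<^sub>F \<psi>p) i x vs"
    unfolding c by (simp add: form_wedge_apply wedge_homog_0[OF h(2)] wedge_homog_0[OF h(3)] cscale_apply s_def p_def)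
  finally show "(a \<and>\<^sub>F \<psi>2) i x vs = (\<pi>0 \<and>\<^sub>F \<psi>m - \<sigma>0 \<and>\<^sub>F \<psi>p) i x vs" .
qed

text \<open>The factor \<open>- 1\<close> is the sign \<open>(-1) ^ (6 - 3)\<close> that the star on
  the product attaches to the \<open>ds\<close> part; it cancels the sign in the star of
  \<open>\<psi>2\<close>.\<close>

lemma star_ext_d_omega: "- 1 *\<^sub>F su3_star \<omega> \<psi>p \<psi>m (ext_d A \<omega>) = K1"
proof -
  have "ext_d A \<omega> = (3/2) *\<^sub>F (a \<and>\<^sub>F \<psi>2) + \<nu>3"
    unfolding ext_d_omega a_psi2 by (auto simp: fun_eq_iff form_scale_def algebra_simps)
  then have "su3_star \<omega> \<psi>p \<psi>m (ext_d A \<omega>) = (3/2) *\<^sub>F (a \<and>\<^sub>F (- \<psi>1)) + su3_star \<omega> \<psi>p \<psi>m \<nu>3"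
    by (simp only: su3_star_add[of _ \<nu>3] su3_star_scale[of "3/2"] su3_star_mult[OF a_alt] su3_star_forms(4))
  also have "a \<and>\<^sub>F (- \<psi>1) = - (a \<and>\<^sub>F \<psi>1)"
    by (intro ext) (simp add: form_wedge_def wedge_linear)
  finally have "su3_star \<omega> \<psi>p \<psi>m (ext_d A \<omega>) = (3/2) *\<^sub>F (- (a \<and>\<^sub>F \<psi>1)) + su3_star \<omega> \<psi>p \<psi>m \<nu>3" .
  moreover have "- 1 *\<^sub>F ((3/2) *\<^sub>F (- X) + N) = (3/2) *\<^sub>F X - N" for X N :: "('i, real^6) form"
    by (intro ext) (simp add: form_scale_def)
  ultimately show ?thesis by (simp only:)
qed

lemma star_tau: "su3_star \<omega> \<psi>p \<psi>m \<tau> = - (\<tau> \<and>\<^sub>F \<omega>)"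
  unfolding su3_star_diff su3_star_scale torsion_star
  by (intro ext) (simp add: form_apply wedge_linear cscale_apply algebra_simps)

text \<open>The square of \<open>\<omega>\<close> contributes twice \<open>\<omega>\<close>, and
  since the star is an involution on 2-forms, the eigenvalue equation for \<open>\<tau>\<close> can
  be inverted to give \<open>- \<tau>\<close> as the star of
  \<open>\<tau> \<and>\<^sub>F \<omega>\<close>.\<close>

lemma star_ext_d_psi1: "su3_star \<omega> \<psi>p \<psi>m (ext_d A \<psi>1) = K2"
proof -
  have "\<tau> \<and>\<^sub>F \<omega> = - su3_star \<omega> \<psi>p \<psi>m \<tau>" unfolding star_tau by simp
  moreover have "su3_star \<omega> \<psi>p \<psi>m (su3_star \<omega> \<psi>p \<psi>m \<tau>) = \<tau>"
    by (rule su3_star_star[OF tau_alt]) (simp add: form_apply torsion_outside)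
  ultimately have "su3_star \<omega> \<psi>p \<psi>m (\<tau> \<and>\<^sub>F \<omega>) = - \<tau>"
    by (simp only: su3_star_minus)
  moreover have "a \<and>\<^sub>F (2 *\<^sub>F \<omega>) = 2 *\<^sub>F (a \<and>\<^sub>F \<omega>)"
    by (intro ext) (simp add: form_apply wedge_linear)
  ultimately show ?thesis
    unfolding ext_d_psi1 su3_star_diff su3_star_mult[OF a_alt] su3_star_forms by (simp only: diff_minus_eq_add)
qed

lemma homog_K: "homog 2 (K2 i x)"
  using homog_wedge[of 0 "a i x" 2 "\<omega> i x"] a_alt[of i x] alt_homog[OF alt_forms(1)] alt_homog[OF tau_alt]
  by (simp only: form_scale_apply form_wedge_apply plus_fun_apply alt.simps add_0 homog_add homog_scale)

lemma diff_K:
  assumes "x \<in> img A i"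
  shows "cov_diff (K1 i) x" "cov_diff (K2 i) x"
  by ((intro cov_diff_form diff assms su3_star_cov_diff[OF torsion_forms(7)], simp)[],
      intro cov_diff_form diff assms)

text \<open>The star of \<open>\<Xi>\<close> is \<open>\<phi>\<close>, so the codifferential is, up
  to sign, the star of the derivative of \<open>\<phi>\<close>.\<close>

lemma codiff_Xi: "codiff Z (g2_metric \<phi>) (g2_volume \<phi>) 4 \<Xi> = P K1 + c *\<^sub>F (P K2 \<and>\<^sub>F S)"
proof -
  have "ext_d Z \<phi> = P (ext_d A \<psi>1) + c *\<^sub>F (P (ext_d A \<omega>) \<and>\<^sub>F S)"
    unfolding phi_eq by (intro ext_d_cyl cov_diff_form diff)
  moreover have "g2_star \<phi> (P (ext_d A \<psi>1) + c *\<^sub>F (P (ext_d A \<omega>) \<and>\<^sub>F S)) =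
      P ((-1) ^ (6 - 3) *\<^sub>F su3_star \<omega> \<psi>p \<psi>m (ext_d A \<omega>)) + c *\<^sub>F (P (su3_star \<omega> \<psi>p \<psi>m (ext_d A \<psi>1)) \<and>\<^sub>F S)"
  proof (rule g2_star_cyl)
    fix i x
    have 0: "alt (0 + k) (wedge s X)" if "alt 0 s" "alt k X" for k s and X :: "(real^6) list \<Rightarrow> real"
      by (rule alt_wedge[OF that])
    have "alt 4 (wedge (\<tau> i x) (\<omega> i x))"
      using alt_wedge[OF tau_alt alt_forms(1)] by simp
    then show "alt (Suc 3) (ext_d A \<psi>1 i x)"
      using 0[OF a_alt[of i x] alt_forms(6)[of i x]]
      unfolding ext_d_psi1 by (simp add: form_wedge_apply alt_diff)
    show "alt 3 (ext_d A \<omega> i x)"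
      using 0[OF torsion_alt(1)[of i x] alt_forms(2)[of i x]] 0[OF torsion_alt(2)[of i x] alt_forms(3)[of i x]]
        torsion_alt(7)[of i x]
      unfolding ext_d_omega by (simp add: form_apply alt_add alt_scale)
  qed simp
  moreover have "(-1) ^ (6 - 3) = (- 1 :: real)" by simp
  ultimately have "g2_star \<phi> (ext_d Z (g2_star \<phi> \<Xi>)) = P K1 + c *\<^sub>F (P K2 \<and>\<^sub>F S)"
    by (simp only: g2_star_Xi star_ext_d_omega star_ext_d_psi1)
  moreover have "codiff Z (g2_metric \<phi>) (g2_volume \<phi>) 4 \<Xi> =
      (-1) ^ (DIM((real^6) \<times> real) * (4 + 1) + 1) *\<^sub>F g2_star \<phi> (ext_d Z (g2_star \<phi> \<Xi>))"
    by (simp only: codiff_def g2_star_def)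
  \<comment> \<open>For 4-forms in dimension 7 the exponent is 36, so the codifferential carries no
    sign.\<close>
  moreover have "(-1) ^ (DIM((real^6) \<times> real) * (4 + 1) + 1) = (1 :: real)" by simp
  ultimately show ?thesis by (simp only: form_scale_one)
qed

lemma laplacian_Xi:
  "hodge_laplacian Z (g2_metric \<phi>) (g2_volume \<phi>) 4 \<Xi> = P (ext_d A K1) + c *\<^sub>F (P (ext_d A K2) \<and>\<^sub>F S)"
proof -
  have "codiff Z (g2_metric \<phi>) (g2_volume \<phi>) (4 + 1) (ext_d Z \<Xi>) = 0"
    by (simp only: ext_d_Xi codiff_def form_hodge_zero ext_d_zero form_scale_zero)
  then show ?thesis
    using ext_d_cyl[of K1 K2, OF diff_K] by (simp only: hodge_laplacian_def codiff_Xi add_0_right)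
qed

text \<open>The factor \<open>-2\<close> appears because the first equation of the system is about
  the square of \<open>\<omega>\<close>, whereas the dual 4-form contains half of it.\<close>

lemma ext_d_K1:
  "-2 *\<^sub>F ext_d A K1 = - 3 *\<^sub>F (a \<and>\<^sub>F a \<and>\<^sub>F \<omega> \<and>\<^sub>F \<omega>) + 3 *\<^sub>F (a \<and>\<^sub>F \<tau> \<and>\<^sub>F \<omega>)
    + 2 *\<^sub>F ext_d A (su3_star \<omega> \<psi>p \<psi>m \<nu>3) - 3 *\<^sub>F (ext_d A a \<and>\<^sub>F \<psi>1)"
proof (rule form_ext)
  fix i x assume x: "x \<in> img A i"
  have tw: "twist (a i x) = a i x"
    using homog_twist[of 0 "a i x"] a_alt[of i x] by simp
  have "ext_d A K1 i x = (3/2) *\<^sub>C (wedge (ext_d A a i x) (\<psi>1 i x) + wedge (a i x) (ext_d A \<psi>1 i x)) -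
      ext_d A (su3_star \<omega> \<psi>p \<psi>m \<nu>3) i x"
    by (subst ext_d_form(3)[OF x], intro cov_diff_form diff[OF x], rule su3_star_cov_diff[OF torsion_forms(7) _ x], simp,
        subst ext_d_form(1)[OF x], intro cov_diff_form diff[OF x], subst ext_d_form(4)[OF x],
        intro cov_diff_form diff[OF x], intro cov_diff_form diff[OF x], simp only: tw)
  then show "(-2 *\<^sub>F ext_d A K1) i x = (- 3 *\<^sub>F (a \<and>\<^sub>F a \<and>\<^sub>F \<omega> \<and>\<^sub>F \<omega>) + 3 *\<^sub>F (a \<and>\<^sub>F \<tau> \<and>\<^sub>F \<omega>)
    + 2 *\<^sub>F ext_d A (su3_star \<omega> \<psi>p \<psi>m \<nu>3) - 3 *\<^sub>F (ext_d A a \<and>\<^sub>F \<psi>1)) i x"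
    unfolding form_scale_apply[of "- 2"] ext_d_psi1
    by (intro ext) (simp add: form_scale_apply form_wedge_apply wedge_diff_right cscale_apply del: cscale_def, simp add: field_simps)
qed (simp add: ext_d_outside form_apply outside su3_star_outside torsion_outside)

text \<open>The coefficients 3 and 2 are twice those in \<open>ext_d_omega\<close>. The derivative
  of \<open>\<omega>\<close> is left in terms of \<open>\<sigma>0\<close>, \<open>\<pi>0\<close> and
  \<open>\<nu>3\<close>, as the second equation of the system has it.\<close>

lemma ext_d_K2:
  "- ext_d A K2 = - (a \<and>\<^sub>F (- 3 *\<^sub>F (\<sigma>0 \<and>\<^sub>F \<psi>p) + 3 *\<^sub>F (\<pi>0 \<and>\<^sub>F \<psi>m) + 2 *\<^sub>F \<nu>3))
    - ext_d A \<tau> - 2 *\<^sub>F (ext_d A a \<and>\<^sub>F \<omega>)"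
proof (rule form_ext)
  fix i x assume x: "x \<in> img A i"
  have tw: "twist (a i x) = a i x"
    using homog_twist[of 0 "a i x"] a_alt[of i x] by simp
  have "ext_d A K2 i x = 2 *\<^sub>C (wedge (ext_d A a i x) (\<omega> i x) + wedge (a i x) (ext_d A \<omega> i x)) + ext_d A \<tau> i x"
    by (subst ext_d_form(2)[OF x], intro cov_diff_form diff[OF x], intro cov_diff_form diff[OF x],
        subst ext_d_form(1)[OF x], intro cov_diff_form diff[OF x], subst ext_d_form(4)[OF x],
        intro cov_diff_form diff[OF x], intro cov_diff_form diff[OF x], simp only: tw)
  then show "(- ext_d A K2) i x = (- (a \<and>\<^sub>F (- 3 *\<^sub>F (\<sigma>0 \<and>\<^sub>F \<psi>p) + 3 *\<^sub>F (\<pi>0 \<and>\<^sub>F \<psi>m) + 2 *\<^sub>F \<nu>3))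
    - ext_d A \<tau> - 2 *\<^sub>F (ext_d A a \<and>\<^sub>F \<omega>)) i x"
    unfolding ext_d_omega
    by (intro ext) (simp add: form_scale_apply form_wedge_apply wedge_add_right wedge_scale_right cscale_apply)
qed (simp add: ext_d_outside form_apply outside torsion_outside)

end

section \<open>Time derivatives\<close>

lemma time_deriv_real:
  assumes "time_differentiable T F" "t \<in> T"
  shows "((\<lambda>s. F s i x vs) has_real_derivative time_deriv T F t i x vs) (at t within T)"
  using assms unfolding time_differentiable_def time_deriv_def has_real_derivative_iff_has_vector_derivative
  using vector_derivative_works by blast

lemma time_deriv_eqI:
  assumes "at t within T \<noteq> bot" "((\<lambda>s. F s i x vs) has_real_derivative D) (at t within T)"
  shows "time_deriv T F t i x vs = D"
  using vector_derivative_within[OF assms(1)] assms(2)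
  by (simp add: time_deriv_def has_real_derivative_iff_has_vector_derivative)

lemma time_differentiableI:
  assumes "\<And>t i x vs. t \<in> T \<Longrightarrow> \<exists>D. ((\<lambda>s. F s i x vs) has_real_derivative D) (at t within T)"
  shows "time_differentiable T F"
  using assms differentiableI_vector
  unfolding time_differentiable_def has_real_derivative_iff_has_vector_derivative by metis

lemma wedge_has_real_derivative:
  assumes "\<And>us. ((\<lambda>s. F s us) has_real_derivative F' us) (at t within T)"
    and "\<And>us. ((\<lambda>s. G s us) has_real_derivative G' us) (at t within T)"
  shows "((\<lambda>s. wedge (F s) (G s) us) has_real_derivative wedge F' (G t) us + wedge (F t) G' us) (at t within T)"
  unfolding wedge_def sum.distrib[symmetric]
proof (rule DERIV_sum)
  fix S
  show "((\<lambda>s. (- 1) ^ card {(i, j). i \<in> S \<and> j \<in> {..<length us} - S \<and> j < i} *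
            F s (nths us S) * G s (nths us ({..<length us} - S))) has_real_derivative
      (- 1) ^ card {(i, j). i \<in> S \<and> j \<in> {..<length us} - S \<and> j < i} *
            F' (nths us S) * G t (nths us ({..<length us} - S)) +
            (- 1) ^ card {(i, j). i \<in> S \<and> j \<in> {..<length us} - S \<and> j < i} *
            F t (nths us S) * G' (nths us ({..<length us} - S))) (at t within T)"
    by (rule derivative_eq_intros refl assms)+ (simp add: algebra_simps)
qed

text \<open>A nondegenerate interval accumulates at each of its points, endpoints included, so
  derivatives within it are unique.\<close>

lemma interval_not_bot:
  fixes T :: "real set"
  assumes "is_interval T" "interior T \<noteq> {}" "t \<in> T"
  shows "at t within T \<noteq> bot"
proof -
  have "T \<noteq> {x}" for x using assms(2) by auto
  then have "t islimpt T"
    using connected_imp_perfect[of T t] assms is_interval_connected by blast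
  then show ?thesis by (simp add: trivial_limit_within)
qed

context warped
begin

lemma minus_cyl: "- (P X + c *\<^sub>F (P Y \<and>\<^sub>F S)) = P (- X) + c *\<^sub>F (P (- Y) \<and>\<^sub>F S)"
proof (rule ext_eqI)
  fix i a z
  have neg: "(- F) i x = - (F i x)" for F :: "('k, 'e) form" and i x by (auto simp: fun_eq_iff)
  show "(- (P X + c *\<^sub>F (P Y \<and>\<^sub>F S))) (i, a) z = (P (- X) + c *\<^sub>F (P (- Y) \<and>\<^sub>F S)) (i, a) z"
    unfolding neg cyl_apply by (auto simp: lift_minus wedge_linear cscale_minus)
qed

lemma Xi_apply:
  "\<Xi> (i, a) z vs = (if z \<in> img Z (i, a) then
     (1/2) * (\<omega> \<and>\<^sub>F \<omega>) i (fst z) (map fst vs) + c * wedge (lift (\<psi>2 i (fst z))) ds vs else 0)"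
  by (simp add: form_apply cscale_apply) (simp add: lift_def form_wedge_apply)

end

section \<open>The equivalence of the flow with the system\<close>

theorem proposition3p6:
  fixes M :: "'m::{t2_space, second_countable_topology} set"
    and A :: "('i, 'm, real^6) atlas"
    and T :: "real set"
    and \<alpha> \<beta> :: real
    and f :: "real \<Rightarrow> real"
    and \<omega> \<psi>p \<psi>m \<sigma>0 \<pi>0 \<pi>1 \<nu>1 \<pi>2 \<sigma>2 \<nu>3 :: "real \<Rightarrow> ('i, real^6) form"
  assumes "smooth_manifold M A"
    and "is_interval T" and "interior T \<noteq> {}"
    and "\<alpha>\<^sup>2 + \<beta>\<^sup>2 = 1"
    and "\<And>t. t \<in> T \<Longrightarrow> su3_structure A (\<omega> t) (\<psi>p t) (\<psi>m t)"
    and "time_differentiable T \<omega>" and "time_differentiable T \<psi>p" and "time_differentiable T \<psi>m"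
    and "\<And>t. t \<in> T \<Longrightarrow> su3_torsion_forms A (\<omega> t) (\<psi>p t) (\<psi>m t)
           (\<sigma>0 t) (\<pi>0 t) (\<pi>1 t) (\<nu>1 t) (\<pi>2 t) (\<sigma>2 t) (\<nu>3 t)"
    and "\<And>t. t \<in> T \<Longrightarrow> f t \<noteq> 0"
    and "\<And>t. t \<in> T \<Longrightarrow> f differentiable (at t within T)"
    and "\<And>t. t \<in> T \<Longrightarrow> g2_coclosed (prod_atlas A circle_atlas)
           (warped_g2 A \<alpha> \<beta> (f t) (\<omega> t) (\<psi>p t) (\<psi>m t))"
  shows "(solves_laplacian_coflow (prod_atlas A circle_atlas) T
            (\<lambda>t. warped_g2 A \<alpha> \<beta> (f t) (\<omega> t) (\<psi>p t) (\<psi>m t))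
          \<longleftrightarrow>
          (\<forall>t\<in>T.
             time_deriv T (\<lambda>t. \<omega> t \<and>\<^sub>F \<omega> t) t =
               - 3 *\<^sub>F ((\<alpha> *\<^sub>F \<pi>0 t - \<beta> *\<^sub>F \<sigma>0 t) \<and>\<^sub>F (\<alpha> *\<^sub>F \<pi>0 t - \<beta> *\<^sub>F \<sigma>0 t) \<and>\<^sub>F \<omega> t \<and>\<^sub>F \<omega> t)
               + 3 *\<^sub>F ((\<alpha> *\<^sub>F \<pi>0 t - \<beta> *\<^sub>F \<sigma>0 t) \<and>\<^sub>F (\<alpha> *\<^sub>F \<pi>2 t - \<beta> *\<^sub>F \<sigma>2 t) \<and>\<^sub>F \<omega> t)
               + 2 *\<^sub>F ext_d A (su3_star (\<omega> t) (\<psi>p t) (\<psi>m t) (\<nu>3 t))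
               - 3 *\<^sub>F (ext_d A (\<alpha> *\<^sub>F \<pi>0 t - \<beta> *\<^sub>F \<sigma>0 t) \<and>\<^sub>F (\<alpha> *\<^sub>F \<psi>p t - \<beta> *\<^sub>F \<psi>m t))
             \<and>
             (vector_derivative f (at t within T) / f t) *\<^sub>F (\<beta> *\<^sub>F \<psi>p t + \<alpha> *\<^sub>F \<psi>m t)
               + (\<beta> *\<^sub>F time_deriv T \<psi>p t + \<alpha> *\<^sub>F time_deriv T \<psi>m t) =
               - ((\<alpha> *\<^sub>F \<pi>0 t - \<beta> *\<^sub>F \<sigma>0 t) \<and>\<^sub>F
                    (- 3 *\<^sub>F (\<sigma>0 t \<and>\<^sub>F \<psi>p t) + 3 *\<^sub>F (\<pi>0 t \<and>\<^sub>F \<psi>m t) + 2 *\<^sub>F \<nu>3 t))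
               - ext_d A (\<alpha> *\<^sub>F \<pi>2 t - \<beta> *\<^sub>F \<sigma>2 t)
               - 2 *\<^sub>F (ext_d A (\<alpha> *\<^sub>F \<pi>0 t - \<beta> *\<^sub>F \<sigma>0 t) \<and>\<^sub>F \<omega> t)))
         \<and> (\<forall>t\<in>T. \<alpha> *\<^sub>F \<sigma>0 t + \<beta> *\<^sub>F \<pi>0 t = 0 \<and> \<alpha> *\<^sub>F \<sigma>2 t + \<beta> *\<^sub>F \<pi>2 t = 0)"

proof -
  let ?Z = "prod_atlas A circle_atlas"
  let ?\<phi> = "\<lambda>t. warped_g2 A \<alpha> \<beta> (f t) (\<omega> t) (\<psi>p t) (\<psi>m t)"
  let ?\<psi>2 = "\<lambda>t. \<beta> *\<^sub>F \<psi>p t + \<alpha> *\<^sub>F \<psi>m t"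
  let ?D\<omega> = "time_deriv T (\<lambda>t. \<omega> t \<and>\<^sub>F \<omega> t)"
  \<comment> \<open>The time derivative of \<open>f t *\<^sub>F ?\<psi>2 t\<close> divided by
    \<open>f t\<close>: what remains of the \<open>ds\<close> part once its factor
    \<open>f t\<close> is taken out.\<close>
  let ?D\<psi> = "\<lambda>t. (vector_derivative f (at t within T) / f t) *\<^sub>F ?\<psi>2 t
               + (\<beta> *\<^sub>F time_deriv T \<psi>p t + \<alpha> *\<^sub>F time_deriv T \<psi>m t)"
  have loc: "coclosed_warped M A \<alpha> \<beta> (f t) (\<omega> t) (\<psi>p t) (\<psi>m t) (\<sigma>0 t) (\<pi>0 t) (\<pi>1 t) (\<nu>1 t) (\<pi>2 t) (\<sigma>2 t) (\<nu>3 t)"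
    if "t \<in> T" for t
    using assms(1,4) assms(5)[OF that] assms(9)[OF that] assms(10)[OF that] assms(12)[OF that]
    by unfold_locales auto
  have bot: "at t within T \<noteq> bot" if "t \<in> T" for t
    by (rule interval_not_bot[OF assms(2,3) that])
  have D\<omega>\<omega>: "((\<lambda>s. (\<omega> s \<and>\<^sub>F \<omega> s) i x vs) has_real_derivative ?D\<omega> t i x vs) (at t within T)" if "t \<in> T" for t i x vs
  proof -
    have "\<exists>D. ((\<lambda>s. (\<omega> s \<and>\<^sub>F \<omega> s) i x vs) has_real_derivative D) (at t within T)" if "t \<in> T" for t i x vs
      using wedge_has_real_derivative[where F = "\<lambda>s. \<omega> s i x" and G = "\<lambda>s. \<omega> s i x" and us = vs,
          OF time_deriv_real[OF assms(6) that] time_deriv_real[OF assms(6) that]]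
      unfolding form_wedge_apply by blast
    then have "time_differentiable T (\<lambda>s. \<omega> s \<and>\<^sub>F \<omega> s)" by (rule time_differentiableI)
    then show ?thesis using that by (rule time_deriv_real)
  qed
  have Df: "(f has_real_derivative vector_derivative f (at t within T)) (at t within T)" if "t \<in> T" for t
    using assms(11)[OF that] unfolding has_real_derivative_iff_has_vector_derivative
    by (simp add: vector_derivative_works)
  \<comment> \<open>Outside the chart images the forms vanish at all times in \<open>T\<close>,
    hence so do their derivatives within \<open>T\<close>. The comparison of the two parts by
    \<open>cyl_eq_iff\<close> asks for this and for the degree of \<open>?D\<psi>\<close>.\<close>
  have out: "?D\<omega> t i x = 0" "?D\<psi> t i x = 0" if "t \<in> T" "x \<notin> img A i" for t i x
  proof -
    have z: "time_deriv T F t i x = 0" if "\<And>s. s \<in> T \<Longrightarrow> F s i x = 0" for F :: "real \<Rightarrow> ('i, real^6) form"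
    proof
      fix vs
      have "((\<lambda>s. F s i x vs) has_real_derivative 0) (at t within T)"
        by (rule has_field_derivative_transform_within[OF DERIV_const zero_less_one \<open>t \<in> T\<close>]) (simp add: that)
      then show "time_deriv T F t i x vs = 0 vs"
        using time_deriv_eqI[OF bot[OF \<open>t \<in> T\<close>]] by simp
    qed
    have "\<omega> s i x = 0" "\<psi>p s i x = 0" "\<psi>m s i x = 0" if "s \<in> T" for s
    proof -
      interpret coclosed_warped M A \<alpha> \<beta> "f s" "\<omega> s" "\<psi>p s" "\<psi>m s" "\<sigma>0 s" "\<pi>0 s" "\<pi>1 s" "\<nu>1 s" "\<pi>2 s" "\<sigma>2 s" "\<nu>3 s"
        by (rule loc[OF that])
      show "\<omega> s i x = 0" "\<psi>p s i x = 0" "\<psi>m s i x = 0" using outside[OF \<open>x \<notin> img A i\<close>] by simp_all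
    qed
    with z[of \<psi>p] z[of \<psi>m] z[of "\<lambda>t. \<omega> t \<and>\<^sub>F \<omega> t"] \<open>t \<in> T\<close>
    show "?D\<omega> t i x = 0" "?D\<psi> t i x = 0" by (simp_all add: form_apply)
  qed
  have hom: "homog 3 (?D\<psi> t i x)" if "t \<in> T" for t i x
  proof -
    have z: "homog 3 (time_deriv T F t i x)" if "\<And>s. s \<in> T \<Longrightarrow> homog 3 (F s i x)" for F :: "real \<Rightarrow> ('i, real^6) form"
      unfolding homog_def
    proof (intro allI impI)
      fix vs :: "(real^6) list" assume "length vs \<noteq> 3"
      then have "((\<lambda>s. F s i x vs) has_real_derivative 0) (at t within T)"
        using that by (intro has_field_derivative_transform_within[OF DERIV_const zero_less_one \<open>t \<in> T\<close>])
          (simp add: homog_def)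
      then show "time_deriv T F t i x vs = 0"
        by (rule time_deriv_eqI[OF bot[OF \<open>t \<in> T\<close>]])
    qed
    have "homog 3 (\<psi>p s i x)" "homog 3 (\<psi>m s i x)" if "s \<in> T" for s
    proof -
      interpret coclosed_warped M A \<alpha> \<beta> "f s" "\<omega> s" "\<psi>p s" "\<psi>m s" "\<sigma>0 s" "\<pi>0 s" "\<pi>1 s" "\<nu>1 s" "\<pi>2 s" "\<sigma>2 s" "\<nu>3 s"
        by (rule loc[OF that])
      show "homog 3 (\<psi>p s i x)" "homog 3 (\<psi>m s i x)" using alt_forms(2,3) alt_homog by blast+
    qed
    with z[of \<psi>p] z[of \<psi>m] \<open>t \<in> T\<close> show ?thesis
      by (simp add: form_apply homog_add homog_scale)
  qed
  have D\<Xi>: "((\<lambda>s. g2_star (?\<phi> s) (?\<phi> s) (i, a) z vs) has_real_derivative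
      (pull_fst A circle_atlas ((1/2) *\<^sub>F ?D\<omega> t) +
       f t *\<^sub>F (pull_fst A circle_atlas (?D\<psi> t) \<and>\<^sub>F pull_snd A circle_atlas circle_ds)) (i, a) z vs) (at t within T)"
    if t: "t \<in> T" for t i a z vs
  proof -
    interpret t: coclosed_warped M A \<alpha> \<beta> "f t" "\<omega> t" "\<psi>p t" "\<psi>m t" "\<sigma>0 t" "\<pi>0 t" "\<pi>1 t" "\<nu>1 t" "\<pi>2 t" "\<sigma>2 t" "\<nu>3 t"
      by (rule loc[OF t])
    define w where "w s = wedge (lift (?\<psi>2 s i (fst z)) :: ((real^6) \<times> real) list \<Rightarrow> real) ds vs" for s
    \<comment> \<open>The formula for the dual 4-form is available only at times in
      \<open>T\<close>, where there is an SU(3)-structure. \<open>h\<close> is that formula at all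
      real times; its derivative within \<open>T\<close> is transferred to the dual 4-form by
      agreement on \<open>T\<close>.\<close>
    define h where "h s = (if z \<in> img ?Z (i, a) then
       (1/2) * (\<omega> s \<and>\<^sub>F \<omega> s) i (fst z) (map fst vs) + f s * w s else 0)" for s
    have h: "h s = g2_star (?\<phi> s) (?\<phi> s) (i, a) z vs" if "s \<in> T" for s
    proof -
      interpret s: coclosed_warped M A \<alpha> \<beta> "f s" "\<omega> s" "\<psi>p s" "\<psi>m s" "\<sigma>0 s" "\<pi>0 s" "\<pi>1 s" "\<nu>1 s" "\<pi>2 s" "\<sigma>2 s" "\<nu>3 s"
        by (rule loc[OF that])
      show ?thesis unfolding s.g2_star_phi s.Xi_apply h_def w_def ..
    qed
    define D2 where "D2 = (\<beta> *\<^sub>F time_deriv T \<psi>p t + \<alpha> *\<^sub>F time_deriv T \<psi>m t) i (fst z)"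
    have D2: "((\<lambda>s. lift (?\<psi>2 s i (fst z)) us) has_real_derivative lift D2 us) (at t within T)" for us :: "((real^6) \<times> real) list"
      unfolding D2_def lift_def
      by (auto simp: form_apply cscale_apply intro!: derivative_eq_intros time_deriv_real[OF assms(7) t] time_deriv_real[OF assms(8) t])
    have W: "(w has_real_derivative wedge (lift D2) ds vs) (at t within T)"
    proof -
      have "((\<lambda>s. ds us) has_real_derivative 0 us) (at t within T)" for us :: "((real^6) \<times> real) list" by simp
      from wedge_has_real_derivative[where F = "\<lambda>s. lift (?\<psi>2 s i (fst z))" and G = "\<lambda>s. ds" and G' = 0 and us = vs, OF D2 this] show ?thesis by (simp add: w_def[abs_def])
    qed
    have "(h has_real_derivative (if z \<in> img ?Z (i, a) then (1/2) * ?D\<omega> t i (fst z) (map fst vs) +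
       (vector_derivative f (at t within T) * w t + f t * wedge (lift D2) ds vs) else 0)) (at t within T)"
      unfolding h_def by (auto intro!: derivative_eq_intros D\<omega>\<omega>[OF t] Df[OF t] W)
    also have "(if z \<in> img ?Z (i, a) then (1/2) * ?D\<omega> t i (fst z) (map fst vs) +
       (vector_derivative f (at t within T) * w t + f t * wedge (lift D2) ds vs) else 0) =
       (t.P ((1/2) *\<^sub>F ?D\<omega> t) + f t *\<^sub>F (t.P (?D\<psi> t) \<and>\<^sub>F t.S)) (i, a) z vs"
    proof (cases "z \<in> img ?Z (i, a)")
      case True
      have e: "?D\<psi> t i (fst z) = (vector_derivative f (at t within T) / f t) *\<^sub>C ?\<psi>2 t i (fst z) + D2"
        by (simp add: D2_def form_apply)
      have lw: "wedge (lift (r *\<^sub>C X + Y)) (k *\<^sub>C ds) vs = k * (r * wedge (lift X) ds vs + wedge (lift Y) ds vs)"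
        for r k and X Y :: "(real^6) list \<Rightarrow> real"
        by (simp add: lift_add lift_scale wedge_linear cscale_apply)
      show ?thesis
        unfolding t.cyl_apply e w_def using True t.c
        by (simp only: if_True plus_fun_apply lw)
          (simp add: lift_def form_scale_apply cscale_apply field_simps)
    next
      case False
      then show ?thesis unfolding t.cyl_apply by simp
    qed
    finally have "(h has_real_derivative (t.P ((1/2) *\<^sub>F ?D\<omega> t) + f t *\<^sub>F (t.P (?D\<psi> t) \<and>\<^sub>F t.S)) (i, a) z vs) (at t within T)" .
    then show ?thesis
      by (rule has_field_derivative_transform_within[OF _ zero_less_one t]) (rule h)
  qed
  have tdiff: "time_differentiable T (\<lambda>t. g2_star (?\<phi> t) (?\<phi> t))"
  proof (rule time_differentiableI)
    fix t I z vs assume "t \<in> T"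
    then show "\<exists>D. ((\<lambda>s. g2_star (?\<phi> s) (?\<phi> s) I z vs) has_real_derivative D) (at t within T)"
      using D\<Xi>[of t "fst I" "snd I" z vs] by auto
  qed
  have step: "time_deriv T (\<lambda>t. g2_star (?\<phi> t) (?\<phi> t)) t =
      - hodge_laplacian ?Z (g2_metric (?\<phi> t)) (g2_volume (?\<phi> t)) 4 (g2_star (?\<phi> t) (?\<phi> t)) \<longleftrightarrow>
    ?D\<omega> t =
               - 3 *\<^sub>F ((\<alpha> *\<^sub>F \<pi>0 t - \<beta> *\<^sub>F \<sigma>0 t) \<and>\<^sub>F (\<alpha> *\<^sub>F \<pi>0 t - \<beta> *\<^sub>F \<sigma>0 t) \<and>\<^sub>F \<omega> t \<and>\<^sub>F \<omega> t)
               + 3 *\<^sub>F ((\<alpha> *\<^sub>F \<pi>0 t - \<beta> *\<^sub>F \<sigma>0 t) \<and>\<^sub>F (\<alpha> *\<^sub>F \<pi>2 t - \<beta> *\<^sub>F \<sigma>2 t) \<and>\<^sub>F \<omega> t)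
               + 2 *\<^sub>F ext_d A (su3_star (\<omega> t) (\<psi>p t) (\<psi>m t) (\<nu>3 t))
               - 3 *\<^sub>F (ext_d A (\<alpha> *\<^sub>F \<pi>0 t - \<beta> *\<^sub>F \<sigma>0 t) \<and>\<^sub>F (\<alpha> *\<^sub>F \<psi>p t - \<beta> *\<^sub>F \<psi>m t)) \<and>
    ?D\<psi> t = - ((\<alpha> *\<^sub>F \<pi>0 t - \<beta> *\<^sub>F \<sigma>0 t) \<and>\<^sub>F
                    (- 3 *\<^sub>F (\<sigma>0 t \<and>\<^sub>F \<psi>p t) + 3 *\<^sub>F (\<pi>0 t \<and>\<^sub>F \<psi>m t) + 2 *\<^sub>F \<nu>3 t))
               - ext_d A (\<alpha> *\<^sub>F \<pi>2 t - \<beta> *\<^sub>F \<sigma>2 t)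
               - 2 *\<^sub>F (ext_d A (\<alpha> *\<^sub>F \<pi>0 t - \<beta> *\<^sub>F \<sigma>0 t) \<and>\<^sub>F \<omega> t)"
    if t: "t \<in> T" for t
  proof -
    interpret coclosed_warped M A \<alpha> \<beta> "f t" "\<omega> t" "\<psi>p t" "\<psi>m t" "\<sigma>0 t" "\<pi>0 t" "\<pi>1 t" "\<nu>1 t" "\<pi>2 t" "\<sigma>2 t" "\<nu>3 t"
      by (rule loc[OF t])
    have td: "time_deriv T (\<lambda>t. g2_star (?\<phi> t) (?\<phi> t)) t = P ((1/2) *\<^sub>F ?D\<omega> t) + f t *\<^sub>F (P (?D\<psi> t) \<and>\<^sub>F S)"
    proof (rule ext_eqI, rule ext)
      fix i a z vs
      show "time_deriv T (\<lambda>t. g2_star (?\<phi> t) (?\<phi> t)) t (i, a) z vs = (P ((1/2) *\<^sub>F ?D\<omega> t) + f t *\<^sub>F (P (?D\<psi> t) \<and>\<^sub>F S)) (i, a) z vs"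
        by (rule time_deriv_eqI[OF bot[OF t]]) (rule D\<Xi>[OF t])
    qed
    have "homog 3 ((- ext_d A K2) i x)" for i x
    proof -
      have "homog 3 (ext_d A K2 i x)" using homog_ext_d[of 2 K2 i A x] homog_K by simp
      then show ?thesis by (simp add: homog_def)
    qed
    then have "P ((1/2) *\<^sub>F ?D\<omega> t) + f t *\<^sub>F (P (?D\<psi> t) \<and>\<^sub>F S) = P (- ext_d A K1) + f t *\<^sub>F (P (- ext_d A K2) \<and>\<^sub>F S) \<longleftrightarrow>
        (1/2) *\<^sub>F ?D\<omega> t = - ext_d A K1 \<and> ?D\<psi> t = - ext_d A K2"
    proof (intro cyl_eq_iff)
      fix i x assume x: "x \<notin> img A i"
      show "((1/2) *\<^sub>F ?D\<omega> t) i x = (- ext_d A K1) i x"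
        using out(1)[OF t x] ext_d_outside[OF x, of K1] by (simp add: form_scale_def fun_eq_iff)
      show "?D\<psi> t i x = (- ext_d A K2) i x"
        unfolding out(2)[OF t x] using ext_d_outside[OF x, of K2] by (simp add: fun_eq_iff)
    qed (use hom[OF t] in auto)
    moreover have "(1/2) *\<^sub>F X = - Y \<longleftrightarrow> X = -2 *\<^sub>F Y" for X Y :: "('i, real^6) form"
    proof -
      have "(1/2) * u = - v \<longleftrightarrow> u = -2 * v" for u v :: real by auto
      then show ?thesis by (simp only: fun_eq_iff form_scale_def uminus_apply)
    qed
    ultimately show ?thesis
      unfolding td g2_star_phi laplacian_Xi minus_cyl by (simp only: ext_d_K1 ext_d_K2)
  qed
  \<comment> \<open>The remaining clauses of the flow hold at every time in \<open>T\<close>, so the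
    equivalence comes down to the evolution equation; the torsion relations hold on either side of
    it.\<close>
  have "g2_structure ?Z (?\<phi> t) \<and> \<alpha> *\<^sub>F \<sigma>0 t + \<beta> *\<^sub>F \<pi>0 t = 0 \<and> \<alpha> *\<^sub>F \<sigma>2 t + \<beta> *\<^sub>F \<pi>2 t = 0" if "t \<in> T" for t
  proof -
    interpret coclosed_warped M A \<alpha> \<beta> "f t" "\<omega> t" "\<psi>p t" "\<psi>m t" "\<sigma>0 t" "\<pi>0 t" "\<pi>1 t" "\<nu>1 t" "\<pi>2 t" "\<sigma>2 t" "\<nu>3 t"
      by (rule loc[OF that])
    show ?thesis using torsion_relations g2_structure_phi by blast
  qed
  then show ?thesis
    unfolding solves_laplacian_coflow_def using tdiff assms(12) step by blast
qed

end
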